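(* Let $k,n$ be positive integers, $m=kn$, and let $a,b$ be positive integers with $ma=nb$. Let $\mathbf r=(a,\dots,a)\in\mathbb Z^m$, $\mathbf c=(b,\dots,b)\in\mathbb Z^n$, and let $\mathcal T(\mathbf r,\mathbf c)$ be the corresponding transportation polytope. Let $\mathrm{ST}_{k,n}$ be the set of spanning trees $T$ of $K_{kn,n}$ with right degree sequence $(k+1,k+1,\dots,k+1,k)$. Then for every vertex $M$ of $\mathcal T(\mathbf r,\mathbf c)$, \[ f(\mathrm{fcone}(\mathcal T(\mathbf r,\mathbf c),M),\mathbf z)=\sum_{T\in \mathrm{PertAux}(M)}\ \prod_{e\notin E(T)}\frac{1}{1-\mathbf z^{\mathrm{cyc}(T,e)}},\] where $\mathrm{PertAux}(M)=\{T\in\mathrm{ST}_{k,n} : \operatorname{aux}(M)\text{ is a subgraph of } T\}$. Moreover, \[ f(\mathcal T(\mathbf r,\mathbf c),\mathbf z)=\sum_{T\in\mathrm{ST}_{k,n}}\mathbf z^{M_T}\prod_{e\notin E(T)}\frac{1}{1-\mathbf z^{\mathrm{cyc}(T,e)}},\] where for $T\in \mathrm{ST}_{k,n}$, $M_T$ is the unique vertex of $\mathcal T(\mathbf r,\mathbf c)$ whose auxiliary graph is a subgraph of $T$.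
   Context: For positive vectors $\mathbf r\in\mathbb R^m$, $\mathbf c\in\mathbb R^n$ with equal coordinate sums, the transportation polytope $\mathcal T(\mathbf r,\mathbf c)\subseteq\mathbb R^{m\times n}$ is the set of nonnegative real $m\times n$ matrices whose $i$th row sums to $r_i$ and whose $j$th column sums to $c_j$. $K_{m,n}$ is the complete bipartite graph with left vertices $u_1,\dots,u_m$, right vertices $w_1,\dots,w_n$, and $e_{i,j}$ the edge joining $u_i$ and $w_j$; $E(G)$ is the edge set of a subgraph $G$. The right degree sequence of a subgraph $G$ is $(d_1,\dots,d_n)$ where $d_j$ is the number of edges of $G$ at $w_j$. The auxiliary graph $\operatorname{aux}(M)$ of a matrix $M$ is the spanning subgraph of $K_{m,n}$ with edge set $\{e_{i,j}: M(i,j)>0\}$. For a spanning tree $T$ of $K_{m,n}$ and an edge $e\notin E(T)$, $T\cup e$ has a unique cycle, which written starting from $e$ is $e=e_{i_1,j_1},e_{i_2,j_1},e_{i_2,j_2},\dots,e_{i_s,j_s},e_{i_1,j_s}$; $\mathrm{cyc}(T,e)$ is the $m\times n$ matrix with entry $1$ at positions $(i_1,j_1),\dots,(i_s,j_s)$, entry $-1$ at positions $(i_2,j_1),(i_3,j_2),\dots,(i_1,j_s)$, and $0$ elsewhere. The feasible cone is $\mathrm{fcone}(P,v)=\{u: v+\delta u\in P \text{ for all sufficiently small }\delta>0\}$. Coordinates are indexed by $(i,j)$ and $\mathbf z^X=\prod_{i,j}z_{i,j}^{X(i,j)}$. For a rational polyhedron $Q$, $f(Q,\mathbf z)$ is its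 multivariate generating function: the unique rational function such that $Q\mapsto f(Q,\mathbf z)$ is a valuation, $f(Q,\mathbf z)=\sum_{\alpha\in Q\cap\mathbb Z^{mn}}\mathbf z^\alpha$ wherever this converges absolutely if $Q$ is pointed, and $f(Q,\mathbf z)=0$ if $Q$ contains a line. *)

theory Defs
  imports
    "HOL-Analysis.Analysis"
    "HOL-Library.Poly_Mapping"
    "HOL-Computational_Algebra.Fraction_Field"
begin

(* The index types 'm and 'n play the roles of {1..m} and {1..n}. Their linear orders label the
   vertices of the bipartite graph (so that there is a last right vertex), and they make the
   Laurent polynomials below an integral domain. *)


section \<open>Subgraphs of the complete bipartite graph\<close>

(* A spanning subgraph of the complete bipartite graph with left vertices Inl i and right vertices
   Inr j is given by its edge set; the pair (i, j) stands for the edge joining Inl i and Inr j. *)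

definition bip_adj :: "('m \<times> 'n) set \<Rightarrow> (('m + 'n) \<times> ('m + 'n)) set" where
  "bip_adj E = {(Inl i, Inr j) |i j. (i, j) \<in> E} \<union> {(Inr j, Inl i) |i j. (i, j) \<in> E}"

definition bip_connected :: "('m \<times> 'n) set \<Rightarrow> bool" where
  "bip_connected E \<longleftrightarrow> (\<forall>x y. (x, y) \<in> (bip_adj E)\<^sup>*)"

(* With is = [i_1, ..., i_s] and js = [j_1, ..., j_s] this is the cycle with edges
   (i_1, j_1), (i_2, j_1), (i_2, j_2), ..., (i_s, j_s), (i_1, j_s). *)
definition bip_cycle :: "('m \<times> 'n) set \<Rightarrow> 'm list \<Rightarrow> 'n list \<Rightarrow> bool" where
  "bip_cycle E is js \<longleftrightarrow>
     length is = length js \<and> 2 \<le> length is \<and> distinct is \<and> distinct js \<and>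
     (\<forall>t < length is. (is ! t, js ! t) \<in> E \<and> (is ! (Suc t mod length is), js ! t) \<in> E)"

definition spanning_tree :: "('m \<times> 'n) set \<Rightarrow> bool" where
  "spanning_tree T \<longleftrightarrow> bip_connected T \<and> (\<nexists>is js. bip_cycle T is js)"

definition right_degree :: "('m \<times> 'n) set \<Rightarrow> 'n \<Rightarrow> nat" where
  "right_degree E j = card {e \<in> E. snd e = j}"

definition ST :: "nat \<Rightarrow> ('m::finite \<times> 'n::{finite, linorder}) set set" where
  "ST k = {T. spanning_tree T \<and>
              (\<forall>j. right_degree T j = (if j = Max UNIV then k else k + 1))}"

(* Requiring the cycle to start with the edge e also fixes its direction, because its second edge
   has to share the right endpoint of e. *)
definition cyc :: "('m::finite \<times> 'n::finite) set \<Rightarrow> 'm \<times> 'n \<Rightarrow> int ^ 'n ^ 'm" where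
  "cyc T e =
     (let (is, js) = (THE (is, js). bip_cycle (insert e T) is js \<and> (hd is, hd js) = e)
      in \<chi> i j. if \<exists>t < length is. i = is ! t \<and> j = js ! t then 1
               else if \<exists>t < length is. i = is ! (Suc t mod length is) \<and> j = js ! t then - 1
               else 0)"


section \<open>Transportation polytopes\<close>

definition transportation_polytope ::
    "real ^ 'm::finite \<Rightarrow> real ^ 'n::finite \<Rightarrow> (real ^ 'n ^ 'm) set" where
  "transportation_polytope r c =
     {X. (\<forall>i j. 0 \<le> X $ i $ j) \<and>
         (\<forall>i. (\<Sum>j\<in>UNIV. X $ i $ j) = r $ i) \<and>
         (\<forall>j. (\<Sum>i\<in>UNIV. X $ i $ j) = c $ j)}"

definition aux :: "real ^ 'n::finite ^ 'm::finite \<Rightarrow> ('m \<times> 'n) set" where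
  "aux M = {(i, j). 0 < M $ i $ j}"

definition PertAux ::
    "nat \<Rightarrow> real ^ 'n::{finite, linorder} ^ 'm::finite \<Rightarrow> ('m \<times> 'n) set set" where
  "PertAux k M = {T \<in> ST k. aux M \<subseteq> T}"

definition tree_vertex ::
    "(real ^ 'n::finite ^ 'm::finite) set \<Rightarrow> ('m \<times> 'n) set \<Rightarrow> real ^ 'n ^ 'm" where
  "tree_vertex P T = (THE M. M extreme_point_of P \<and> aux M \<subseteq> T)"

definition fcone :: "'a::real_normed_vector set \<Rightarrow> 'a \<Rightarrow> 'a set" where
  "fcone P v = {u. \<forall>\<^sub>F \<delta> in at_right 0. v + \<delta> *\<^sub>R u \<in> P}"


section \<open>Laurent polynomials and rational functions in the matrix variables\<close>

(* A Laurent polynomial maps an exponent matrix (row index, then column index) to the coefficient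
   of the corresponding monomial. *)
type_synonym ('m, 'n) laurent = "('m \<Rightarrow>\<^sub>0 'n \<Rightarrow>\<^sub>0 int) \<Rightarrow>\<^sub>0 complex"

definition exponent :: "int ^ 'n::finite ^ 'm::finite \<Rightarrow> 'm \<Rightarrow>\<^sub>0 'n \<Rightarrow>\<^sub>0 int" where
  "exponent X = Abs_poly_mapping (\<lambda>i. Abs_poly_mapping (\<lambda>j. X $ i $ j))"

definition zpow ::
    "int ^ 'n::{finite, linorder} ^ 'm::{finite, linorder} \<Rightarrow> ('m, 'n) laurent fract" where
  "zpow X = Fract (Poly_Mapping.single (exponent X) 1) 1"

definition const_rat ::
    "complex \<Rightarrow> ('m::{finite, linorder}, 'n::{finite, linorder}) laurent fract" where
  "const_rat a = Fract (Poly_Mapping.single 0 a) 1"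

definition laurent_eval ::
    "('m::finite, 'n::finite) laurent \<Rightarrow> complex ^ 'n ^ 'm \<Rightarrow> complex" where
  "laurent_eval p z =
     (\<Sum>X\<in>Poly_Mapping.keys p. Poly_Mapping.lookup p X *
        (\<Prod>i\<in>UNIV. \<Prod>j\<in>UNIV. z $ i $ j powi Poly_Mapping.lookup (Poly_Mapping.lookup X i) j))"

definition monom_eval ::
    "int ^ 'n::finite ^ 'm::finite \<Rightarrow> complex ^ 'n ^ 'm \<Rightarrow> complex" where
  "monom_eval X z = (\<Prod>i\<in>UNIV. \<Prod>j\<in>UNIV. z $ i $ j powi (X $ i $ j))"


section \<open>Multivariate generating functions of rational polyhedra\<close>

definition real_mat :: "int ^ 'n ^ 'm \<Rightarrow> real ^ 'n ^ 'm" where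
  "real_mat X = (\<chi> i j. of_int (X $ i $ j))"

definition rational_polyhedron :: "(real ^ 'n::finite ^ 'm::finite) set \<Rightarrow> bool" where
  "rational_polyhedron Q \<longleftrightarrow>
     (\<exists>H. finite H \<and> Q = \<Inter> H \<and>
        (\<forall>h\<in>H. \<exists>a b. a \<noteq> 0 \<and> (\<forall>i j. a $ i $ j \<in> \<rat>) \<and> b \<in> \<rat> \<and> h = {x. a \<bullet> x \<le> b}))"

definition contains_line :: "'a::real_vector set \<Rightarrow> bool" where
  "contains_line Q \<longleftrightarrow> (\<exists>x v. v \<noteq> 0 \<and> (\<forall>t. x + t *\<^sub>R v \<in> Q))"

(* The first clause is linearity on the real vector space spanned by the indicator functions of
   rational polyhedra. The last clause is an identity of rational functions: it is read at the
   points z of the torus where the series converges absolutely and a representation p/q of F Q can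
   be evaluated. *)
definition is_gen_fun ::
    "((real ^ 'n::{finite, linorder} ^ 'm::{finite, linorder}) set \<Rightarrow> ('m, 'n) laurent fract)
      \<Rightarrow> bool" where
  "is_gen_fun F \<longleftrightarrow>
     (\<forall>\<Q> \<alpha>. finite \<Q> \<and> (\<forall>Q\<in>\<Q>. rational_polyhedron Q) \<and>
            (\<forall>x. (\<Sum>Q\<in>\<Q>. \<alpha> Q * indicator Q x) = (0::real))
        \<longrightarrow> (\<Sum>Q\<in>\<Q>. const_rat (of_real (\<alpha> Q)) * F Q) = 0) \<and>
     (\<forall>Q. rational_polyhedron Q \<and> contains_line Q \<longrightarrow> F Q = 0) \<and>
     (\<forall>Q z p q. rational_polyhedron Q \<and> \<not> contains_line Q \<and> (\<forall>i j. z $ i $ j \<noteq> 0) \<and>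
            (\<lambda>\<alpha>. norm (monom_eval \<alpha> z)) summable_on {\<alpha>. real_mat \<alpha> \<in> Q} \<and>
            F Q = Fract p q \<and> laurent_eval q z \<noteq> 0
        \<longrightarrow> laurent_eval p z / laurent_eval q z =
              infsum (\<lambda>\<alpha>. monom_eval \<alpha> z) {\<alpha>. real_mat \<alpha> \<in> Q})"

(* Such an F exists and is unique on rational polyhedra (Lawrence, Khovanskii-Pukhlikov, Barvinok);
   its values on other sets are irrelevant. *)
definition gen_fun ::
    "(real ^ 'n::{finite, linorder} ^ 'm::{finite, linorder}) set \<Rightarrow> ('m, 'n) laurent fract" where
  "gen_fun = (SOME F. is_gen_fun F)"

end

theory Submission
  imports Defs
begin

text \<open>
  Formal Laurent series, i.e. arbitrary functions on the lattice, form a module over the Laurent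
  polynomials. If \<open>q * s = p\<close> with \<open>q \<noteq> 0\<close>, then \<open>p / q\<close> depends only on \<open>s\<close> because there are no zero
  divisors. This assigns a rational function to each series that has such a \<open>q\<close>; the assignment is
  linear, and it sends every series with a period to \<open>0\<close>. The lattice points of a rational polyhedron
  form such a series: by Dickson's lemma an infinite set of lattice points has a recession vector
  \<open>u\<close>, and \<open>1 - z\<^sup>u\<close> reduces the series to finitely many slices whose recession cones have smaller
  dimension. This yields the generating functions, and on pointed flow polyhedra they are determined
  by their values on the curves \<open>t \<mapsto> (t\<^sup>v)\<close> with a generic integral weight \<open>v\<close>.

  For the formula itself the margins are perturbed so that the vertices of the polyhedron become
  simple, without changing the lattice points. A vertex then corresponds to a spanning tree whose
  perturbed flow is positive, which means that its right degree sequence is \<open>(k+1, \<dots>, k+1, k)\<close>. The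
  tangent cone at the vertex of \<open>T\<close> is unimodular with generators \<open>cyc T e\<close>.
\<close>

section \<open>Formal Laurent series as a module over Laurent polynomials\<close>

text \<open>For \<open>n > 1\<close> the vertices are degenerate: a vertex has one nonzero entry in
  each row, so \<open>aux M\<close> is a disconnected forest contained in many spanning trees. No
  perturbed polyhedron is constructed to resolve this. The proof works with the sets
  \<open>relaxed_points k s G\<close>, in which the sign conditions on the edges of \<open>G\<close>
  are dropped. The polytope (\<open>G = {}\<close>), the feasible cone (\<open>s = 0\<close>,
  \<open>G = aux M\<close>) and the simplicial cone of a tree (\<open>G = T\<close>) all have this
  form, so one induction on the complement of \<open>G\<close> yields both identities. The
  perturbation enters through the signs of \<open>pert_excess\<close> on cuts: it vanishes only on
  trivial cuts, and where it is positive the unperturbed excess is nonnegative. With N = n + 1 the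
  corrections to a multiple of N are at most n in absolute value, which gives both properties.
  Lowering the last column alone by n is what turns positivity on all tree edges into the degree
  sequence. Finally, \<open>gen_fun\<close> is an arbitrary choice subject to
  \<open>is_gen_fun\<close>, so a formally computed value must still be transferred to it through
  points of absolute convergence.\<close>

definition act :: "('k::ab_group_add \<Rightarrow>\<^sub>0 'c::comm_ring_1) \<Rightarrow> ('k \<Rightarrow> 'c) \<Rightarrow> 'k \<Rightarrow> 'c" where
  "act p s X = (\<Sum>Y\<in>Poly_Mapping.keys p. Poly_Mapping.lookup p Y * s (X - Y))"

lemma act_superset:
  assumes "finite A" "Poly_Mapping.keys p \<subseteq> A"
  shows "act p s X = (\<Sum>Y\<in>A. Poly_Mapping.lookup p Y * s (X - Y))"
  unfolding act_def by (rule sum.mono_neutral_left) (use assms in \<open>auto simp: in_keys_iff\<close>)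

lemma act_add_left: "act (p + q) s X = act p s X + act q s X"
proof -
  have "Poly_Mapping.keys (p + q) \<subseteq> Poly_Mapping.keys p \<union> Poly_Mapping.keys q"
    by (rule keys_add)
  then show ?thesis
    by (simp add: act_superset[of "Poly_Mapping.keys p \<union> Poly_Mapping.keys q"] lookup_add
        distrib_right sum.distrib)
qed

lemma act_zero_left [simp]: "act 0 s X = 0"
  by (simp add: act_def)

lemma act_single: "act (Poly_Mapping.single Y c) s X = c * s (X - Y)"
  by (simp add: act_superset[of "{Y}"])

lemma act_one [simp]: "act 1 s = s"
  by (rule ext) (simp flip: single_one add: act_single)

lemma act_uminus_left: "act (- p) s X = - act p s X"
  by (simp add: act_def sum_negf)

lemma act_diff_left: "act (p - q) s X = act p s X - act q s X"
  using act_add_left[of p "- q"] by (simp add: act_uminus_left)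

lemma act_add_right: "act p (\<lambda>X. s X + s' X) X = act p s X + act p s' X"
  by (simp add: act_def distrib_left sum.distrib)

lemma act_zero_right [simp]: "act p (\<lambda>X. 0) = (\<lambda>X. 0)"
  by (simp add: act_def fun_eq_iff)

lemma poly_mapping_add_induct [case_names zero add]:
  fixes p :: "'k \<Rightarrow>\<^sub>0 'c::comm_monoid_add"
  assumes "P 0" "\<And>p Y c. P p \<Longrightarrow> P (Poly_Mapping.single Y c + p)"
  shows "P p"
proof -
  have "P (\<Sum>Y\<in>A. Poly_Mapping.single Y (Poly_Mapping.lookup p Y))" if "finite A" for A
    using that by induction (use assms in auto)
  moreover have "(\<Sum>Y\<in>Poly_Mapping.keys p. Poly_Mapping.single Y (Poly_Mapping.lookup p Y)) = p"
    by (rule poly_mapping_eqI) (auto simp: lookup_sum lookup_single when_def in_keys_iff)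
  ultimately show ?thesis
    by (metis finite_keys)
qed

lemma act_mult: "act (p * q) s = act p (act q s)"
proof (induction p rule: poly_mapping_add_induct)
  case zero
  then show ?case by (simp add: fun_eq_iff)
next
  case (add p Y c)
  have "act (Poly_Mapping.single Y c * q) s = act (Poly_Mapping.single Y c) (act q s)"
  proof (induction q rule: poly_mapping_add_induct)
    case zero
    then show ?case by (simp add: fun_eq_iff)
  next
    case (add q Z d)
    then show ?case
      by (simp add: fun_eq_iff distrib_left act_add_left act_single mult_single algebra_simps)
  qed
  with add show ?case
    by (simp add: fun_eq_iff distrib_right act_add_left)
qed

lemma act_lookup: "act p (Poly_Mapping.lookup q) = Poly_Mapping.lookup (p * q)"
proof -
  \<comment> \<open>The finitely supported series are exactly the multiples of the unit series
    \<open>Poly_Mapping.lookup 1\<close>, so the claim reduces to \<open>act_mult\<close>.\<close>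
  have *: "act p (Poly_Mapping.lookup 1) = Poly_Mapping.lookup p" for p :: "'k::ab_group_add \<Rightarrow>\<^sub>0 'c::comm_ring_1"
  proof
    fix X
    have "act p (Poly_Mapping.lookup 1) X =
        (\<Sum>Y\<in>Poly_Mapping.keys p. if Y = X then Poly_Mapping.lookup p Y else 0)"
      unfolding act_def by (rule sum.cong) (auto simp: lookup_one when_def)
    also have "\<dots> = Poly_Mapping.lookup p X"
      by (simp add: sum.delta in_keys_iff)
    finally show "act p (Poly_Mapping.lookup 1) X = Poly_Mapping.lookup p X" .
  qed
  show ?thesis
    by (metis * act_mult)
qed

subsection \<open>Rational functions of formal series\<close>

definition has_fract ::
    "('k::linordered_ab_group_add \<Rightarrow> complex) \<Rightarrow> ('k \<Rightarrow>\<^sub>0 complex) fract \<Rightarrow> bool" where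
  "has_fract s f \<longleftrightarrow> (\<exists>p q. q \<noteq> 0 \<and> act q s = Poly_Mapping.lookup p \<and> f = Fract p q)"

lemma has_fract_unique:
  assumes "has_fract s f" "has_fract s g"
  shows "f = g"
proof -
  from assms obtain p q p' q' where *: "q \<noteq> 0" "act q s = Poly_Mapping.lookup p" "f = Fract p q"
    "q' \<noteq> 0" "act q' s = Poly_Mapping.lookup p'" "g = Fract p' q'"
    unfolding has_fract_def by blast
  have "Poly_Mapping.lookup (q' * p) = act (q' * q) s"
    using * by (metis act_lookup act_mult)
  also have "\<dots> = Poly_Mapping.lookup (q * p')"
    using * by (metis act_lookup act_mult mult.commute)
  finally have "q' * p = q * p'"
    by (simp add: poly_mapping_eqI)
  then show ?thesis
    using * by (simp add: eq_fract mult.commute)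
qed

lemma has_fract_zero [simp]: "has_fract (\<lambda>X. 0) 0"
  unfolding has_fract_def by (rule exI[of _ 0], rule exI[of _ 1]) (auto simp: Zero_fract_def)

lemma has_fract_add:
  assumes "has_fract s f" "has_fract t g"
  shows "has_fract (\<lambda>X. s X + t X) (f + g)"
proof -
  from assms obtain p q p' q' where *: "q \<noteq> 0" "act q s = Poly_Mapping.lookup p" "f = Fract p q"
    "q' \<noteq> 0" "act q' t = Poly_Mapping.lookup p'" "g = Fract p' q'"
    unfolding has_fract_def by blast
  have "act (q * q') (\<lambda>X. s X + t X) = Poly_Mapping.lookup (p * q' + p' * q)"
  proof
    fix X
    have "act (q * q') s = act q' (act q s)" "act (q * q') t = act q (act q' t)"
      by (metis act_mult mult.commute)+
    then show "act (q * q') (\<lambda>X. s X + t X) X = Poly_Mapping.lookup (p * q' + p' * q) X"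
      using * by (simp add: act_add_right act_lookup lookup_add mult.commute)
  qed
  then show ?thesis
    unfolding has_fract_def using *
    by (intro exI[of _ "p * q' + p' * q"] exI[of _ "q * q'"]) (auto simp: add_fract)
qed

lemma has_fract_act:
  assumes "has_fract s f"
  shows "has_fract (act r s) (Fract r 1 * f)"
proof -
  from assms obtain p q where *: "q \<noteq> 0" "act q s = Poly_Mapping.lookup p" "f = Fract p q"
    unfolding has_fract_def by blast
  have "act q (act r s) = Poly_Mapping.lookup (r * p)"
    using * by (metis act_lookup act_mult mult.commute)
  then show ?thesis
    unfolding has_fract_def using * by (intro exI[of _ "r * p"] exI[of _ "q"]) auto
qed

text \<open>A series is recognised after multiplication by any nonzero \<open>r\<close>. With
  \<open>r = 1 - z^u\<close> this handles periodic series and, by telescoping, unimodular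
  cones.\<close>

lemma has_fract_divide:
  assumes "has_fract (act r s) f" "r \<noteq> 0"
  shows "has_fract s (f / Fract r 1)"
proof -
  from assms obtain p q where *: "q \<noteq> 0" "act q (act r s) = Poly_Mapping.lookup p" "f = Fract p q"
    unfolding has_fract_def by blast
  have "act (q * r) s = Poly_Mapping.lookup p"
    using * by (metis act_mult)
  then show ?thesis
    unfolding has_fract_def using * assms(2)
    by (intro exI[of _ "p"] exI[of _ "q * r"]) auto
qed

lemma has_fract_scale:
  assumes "has_fract s f"
  shows "has_fract (\<lambda>X. c * s X) (Fract (Poly_Mapping.single 0 c) 1 * f)"
proof -
  have "(\<lambda>X. c * s X) = act (Poly_Mapping.single 0 c) s"
    by (simp add: fun_eq_iff act_single)
  then show ?thesis
    using has_fract_act[OF assms] by simp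
qed

lemma has_fract_sum:
  assumes "\<And>i. i \<in> I \<Longrightarrow> has_fract (s i) (f i)"
  shows "has_fract (\<lambda>X. \<Sum>i\<in>I. s i X) (\<Sum>i\<in>I. f i)"
  using assms by (induction I rule: infinite_finite_induct) (auto intro: has_fract_add)

lemma has_fract_lookup: "has_fract (Poly_Mapping.lookup p) (Fract p 1)"
  unfolding has_fract_def by (rule exI[of _ p], rule exI[of _ 1]) simp


subsection \<open>Integer matrices as exponents, and evaluation\<close>

definition matrix_of :: "('m \<Rightarrow>\<^sub>0 'n \<Rightarrow>\<^sub>0 int) \<Rightarrow> int ^ 'n ^ 'm" where
  "matrix_of X = (\<chi> i j. Poly_Mapping.lookup (Poly_Mapping.lookup X i) j)"

lemma lookup_exponent:
  "Poly_Mapping.lookup (Poly_Mapping.lookup (exponent X) i) j = X $ i $ j"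
  by (simp add: exponent_def)

lemma matrix_of_exponent [simp]: "matrix_of (exponent X) = X"
  by (simp add: matrix_of_def lookup_exponent vec_eq_iff)

lemma exponent_matrix_of [simp]:
  "exponent (matrix_of X) = (X :: 'm::finite \<Rightarrow>\<^sub>0 'n::finite \<Rightarrow>\<^sub>0 int)"
  by (intro poly_mapping_eqI) (simp add: matrix_of_def lookup_exponent)

lemma matrix_of_add [simp]: "matrix_of (X + Y) = matrix_of X + matrix_of Y"
  and matrix_of_diff [simp]: "matrix_of (X - Y) = matrix_of X - matrix_of Y"
  and matrix_of_zero [simp]: "matrix_of 0 = 0"
  by (simp_all add: matrix_of_def vec_eq_iff lookup_add lookup_minus)

lemma exponent_zero: "exponent 0 = 0"
  by (metis exponent_matrix_of matrix_of_zero)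

lemma bij_matrix_of:
  "bij (matrix_of :: ('m::finite \<Rightarrow>\<^sub>0 'n::finite \<Rightarrow>\<^sub>0 int) \<Rightarrow> _)"
  by (rule o_bij[of exponent]) (auto simp: fun_eq_iff)

lemma monom_eval_add:
  assumes "\<forall>i j. z $ i $ j \<noteq> 0"
  shows "monom_eval (X + Y) z = monom_eval X z * monom_eval Y z"
  using assms by (simp add: monom_eval_def power_int_add prod.distrib)

lemma monom_eval_zero [simp]: "monom_eval 0 z = 1"
  by (simp add: monom_eval_def)

lemma laurent_eval_altdef:
  "laurent_eval p z =
     (\<Sum>X\<in>Poly_Mapping.keys p. Poly_Mapping.lookup p X * monom_eval (matrix_of X) z)"
  by (simp add: laurent_eval_def monom_eval_def matrix_of_def)

lemma laurent_eval_superset: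
  assumes "finite A" "Poly_Mapping.keys p \<subseteq> A"
  shows "laurent_eval p z =
     (\<Sum>X\<in>A. Poly_Mapping.lookup p X * monom_eval (matrix_of X) z)"
  unfolding laurent_eval_altdef
  by (rule sum.mono_neutral_left) (use assms in \<open>auto simp: in_keys_iff\<close>)

lemma laurent_eval_zero [simp]: "laurent_eval 0 z = 0"
  by (simp add: laurent_eval_altdef)

lemma laurent_eval_single:
  "laurent_eval (Poly_Mapping.single X c) z = c * monom_eval (matrix_of X) z"
  by (subst laurent_eval_superset[of "{X}"]) auto

lemma laurent_eval_one [simp]: "laurent_eval 1 z = 1"
  by (simp flip: single_one add: laurent_eval_single)

lemma laurent_eval_add: "laurent_eval (p + q) z = laurent_eval p z + laurent_eval q z"
proof -
  have "Poly_Mapping.keys (p + q) \<subseteq> Poly_Mapping.keys p \<union> Poly_Mapping.keys q"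
    by (rule keys_add)
  then show ?thesis
    by (simp add: laurent_eval_superset[of "Poly_Mapping.keys p \<union> Poly_Mapping.keys q"]
        lookup_add distrib_right sum.distrib)
qed

lemma laurent_eval_uminus: "laurent_eval (- p) z = - laurent_eval p z"
  by (simp add: laurent_eval_altdef sum_negf)

lemma laurent_eval_diff: "laurent_eval (p - q) z = laurent_eval p z - laurent_eval q z"
  using laurent_eval_add[of p "- q"] by (simp add: laurent_eval_uminus)

lemma laurent_eval_mult:
  assumes z: "\<forall>i j. z $ i $ j \<noteq> 0"
  shows "laurent_eval (p * q) z = laurent_eval p z * laurent_eval q z"
proof (induction p rule: poly_mapping_add_induct)
  case zero
  then show ?case by simp
next
  case (add p Y c)
  have "laurent_eval (Poly_Mapping.single Y c * q) z =
      laurent_eval (Poly_Mapping.single Y c) z * laurent_eval q z"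
  proof (induction q rule: poly_mapping_add_induct)
    case zero
    then show ?case by simp
  next
    case (add q Z d)
    then show ?case
      by (simp add: distrib_left laurent_eval_add laurent_eval_single mult_single
          monom_eval_add[OF z])
  qed
  with add show ?case
    by (simp add: distrib_right laurent_eval_add)
qed

definition lattice_series ::
    "(int ^ 'n ^ 'm) set \<Rightarrow> ('m \<Rightarrow>\<^sub>0 'n \<Rightarrow>\<^sub>0 int) \<Rightarrow> complex" where
  "lattice_series S X = of_bool (matrix_of X \<in> S)"

text \<open>The bridge from formal to analytic values. Absolute convergence allows the finitely many
  shifts in \<open>act D\<close> to be summed separately, and a shift by \<open>Y\<close> multiplies
  the sum by the value of the monomial \<open>Y\<close>.\<close>

lemma laurent_eval_act:
  fixes z :: "complex ^ 'n::finite ^ 'm::finite"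
  assumes z: "\<forall>i j. z $ i $ j \<noteq> 0"
    and conv: "(\<lambda>\<alpha>. norm (monom_eval \<alpha> z)) summable_on S"
    and N: "act D (lattice_series S) = Poly_Mapping.lookup N"
  shows "laurent_eval N z = laurent_eval D z * infsum (\<lambda>\<alpha>. monom_eval \<alpha> z) S"
proof -
  define \<sigma> where "\<sigma> = infsum (\<lambda>\<alpha>. monom_eval \<alpha> z) S"
  define e where "e X = monom_eval (matrix_of X) z" for X :: "'m \<Rightarrow>\<^sub>0 'n \<Rightarrow>\<^sub>0 int"
  have e_add: "e (X + Y) = e X * e Y" for X Y
    by (simp add: e_def monom_eval_add[OF z])
  have "((\<lambda>\<alpha>. monom_eval \<alpha> z) has_sum \<sigma>) S"
    unfolding \<sigma>_def using abs_summable_summable[OF conv] by simp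
  then have "((\<lambda>\<alpha>. of_bool (\<alpha> \<in> S) * monom_eval \<alpha> z) has_sum \<sigma>) UNIV"
    by (rule has_sum_cong_neutral[THEN iffD1, rotated -1]) auto
  then have base: "((\<lambda>X. lattice_series S X * e X) has_sum \<sigma>) UNIV"
    unfolding lattice_series_def e_def
    using has_sum_reindex_bij_betw[OF bij_matrix_of, of "\<lambda>\<alpha>. of_bool (\<alpha> \<in> S) * monom_eval \<alpha> z"]
    by simp
  have shifted: "((\<lambda>X. Poly_Mapping.lookup D Y * lattice_series S (X - Y) * e X) has_sum
      (Poly_Mapping.lookup D Y * e Y * \<sigma>)) UNIV" for Y
  proof -
    have bij: "bij (\<lambda>X. X - Y)"
      by (rule o_bij[of "\<lambda>X. X + Y"]) (auto simp: fun_eq_iff)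
    have "((\<lambda>X. lattice_series S (X - Y) * e (X - Y)) has_sum \<sigma>) UNIV"
      using has_sum_reindex_bij_betw[OF bij, of "\<lambda>X. lattice_series S X * e X"] base by simp
    then have "((\<lambda>X. (Poly_Mapping.lookup D Y * e Y) * (lattice_series S (X - Y) * e (X - Y)))
        has_sum (Poly_Mapping.lookup D Y * e Y * \<sigma>)) UNIV"
      by (rule has_sum_cmult_right)
    moreover have "(Poly_Mapping.lookup D Y * e Y) * (lattice_series S (X - Y) * e (X - Y)) =
        Poly_Mapping.lookup D Y * lattice_series S (X - Y) * e X" for X
      using e_add[of Y "X - Y"] by simp
    ultimately show ?thesis
      by simp
  qed
  have "((\<lambda>X. \<Sum>Y\<in>Poly_Mapping.keys D. Poly_Mapping.lookup D Y * lattice_series S (X - Y) * e X)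
      has_sum (\<Sum>Y\<in>Poly_Mapping.keys D. Poly_Mapping.lookup D Y * e Y * \<sigma>)) UNIV"
    using finite_keys[of D]
  proof (induction rule: finite_induct)
    case (insert Y A)
    then show ?case
      using has_sum_add[OF shifted[of Y]] by simp
  qed simp
  then have "((\<lambda>X. Poly_Mapping.lookup N X * e X) has_sum (laurent_eval D z * \<sigma>)) UNIV"
    by (simp add: laurent_eval_altdef e_def sum_distrib_right act_def flip: N)
  moreover have "((\<lambda>X. Poly_Mapping.lookup N X * e X) has_sum laurent_eval N z) UNIV"
  proof (rule has_sum_cong_neutral[THEN iffD1])
    show "((\<lambda>X. Poly_Mapping.lookup N X * e X) has_sum laurent_eval N z) (Poly_Mapping.keys N)"
      unfolding laurent_eval_altdef e_def by (rule has_sum_finite) simp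
  qed (auto simp: in_keys_iff)
  ultimately show ?thesis
    unfolding \<sigma>_def by (rule has_sum_unique[symmetric])
qed

section \<open>Existence of generating functions\<close>

text \<open>Subsequences are extracted for one function after another. A monotone sequence of
  naturals is increasing or, from the place of its minimum on, constant.\<close>

lemma mono_subsequences:
  fixes F :: "('a \<Rightarrow> nat) set"
  assumes "finite F" "infinite S"
  shows "\<exists>g :: nat \<Rightarrow> 'a. inj g \<and> range g \<subseteq> S \<and> (\<forall>f\<in>F. mono (f \<circ> g))"
  using assms(1)
proof induction
  case empty
  then show ?case
    using infinite_countable_subset[OF assms(2)] by auto
next
  case (insert f F)
  then obtain g :: "nat \<Rightarrow> 'a" where g: "inj g" "range g \<subseteq> S" "\<forall>f\<in>F. mono (f \<circ> g)"
    by blast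
  obtain r where r: "strict_mono r" "monoseq (\<lambda>n. f (g (r n)))"
    using seq_monosub[of "\<lambda>n. f (g n)"] by blast
  obtain k where k: "mono (\<lambda>n. f (g (r (n + k))))"
  proof (cases "mono (\<lambda>n. f (g (r n)))")
    case True
    then show ?thesis
      using that[of 0] by simp
  next
    case False
    then have dec: "f (g (r n)) \<le> f (g (r m))" if "m \<le> n" for m n
      using r(2) that unfolding monoseq_def mono_def by blast
    define M where "M = (LEAST y. \<exists>n. y = f (g (r n)))"
    have "\<exists>n. M = f (g (r n))" unfolding M_def by (rule LeastI_ex) auto
    then obtain k where k: "M = f (g (r k))" by blast
    have "M \<le> f (g (r n))" for n
      unfolding M_def by (rule Least_le) auto
    then have "f (g (r (n + k))) = M" for n
      using dec[of k "n + k"] k by (simp add: antisym)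
    then show ?thesis
      using that[of k] by (simp add: mono_def)
  qed
  define h where "h n = g (r (n + k))" for n
  have "inj h"
    by (rule injI) (use g(1) r(1) in \<open>simp add: h_def inj_eq strict_mono_eq\<close>)
  moreover have "mono (f' \<circ> h)" if "f' \<in> F" for f'
    using g(3) that r(1) by (auto simp: mono_def h_def strict_mono_less_eq)
  ultimately show ?case
    using g(2) k by (intro exI[of _ h]) (auto simp: h_def[abs_def] o_def)
qed

text \<open>Applied to slacks of inequalities it produces recession vectors, applied to bounded
  pairings it produces integral kernel vectors.\<close>

lemma dickson:
  fixes F :: "('a \<Rightarrow> nat) set"
  assumes "finite F" "infinite S"
  shows "\<exists>x\<in>S. \<exists>y\<in>S. x \<noteq> y \<and> (\<forall>f\<in>F. f x \<le> f y)"
proof -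
  obtain g :: "nat \<Rightarrow> 'a" where g: "inj g" "range g \<subseteq> S" "\<forall>f\<in>F. mono (f \<circ> g)"
    using mono_subsequences[OF assms] by blast
  have "g 0 \<noteq> g 1"
    using g(1) by (simp add: inj_eq)
  moreover have "f (g 0) \<le> f (g 1)" if "f \<in> F" for f
    using g(3) that unfolding mono_def o_def by (metis zero_le_one)
  ultimately show ?thesis
    using g(2) by blast
qed

section \<open>Lattice points of integral inequalities and their recession vectors\<close>

definition pairing :: "int ^ 'n::finite ^ 'm::finite \<Rightarrow> int ^ 'n ^ 'm \<Rightarrow> int" where
  "pairing a x = (\<Sum>i\<in>UNIV. \<Sum>j\<in>UNIV. a $ i $ j * x $ i $ j)"

lemma pairing_add: "pairing a (x + y) = pairing a x + pairing a y"
  and pairing_diff: "pairing a (x - y) = pairing a x - pairing a y"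
  and pairing_minus_left: "pairing (- a) x = - pairing a x"
  by (simp_all add: pairing_def distrib_left right_diff_distrib sum.distrib sum_subtractf sum_negf)

lemma real_mat_nth [simp]: "real_mat x $ i $ j = of_int (x $ i $ j)"
  by (simp add: real_mat_def)

lemma inj_real_mat: "inj real_mat"
  by (auto simp: inj_def real_mat_def vec_eq_iff)

lemma inner_real_mat: "real_mat a \<bullet> x = (\<Sum>i\<in>UNIV. \<Sum>j\<in>UNIV. of_int (a $ i $ j) * x $ i $ j)"
  by (simp add: inner_vec_def)

lemma inner_real_mat_real_mat: "real_mat a \<bullet> real_mat x = of_int (pairing a x)"
  by (simp add: inner_real_mat pairing_def)

definition lattice_points :: "((int ^ 'n::finite ^ 'm::finite) \<times> int) set \<Rightarrow> (int ^ 'n ^ 'm) set" where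
  "lattice_points H = {x. \<forall>(a, b)\<in>H. pairing a x \<le> b}"

definition recession :: "((int ^ 'n::finite ^ 'm::finite) \<times> int) set \<Rightarrow> (int ^ 'n ^ 'm) set" where
  "recession H = {u. \<forall>(a, b)\<in>H. pairing a u \<le> 0}"

lemma recession_nonzero:
  assumes "finite H" "infinite (lattice_points H)"
  obtains u where "u \<in> recession H" "u \<noteq> 0"
proof -
  \<comment> \<open>The slacks are natural numbers on lattice points. If no slack of
    \<open>y\<close> is below that of \<open>x\<close>, then \<open>y - x\<close> is a recession
    vector.\<close>
  define F where "F = (\<lambda>(a, b) x. nat (b - pairing a x)) ` H"
  have "finite F" using assms(1) by (simp add: F_def)
  then obtain x y where xy: "x \<in> lattice_points H" "y \<in> lattice_points H" "x \<noteq> y"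
      "\<forall>f\<in>F. f x \<le> f y"
    using dickson[OF _ assms(2)] by blast
  have "pairing a (y - x) \<le> 0" if "(a, b) \<in> H" for a b
  proof -
    have "(\<lambda>x. nat (b - pairing a x)) \<in> F"
      using that by (force simp: F_def)
    then have "nat (b - pairing a x) \<le> nat (b - pairing a y)"
      using xy(4) by auto
    moreover have "pairing a x \<le> b"
      using xy(1) that by (auto simp: lattice_points_def)
    moreover have "pairing a y \<le> b"
      using xy(2) that by (auto simp: lattice_points_def)
    ultimately show ?thesis
      by (simp add: pairing_diff nat_le_eq_zle)
  qed
  then show thesis
    using that[of "y - x"] xy(3) by (auto simp: recession_def)
qed

text \<open>The condition on \<open>D\<close> makes it nonzero wherever the series of \<open>S\<close> converges, so that the
  rational function \<open>N / D\<close> can be evaluated at all these points.\<close>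

definition tame ::
    "(int ^ 'n::finite ^ 'm::finite) set \<Rightarrow> (('m \<Rightarrow>\<^sub>0 'n \<Rightarrow>\<^sub>0 int) \<Rightarrow> complex) \<Rightarrow> bool" where
  "tame S s \<longleftrightarrow> (\<exists>D N. D \<noteq> 0 \<and> act D s = Poly_Mapping.lookup N \<and>
     (\<forall>z. (\<forall>i j. z $ i $ j \<noteq> 0) \<and> (\<lambda>\<alpha>. norm (monom_eval \<alpha> z)) summable_on S \<longrightarrow>
        laurent_eval D z \<noteq> 0))"

lemma tame_mono:
  assumes "tame S s" "S \<subseteq> S'"
  shows "tame S' s"
  using assms summable_on_subset_banach unfolding tame_def by blast

lemma tame_zero: "tame S (\<lambda>X. 0)"
  unfolding tame_def by (rule exI[of _ 1], rule exI[of _ 0]) auto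

lemma tame_add:
  fixes s :: "('m::{finite,linorder} \<Rightarrow>\<^sub>0 'n::{finite,linorder} \<Rightarrow>\<^sub>0 int) \<Rightarrow> complex"
  assumes "tame S s" "tame S t"
  shows "tame S (\<lambda>X. s X + t X)"
proof -
  from assms obtain D N D' N' where *: "D \<noteq> 0" "act D s = Poly_Mapping.lookup N"
    "\<forall>z. (\<forall>i j. z $ i $ j \<noteq> 0) \<and> (\<lambda>\<alpha>. norm (monom_eval \<alpha> z)) summable_on S \<longrightarrow>
        laurent_eval D z \<noteq> 0"
    "D' \<noteq> 0" "act D' t = Poly_Mapping.lookup N'"
    "\<forall>z. (\<forall>i j. z $ i $ j \<noteq> 0) \<and> (\<lambda>\<alpha>. norm (monom_eval \<alpha> z)) summable_on S \<longrightarrow>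
        laurent_eval D' z \<noteq> 0"
    unfolding tame_def by blast
  have "act (D * D') (\<lambda>X. s X + t X) = Poly_Mapping.lookup (D' * N + D * N')"
  proof
    fix X
    have "act (D * D') s = act D' (act D s)" "act (D * D') t = act D (act D' t)"
      by (metis act_mult mult.commute)+
    then show "act (D * D') (\<lambda>X. s X + t X) X = Poly_Mapping.lookup (D' * N + D * N') X"
      using * by (simp add: act_add_right act_lookup lookup_add)
  qed
  then show ?thesis
    unfolding tame_def using *
    by (intro exI[of _ "D * D'"] exI[of _ "D' * N + D * N'"]) (auto simp: laurent_eval_mult)
qed

lemma tame_sum:
  fixes s :: "'a \<Rightarrow> ('m::{finite,linorder} \<Rightarrow>\<^sub>0 'n::{finite,linorder} \<Rightarrow>\<^sub>0 int) \<Rightarrow> complex"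
  assumes "\<And>i. i \<in> I \<Longrightarrow> tame S (s i)"
  shows "tame S (\<lambda>X. \<Sum>i\<in>I. s i X)"
  using assms by (induction I rule: infinite_finite_induct) (auto intro: tame_add tame_zero)

lemma tame_act:
  fixes s :: "('m::{finite,linorder} \<Rightarrow>\<^sub>0 'n::{finite,linorder} \<Rightarrow>\<^sub>0 int) \<Rightarrow> complex"
  assumes "tame S (act E s)" "E \<noteq> 0"
    and "\<And>z. (\<forall>i j. z $ i $ j \<noteq> 0) \<Longrightarrow> (\<lambda>\<alpha>. norm (monom_eval \<alpha> z)) summable_on S \<Longrightarrow>
        laurent_eval E z \<noteq> 0"
  shows "tame S s"
proof -
  from assms(1) obtain D N where *: "D \<noteq> 0" "act D (act E s) = Poly_Mapping.lookup N"
    "\<forall>z. (\<forall>i j. z $ i $ j \<noteq> 0) \<and> (\<lambda>\<alpha>. norm (monom_eval \<alpha> z)) summable_on S \<longrightarrow>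
        laurent_eval D z \<noteq> 0"
    unfolding tame_def by blast
  then show ?thesis
    unfolding tame_def using assms(2,3)
    by (intro exI[of _ "D * E"] exI[of _ N]) (auto simp: laurent_eval_mult act_mult)
qed

lemma lattice_series_finite:
  fixes S :: "(int ^ 'n::finite ^ 'm::finite) set"
  assumes "finite S"
  shows "lattice_series S =
    Poly_Mapping.lookup (\<Sum>\<alpha>\<in>S. Poly_Mapping.single (exponent \<alpha>) 1)"
proof
  fix X :: "'m \<Rightarrow>\<^sub>0 'n \<Rightarrow>\<^sub>0 int"
  have "exponent \<alpha> = X \<longleftrightarrow> \<alpha> = matrix_of X" for \<alpha>
    by (metis exponent_matrix_of matrix_of_exponent)
  then show "lattice_series S X =
      Poly_Mapping.lookup (\<Sum>\<alpha>\<in>S. Poly_Mapping.single (exponent \<alpha>) 1) X"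
    using assms by (simp add: lattice_series_def lookup_sum lookup_single when_def)
qed

lemma one_minus_monom_nonzero:
  assumes "u \<noteq> 0"
  shows "1 - Poly_Mapping.single (exponent u) (1 :: complex) \<noteq> 0"
proof
  assume "1 - Poly_Mapping.single (exponent u) (1 :: complex) = 0"
  then have "Poly_Mapping.lookup (1 - Poly_Mapping.single (exponent u) (1 :: complex)) 0 = 0"
    by simp
  moreover have "exponent u \<noteq> 0"
    using assms by (metis exponent_zero matrix_of_exponent)
  ultimately show False
    by (simp add: lookup_minus lookup_single lookup_one when_def)
qed

lemma act_one_minus_monom:
  "act (1 - Poly_Mapping.single (exponent u) 1) s X = s X - s (X - exponent u)"
  by (simp add: act_diff_left act_single)

lemma monom_eval_scale_nat:
  assumes "\<forall>i j. z $ i $ j \<noteq> 0"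
  shows "monom_eval (\<chi> i j. int k * u $ i $ j) z = monom_eval u z ^ k"
proof (induction k)
  case 0
  then show ?case by (simp add: monom_eval_def)
next
  case (Suc k)
  have "(\<chi> i j. int (Suc k) * u $ i $ j) = u + (\<chi> i j. int k * u $ i $ j)"
    by (simp add: vec_eq_iff algebra_simps)
  then show ?case
    using Suc by (simp add: monom_eval_add[OF assms])
qed

text \<open>If the monomial \<open>u\<close> had value 1, all terms along the ray from
  \<open>x\<close> in direction \<open>u\<close> would have the same nonzero norm.\<close>

lemma monom_eval_recession_ne_1:
  fixes z :: "complex ^ 'n::finite ^ 'm::finite"
  assumes z: "\<forall>i j. z $ i $ j \<noteq> 0"
    and conv: "(\<lambda>\<alpha>. norm (monom_eval \<alpha> z)) summable_on S"
    and S: "\<And>k. x + (\<chi> i j. int k * u $ i $ j) \<in> S" and u: "u \<noteq> 0"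
  shows "monom_eval u z \<noteq> 1"
proof
  assume one: "monom_eval u z = 1"
  define f where "f k = x + (\<chi> i j. int k * u $ i $ j)" for k
  have inj: "inj f"
    using u by (force simp: inj_def f_def vec_eq_iff)
  have norm_f: "norm (monom_eval (f k) z) = norm (monom_eval x z)" for k
    by (simp add: f_def monom_eval_add[OF z] monom_eval_scale_nat[OF z] one)
  have "(\<lambda>\<alpha>. norm (monom_eval \<alpha> z)) summable_on range f"
    by (rule summable_on_subset_banach[OF conv]) (use S in \<open>auto simp: f_def\<close>)
  then have "((\<lambda>\<alpha>. norm (monom_eval \<alpha> z)) \<circ> f) summable_on UNIV"
    using summable_on_reindex[OF inj] by blast
  then have "(\<lambda>k::nat. norm (monom_eval x z)) summable_on UNIV"
    by (simp add: o_def norm_f)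
  then have "summable (\<lambda>k::nat. norm (monom_eval x z))"
    by (simp add: summable_on_UNIV_nonneg_real_iff)
  moreover have "monom_eval x z \<noteq> 0"
    using z by (simp add: monom_eval_def)
  ultimately show False
    by (simp add: summable_const_iff)
qed

lemma tame_lattice_points:
  fixes H :: "((int ^ 'n::{finite,linorder} ^ 'm::{finite,linorder}) \<times> int) set"
  assumes "finite H"
  shows "tame (lattice_points H) (lattice_series (lattice_points H))"
  using assms
proof (induction "dim (real_mat ` recession H)" arbitrary: H rule: less_induct)
  case less
  define S where "S = lattice_points H"
  show ?case
  proof (cases "finite S")
    case True
    then show ?thesis
      unfolding tame_def S_def[symmetric]
      by (intro exI[of _ 1] exI[of _ "\<Sum>\<alpha>\<in>S. Poly_Mapping.single (exponent \<alpha>) 1"])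
        (auto simp: lattice_series_finite)
  next
    case False
    then obtain u where u: "u \<in> recession H" "u \<noteq> 0"
      using recession_nonzero[OF less.prems] S_def by metis
    \<comment> \<open>\<open>H \<union> sh H\<close> describes \<open>S + u\<close>. Tightening one
      inequality at a time cuts the points of \<open>S\<close> outside \<open>S + u\<close> into
      disjoint slices.\<close>
    define sh where "sh H' = (\<lambda>(a, b). (a, b + pairing a u)) ` H'" for H'
    have sh: "tame S (lattice_series (S - lattice_points (H \<union> sh H')))" if "finite H'" "H' \<subseteq> H" for H'
      using that
    proof (induction H' rule: finite_induct)
      case empty
      then show ?case
        by (simp add: S_def sh_def lattice_series_def tame_zero)
    next
      case (insert ab H')
      obtain a b where ab: "ab = (a, b)" by fastforce
      define slice where "slice t = H \<union> sh H' \<union> {(a, t), (- a, - t)}" for t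
      \<comment> \<open>The integers that satisfy the old bound \<open>b\<close> but violate the
        tightened one; there are none if \<open>pairing a u = 0\<close>.\<close>
      define I where "I = {b + pairing a u + 1..b}"
      have au: "pairing a u \<le> 0" "(a, b) \<in> H"
        using u insert.prems ab by (auto simp: recession_def)
      have slice_iff: "x \<in> lattice_points (slice t) \<longleftrightarrow>
          x \<in> S \<and> x \<in> lattice_points (H \<union> sh H') \<and> pairing a x = t" for x t
        by (auto simp: slice_def S_def lattice_points_def pairing_minus_left)
      have tame_slice: "tame S (lattice_series (lattice_points (slice t)))" if "t \<in> I" for t
      proof -
        have neg: "pairing a u \<noteq> 0" using that by (auto simp: I_def)
        have fin: "finite (slice t)"
          using less.prems insert.hyps by (auto simp: slice_def sh_def)
        have sub: "recession (slice t) \<subseteq> recession H"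
          by (auto simp: recession_def slice_def)
        have orth: "real_mat a \<bullet> y = 0" if "y \<in> span (real_mat ` recession (slice t))" for y
        proof (rule span_induct[OF that])
          show "subspace {x. real_mat a \<bullet> x = 0}"
            by (rule subspace_hyperplane)
        next
          fix y assume "y \<in> real_mat ` recession (slice t)"
          then show "real_mat a \<bullet> y = 0"
            by (auto simp: recession_def slice_def inner_real_mat_real_mat pairing_minus_left)
        qed
        \<comment> \<open>The dimension drops because \<open>u\<close> is a recession vector of
          \<open>H\<close> with nonzero pairing with \<open>a\<close>, whereas recession vectors of
          the slice are orthogonal to \<open>a\<close>.\<close>
        have "real_mat u \<in> span (real_mat ` recession H)"
          using u by (simp add: span_base)
        moreover have "real_mat u \<notin> span (real_mat ` recession (slice t))"
          using orth[of "real_mat u"] neg by (auto simp: inner_real_mat_real_mat)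
        moreover have "span (real_mat ` recession (slice t)) \<subseteq> span (real_mat ` recession H)"
          by (intro span_mono image_mono sub)
        ultimately have "dim (real_mat ` recession (slice t)) < dim (real_mat ` recession H)"
          by (intro dim_psubset) blast
        then have "tame (lattice_points (slice t)) (lattice_series (lattice_points (slice t)))"
          using less.hyps fin by blast
        then show ?thesis
          by (rule tame_mono) (auto simp: slice_iff)
      qed
      have "lattice_series (S - lattice_points (H \<union> sh (insert ab H'))) X =
          lattice_series (S - lattice_points (H \<union> sh H')) X +
          (\<Sum>t\<in>I. lattice_series (lattice_points (slice t)) X)" for X
      proof -
        let ?x = "matrix_of X"
        have "(\<Sum>t\<in>I. lattice_series (lattice_points (slice t)) X) =
            (\<Sum>t\<in>I. if t = pairing a ?x then of_bool (?x \<in> S \<inter> lattice_points (H \<union> sh H')) else 0)"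
          by (rule sum.cong) (auto simp: lattice_series_def slice_iff)
        also have "\<dots> = of_bool (?x \<in> S \<inter> lattice_points (H \<union> sh H') \<and> pairing a ?x \<in> I)"
          by (simp add: I_def)
        finally have "(\<Sum>t\<in>I. lattice_series (lattice_points (slice t)) X) =
            of_bool (?x \<in> S \<inter> lattice_points (H \<union> sh H') \<and> pairing a ?x \<in> I)" .
        moreover have "?x \<in> lattice_points (H \<union> sh (insert ab H')) \<longleftrightarrow>
            ?x \<in> lattice_points (H \<union> sh H') \<and> pairing a ?x \<le> b + pairing a u"
          by (auto simp: lattice_points_def sh_def ab)
        moreover have "pairing a ?x \<le> b" if "?x \<in> S"
          using that au by (auto simp: S_def lattice_points_def)
        ultimately show ?thesis
          by (auto simp: lattice_series_def I_def)
      qed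
      moreover have "tame S (\<lambda>X. lattice_series (S - lattice_points (H \<union> sh H')) X +
          (\<Sum>t\<in>I. lattice_series (lattice_points (slice t)) X))"
        using insert by (intro tame_add tame_sum tame_slice) auto
      ultimately show ?case
        by (simp only: fun_eq_iff[symmetric])
    qed
    define E where "E = 1 - Poly_Mapping.single (exponent u) (1 :: complex)"
    have "act E (lattice_series S) = lattice_series (S - lattice_points (H \<union> sh H))"
    proof
      fix X :: "'m \<Rightarrow>\<^sub>0 'n \<Rightarrow>\<^sub>0 int"
      let ?x = "matrix_of X"
      have le: "pairing a u \<le> 0" if "(a, b) \<in> H" for a b
        using u(1) that by (auto simp: recession_def)
      have "?x - u \<in> S \<longleftrightarrow> (\<forall>(a, b)\<in>H. pairing a ?x \<le> b + pairing a u)"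
        by (simp add: S_def lattice_points_def pairing_diff diff_le_eq case_prod_beta)
      also have "\<dots> \<longleftrightarrow> ?x \<in> lattice_points (H \<union> sh H)"
        using le by (fastforce simp: lattice_points_def sh_def)
      finally have "?x - u \<in> S \<longleftrightarrow> ?x \<in> lattice_points (H \<union> sh H)" .
      moreover have "?x \<in> S" if "?x \<in> lattice_points (H \<union> sh H)"
        using that by (auto simp: lattice_points_def S_def)
      ultimately show "act E (lattice_series S) X = lattice_series (S - lattice_points (H \<union> sh H)) X"
        by (auto simp: E_def act_one_minus_monom lattice_series_def)
    qed
    then have "tame S (act E (lattice_series S))"
      using sh[of H] less.prems by simp
    moreover have "E \<noteq> 0"
      unfolding E_def by (rule one_minus_monom_nonzero[OF u(2)])
    moreover have "laurent_eval E z \<noteq> 0"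
      if z: "\<forall>i j. z $ i $ j \<noteq> 0" and conv: "(\<lambda>\<alpha>. norm (monom_eval \<alpha> z)) summable_on S" for z
    proof -
      obtain x where x: "x \<in> S"
        using False by fastforce
      have "x + (\<chi> i j. int k * u $ i $ j) \<in> S" for k
      proof -
        have "pairing a (\<chi> i j. int k * u $ i $ j) = int k * pairing a u" for a
          by (simp add: pairing_def sum_distrib_left algebra_simps)
        moreover have "pairing a x + int k * pairing a u \<le> b" if "(a, b) \<in> H" for a b
        proof -
          have "pairing a x \<le> b" "pairing a u \<le> 0"
            using x u that by (auto simp: S_def lattice_points_def recession_def)
          then show ?thesis
            by (smt (verit) mult_nonneg_nonpos of_nat_0_le_iff)
        qed
        ultimately show ?thesis
          by (auto simp: S_def lattice_points_def pairing_add)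
      qed
      then show ?thesis
        using monom_eval_recession_ne_1[OF z conv _ u(2), of x]
        by (simp add: E_def laurent_eval_diff laurent_eval_single)
    qed
    ultimately show ?thesis
      unfolding S_def[symmetric] by (rule tame_act)
  qed
qed


section \<open>From rational polyhedra to integral inequalities\<close>

lemma finite_rat_common_denominator:
  fixes S :: "real set"
  assumes "finite S" "S \<subseteq> \<rat>"
  shows "\<exists>d::nat. d > 0 \<and> (\<forall>x\<in>S. of_nat d * x \<in> \<int>)"
  using assms
proof (induction rule: finite_induct)
  case empty
  then show ?case by (intro exI[of _ 1]) auto
next
  case (insert x S)
  then obtain d :: nat where d: "d > 0" "\<forall>x\<in>S. of_nat d * x \<in> \<int>" by auto
  obtain p q :: int where pq: "x = of_int p / of_int q" "q > 0"
    using insert.prems by (auto elim: Rats_cases')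
  have "of_nat (d * nat q) * x = of_int (int d * p)"
    using pq by simp
  then have "of_nat (d * nat q) * x \<in> \<int>"
    by (metis Ints_of_int)
  moreover have "of_nat (d * nat q) * y \<in> \<int>" if "y \<in> S" for y
  proof -
    have "of_nat (d * nat q) * y = of_int q * (of_nat d * y)"
      using pq by (simp add: mult_ac)
    then show ?thesis
      using d that by (metis Ints_mult Ints_of_int)
  qed
  ultimately show ?case
    using d pq by (intro exI[of _ "d * nat q"]) auto
qed

text \<open>Clearing denominators in the normal vector suffices: on lattice points the left side is
  then an integer, and the real bound can be replaced by its floor.\<close>

lemma rational_halfspace_integral:
  fixes a :: "real ^ 'n::finite ^ 'm::finite"
  assumes "\<forall>i j. a $ i $ j \<in> \<rat>"
  obtains A B where "{x. a \<bullet> x \<le> b} = {x. real_mat A \<bullet> x \<le> B}"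
proof -
  obtain d :: nat where d: "d > 0" "\<forall>x\<in>range (\<lambda>(i, j). a $ i $ j). of_nat d * x \<in> \<int>"
    using finite_rat_common_denominator[of "range (\<lambda>(i, j). a $ i $ j)"] assms by fastforce
  define A where "A = (\<chi> i j. \<lfloor>of_nat d * a $ i $ j\<rfloor>)"
  have "of_nat d * a $ i $ j \<in> \<int>" for i j
    using d(2) by auto
  then have "real_mat A = of_nat d *\<^sub>R a"
    by (simp add: vec_eq_iff A_def)
  then have "a \<bullet> x \<le> b \<longleftrightarrow> real_mat A \<bullet> x \<le> of_nat d * b" for x
    using d(1) by simp
  then show thesis
    by (intro that[of A "of_nat d * b"]) auto
qed

lemma rational_polyhedron_integral:
  assumes "rational_polyhedron (Q :: (real ^ 'n::finite ^ 'm::finite) set)"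
  obtains H where "finite H" "Q = {x. \<forall>(a, b)\<in>H. real_mat a \<bullet> x \<le> b}"
proof -
  from assms obtain \<H> where \<H>: "finite \<H>" "Q = \<Inter> \<H>"
    "\<forall>h\<in>\<H>. \<exists>a b. a \<noteq> 0 \<and> (\<forall>i j. a $ i $ j \<in> \<rat>) \<and> b \<in> \<rat> \<and> h = {x. a \<bullet> x \<le> b}"
    unfolding rational_polyhedron_def by blast
  have "\<forall>h\<in>\<H>. \<exists>A B. h = {x. real_mat A \<bullet> x \<le> B}"
    using \<H>(3) rational_halfspace_integral by metis
  then obtain A B where AB: "\<And>h. h \<in> \<H> \<Longrightarrow> h = {x. real_mat (A h) \<bullet> x \<le> B h}"
    by metis
  show thesis
  proof (rule that[of "(\<lambda>h. (A h, B h)) ` \<H>"])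
    have "x \<in> Q \<longleftrightarrow> (\<forall>h\<in>\<H>. real_mat (A h) \<bullet> x \<le> B h)" for x
      using AB \<H>(2) by blast
    then show "Q = {x. \<forall>(a, b)\<in>(\<lambda>h. (A h, B h)) ` \<H>. real_mat a \<bullet> x \<le> b}"
      by auto
  qed (use \<H>(1) in auto)
qed

text \<open>The direction of a line may be irrational, while a period must be integral. Rounding the
  multiples of \<open>v\<close> gives infinitely many integer points whose pairings with
  \<open>A\<close> stay bounded, since each rounding error is at most 1. Two of them with equal
  pairings differ by a suitable \<open>u\<close>.\<close>

lemma integral_kernel_vector:
  fixes v :: "real ^ 'n::finite ^ 'm::finite"
  assumes "finite A" "v \<noteq> 0" "\<And>a. a \<in> A \<Longrightarrow> real_mat a \<bullet> v = 0"
  obtains u where "u \<noteq> 0" "\<And>a. a \<in> A \<Longrightarrow> pairing a u = 0"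
proof -
  define w :: "nat \<Rightarrow> int ^ 'n ^ 'm" where "w t = (\<chi> i j. \<lfloor>real t * v $ i $ j\<rfloor>)" for t
  define c :: "int ^ 'n ^ 'm \<Rightarrow> int" where "c a = (\<Sum>i\<in>UNIV. \<Sum>j\<in>UNIV. \<bar>a $ i $ j\<bar>)" for a
  have bound: "\<bar>pairing a (w t)\<bar> \<le> c a" if "a \<in> A" for a t
  proof -
    have "real_of_int (pairing a (w t)) = real_mat a \<bullet> (real_mat (w t) - real t *\<^sub>R v)"
      using assms(3)[OF that] by (simp add: inner_real_mat_real_mat inner_diff_right)
    also have "\<dots> = (\<Sum>i\<in>UNIV. \<Sum>j\<in>UNIV. of_int (a $ i $ j) * (of_int (w t $ i $ j) - real t * v $ i $ j))"
      by (simp add: inner_real_mat)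
    also have "\<bar>\<dots>\<bar> \<le> (\<Sum>i\<in>UNIV. \<Sum>j\<in>UNIV. \<bar>of_int (a $ i $ j)\<bar>)"
    proof (intro order_trans[OF sum_abs] sum_mono)
      fix i j
      have "\<bar>of_int (w t $ i $ j) - real t * v $ i $ j\<bar> \<le> 1"
        unfolding w_def by (simp add: abs_le_iff) linarith
      then show "\<bar>of_int (a $ i $ j) * (of_int (w t $ i $ j) - real t * v $ i $ j)\<bar> \<le> \<bar>of_int (a $ i $ j)\<bar>"
        by (simp add: abs_mult mult_left_le)
    qed
    finally show ?thesis
      unfolding c_def by (simp flip: of_int_abs of_int_sum)
  qed
  have inf: "infinite (range w)"
  proof
    assume fin: "finite (range w)"
    obtain i j where ij: "v $ i $ j \<noteq> 0"
      using assms(2) by (auto simp: vec_eq_iff)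
    have "finite ((\<lambda>X. \<bar>X $ i $ j\<bar>) ` range w)"
      using fin by blast
    then have M: "\<bar>w t $ i $ j\<bar> \<le> Max ((\<lambda>X. \<bar>X $ i $ j\<bar>) ` range w)" (is "_ \<le> ?M") for t
      by (rule Max_ge) auto
    obtain t :: nat where t: "real_of_int ?M + 1 < real t * \<bar>v $ i $ j\<bar>"
      using reals_Archimedean3[of "\<bar>v $ i $ j\<bar>"] ij by auto
    have "\<bar>real t * v $ i $ j\<bar> \<le> real_of_int \<bar>w t $ i $ j\<bar> + 1"
      unfolding w_def by (simp add: abs_le_iff) linarith
    with M[of t] t show False
      by (simp add: abs_mult)
  qed
  \<comment> \<open>Including each pairing together with its negative turns the inequalities from
    \<open>dickson\<close> into equalities; the offset \<open>c a\<close> makes both natural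
    numbers.\<close>
  define F where "F = (\<lambda>a x. nat (pairing a x + c a)) ` A \<union> (\<lambda>a x. nat (c a - pairing a x)) ` A"
  have fin: "finite F"
    using assms(1) by (simp add: F_def)
  obtain x y where xy: "x \<in> range w" "y \<in> range w" "x \<noteq> y"
      "\<forall>f\<in>F. f x \<le> f y"
    using dickson[OF fin inf] by blast
  have "pairing a (y - x) = 0" if "a \<in> A" for a
  proof -
    have "(\<lambda>x. nat (pairing a x + c a)) \<in> F" "(\<lambda>x. nat (c a - pairing a x)) \<in> F"
      using that by (auto simp: F_def)
    then have "nat (pairing a x + c a) \<le> nat (pairing a y + c a)"
        "nat (c a - pairing a x) \<le> nat (c a - pairing a y)"
      using xy(4) by auto
    moreover have "\<bar>pairing a x\<bar> \<le> c a" "\<bar>pairing a y\<bar> \<le> c a"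
      using xy(1,2) bound that by auto
    ultimately show ?thesis
      by (simp add: pairing_diff)
  qed
  then show thesis
    using that[of "y - x"] xy(3) by auto
qed

abbreviation lattice_part :: "(real ^ 'n::finite ^ 'm::finite) set \<Rightarrow> (int ^ 'n ^ 'm) set" where
  "lattice_part Q \<equiv> {\<alpha>. real_mat \<alpha> \<in> Q}"

lemma tame_rational_polyhedron:
  fixes Q :: "(real ^ 'n::{finite,linorder} ^ 'm::{finite,linorder}) set"
  assumes "rational_polyhedron Q"
  shows "tame (lattice_part Q) (lattice_series (lattice_part Q))"
proof -
  obtain H where H: "finite H" "Q = {x. \<forall>(a, b)\<in>H. real_mat a \<bullet> x \<le> b}"
    using rational_polyhedron_integral[OF assms] .
  have "lattice_part Q = lattice_points ((\<lambda>(a, b). (a, \<lfloor>b\<rfloor>)) ` H)"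
    by (auto simp: H(2) lattice_points_def inner_real_mat_real_mat le_floor_iff)
  moreover have "finite ((\<lambda>(a, b). (a, \<lfloor>b\<rfloor>)) ` H)"
    using H(1) by simp
  ultimately show ?thesis
    using tame_lattice_points by metis
qed

lemma has_fract_line:
  fixes Q :: "(real ^ 'n::{finite,linorder} ^ 'm::{finite,linorder}) set"
  assumes "rational_polyhedron Q" "contains_line Q"
  shows "has_fract (lattice_series (lattice_part Q)) 0"
proof -
  obtain H where H: "finite H" "Q = {x. \<forall>(a, b)\<in>H. real_mat a \<bullet> x \<le> b}"
    using rational_polyhedron_integral[OF assms(1)] .
  obtain x v where v: "v \<noteq> 0" "\<And>t. x + t *\<^sub>R v \<in> Q"
    using assms(2) unfolding contains_line_def by blast
  have "real_mat a \<bullet> v = 0" if "(a, b) \<in> H" for a b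
  proof (rule ccontr)
    assume nz: "real_mat a \<bullet> v \<noteq> 0"
    define t where "t = (b + 1 - real_mat a \<bullet> x) / (real_mat a \<bullet> v)"
    have "real_mat a \<bullet> (x + t *\<^sub>R v) = b + 1"
      using nz by (simp add: inner_add_right t_def)
    then show False
      using v(2)[of t] that H(2) by auto
  qed
  then have "real_mat a \<bullet> v = 0" if "a \<in> fst ` H" for a
    using that by auto
  with integral_kernel_vector[OF finite_imageI[OF H(1)] v(1)]
  obtain u where u: "u \<noteq> 0" "\<And>a. a \<in> fst ` H \<Longrightarrow> pairing a u = 0"
    by metis
  have "act (1 - Poly_Mapping.single (exponent u) 1) (lattice_series (lattice_part Q)) = (\<lambda>X. 0)"
  proof
    fix X :: "'m \<Rightarrow>\<^sub>0 'n \<Rightarrow>\<^sub>0 int"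
    have "pairing a (matrix_of X - u) = pairing a (matrix_of X)" if "(a, b) \<in> H" for a b
      using u(2)[of a] that by (force simp: pairing_diff)
    then have "matrix_of X - u \<in> lattice_part Q \<longleftrightarrow> matrix_of X \<in> lattice_part Q"
      by (auto simp: H(2) inner_real_mat_real_mat)
    then show "act (1 - Poly_Mapping.single (exponent u) 1) (lattice_series (lattice_part Q)) X = 0"
      by (simp add: act_one_minus_monom lattice_series_def)
  qed
  then have "has_fract (act (1 - Poly_Mapping.single (exponent u) 1) (lattice_series (lattice_part Q))) 0"
    by simp
  from has_fract_divide[OF this one_minus_monom_nonzero[OF u(1)]] show ?thesis
    by simp
qed

lemma tame_imp_has_fract:
  assumes "tame S s"
  obtains f where "has_fract s f"
  using assms unfolding tame_def has_fract_def by blast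

theorem ex_gen_fun:
  "\<exists>F :: (real ^ 'n::{finite,linorder} ^ 'm::{finite,linorder}) set \<Rightarrow> _. is_gen_fun F"
proof -
  define F where "F Q = (THE f. has_fract (lattice_series (lattice_part Q)) f)"
    for Q :: "(real ^ 'n::{finite,linorder} ^ 'm::{finite,linorder}) set"
  have F_eq: "F Q = f" if "has_fract (lattice_series (lattice_part Q)) f" for Q f
    unfolding F_def using that has_fract_unique by blast
  have F: "has_fract (lattice_series (lattice_part Q)) (F Q)" if Q: "rational_polyhedron Q" for Q
  proof -
    obtain f where f: "has_fract (lattice_series (lattice_part Q)) f"
      using tame_imp_has_fract[OF tame_rational_polyhedron[OF Q]] .
    with F_eq[OF f] show ?thesis
      by simp
  qed
  show ?thesis
    unfolding is_gen_fun_def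
  proof (intro exI[of _ F] conjI allI impI; elim conjE)
    fix \<Q> :: "(real ^ 'n::{finite,linorder} ^ 'm::{finite,linorder}) set set" and \<alpha>
    assume \<Q>: "finite \<Q>" "\<forall>Q\<in>\<Q>. rational_polyhedron Q"
      and sum: "\<forall>x. (\<Sum>Q\<in>\<Q>. \<alpha> Q * indicator Q x) = (0::real)"
    have "has_fract (\<lambda>X. \<Sum>Q\<in>\<Q>. of_real (\<alpha> Q) * lattice_series (lattice_part Q) X)
        (\<Sum>Q\<in>\<Q>. const_rat (of_real (\<alpha> Q)) * F Q)"
      unfolding const_rat_def using \<Q>(2) by (intro has_fract_sum has_fract_scale F) auto
    moreover have "(\<Sum>Q\<in>\<Q>. of_real (\<alpha> Q) * lattice_series (lattice_part Q) X) = 0" for X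
    proof -
      have "(\<Sum>Q\<in>\<Q>. of_real (\<alpha> Q) * lattice_series (lattice_part Q) X) =
          of_real (\<Sum>Q\<in>\<Q>. \<alpha> Q * indicator Q (real_mat (matrix_of X)))"
        by (auto simp: lattice_series_def indicator_def intro!: sum.cong)
      then show ?thesis
        by (simp only: sum of_real_0)
    qed
    ultimately have "has_fract (\<lambda>X. 0) (\<Sum>Q\<in>\<Q>. const_rat (of_real (\<alpha> Q)) * F Q)"
      by simp
    then show "(\<Sum>Q\<in>\<Q>. const_rat (of_real (\<alpha> Q)) * F Q) = 0"
      by (rule has_fract_unique) (rule has_fract_zero)
  next
    fix Q :: "(real ^ 'n::{finite,linorder} ^ 'm::{finite,linorder}) set"
    assume "rational_polyhedron Q" "contains_line Q"
    then show "F Q = 0"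
      by (intro F_eq has_fract_line)
  next
    fix Q :: "(real ^ 'n::{finite,linorder} ^ 'm::{finite,linorder}) set" and z p q
    assume Q: "rational_polyhedron Q" and z: "\<forall>i j. z $ i $ j \<noteq> 0"
      and conv: "(\<lambda>\<alpha>. norm (monom_eval \<alpha> z)) summable_on lattice_part Q"
      and FQ: "F Q = Fract p q" and q: "laurent_eval q z \<noteq> 0"
    \<comment> \<open>The fraction \<open>p / q\<close> is an arbitrary representation of
      \<open>F Q\<close>. It is compared with one whose denominator is known not to vanish at
      \<open>z\<close>.\<close>
    obtain D N where D: "D \<noteq> 0" "act D (lattice_series (lattice_part Q)) = Poly_Mapping.lookup N"
      "laurent_eval D z \<noteq> 0"
      using tame_rational_polyhedron[OF Q] z conv unfolding tame_def by blast
    have "F Q = Fract N D"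
      using D by (intro F_eq) (auto simp: has_fract_def)
    moreover have "q \<noteq> 0"
      using q by auto
    ultimately have "p * D = N * q"
      using FQ D(1) by (simp add: eq_fract)
    then have "laurent_eval p z * laurent_eval D z =
        laurent_eval D z * infsum (\<lambda>\<alpha>. monom_eval \<alpha> z) (lattice_part Q) * laurent_eval q z"
      using laurent_eval_act[OF z conv D(2)] laurent_eval_mult[OF z] by metis
    then show "laurent_eval p z / laurent_eval q z =
        infsum (\<lambda>\<alpha>. monom_eval \<alpha> z) (lattice_part Q)"
      using D(3) q by (simp add: field_simps)
  qed
qed

lemma is_gen_fun_gen_fun:
  "is_gen_fun (gen_fun :: (real ^ 'n::{finite,linorder} ^ 'm::{finite,linorder}) set \<Rightarrow> _)"
  unfolding gen_fun_def using ex_gen_fun by (rule someI_ex)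

section \<open>Uniqueness of generating functions\<close>

lemma pairing_scale_add:
  "pairing (\<chi> i j. K * v $ i $ j + X $ i $ j) Y = K * pairing v Y + pairing X Y"
  by (simp add: pairing_def algebra_simps sum.distrib sum_distrib_left)

lemma pairing_self_pos:
  assumes "X \<noteq> 0"
  shows "0 < pairing X X"
proof -
  obtain i j where ij: "X $ i $ j \<noteq> 0"
    using assms by (auto simp: vec_eq_iff)
  have "0 < (\<Sum>j\<in>UNIV. X $ i $ j * X $ i $ j)"
    by (rule sum_pos2[of _ j]) (use ij in \<open>auto simp: zero_less_mult_iff\<close>)
  then show ?thesis
    unfolding pairing_def by (intro sum_pos2[of _ i]) (auto intro: sum_nonneg)
qed

text \<open>Finitely many hyperplanes cannot cover the open cone of weights that are positive on
  \<open>C\<close>.\<close>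

lemma generic_weight:
  assumes "finite C" "finite \<Delta>" "0 \<notin> \<Delta>" "\<forall>Y\<in>C. 0 < pairing v0 Y"
  shows "\<exists>v. (\<forall>Y\<in>C. 0 < pairing v Y) \<and> (\<forall>X\<in>\<Delta>. pairing v X \<noteq> 0)"
  using assms(2,3)
proof (induction \<Delta> rule: finite_induct)
  case empty
  then show ?case using assms(4) by auto
next
  case (insert X \<Delta>)
  then obtain v where v: "\<forall>Y\<in>C. 0 < pairing v Y" "\<forall>X\<in>\<Delta>. pairing v X \<noteq> 0"
    by auto
  show ?case
  proof (cases "pairing v X = 0")
    case False
    then show ?thesis using v by auto
  next
    case True
    \<comment> \<open>\<open>K\<close> exceeds all relevant pairings of \<open>X\<close>, so
      \<open>K\<close> times \<open>v\<close> plus \<open>X\<close> keeps the earlier conditions,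
      while its pairing with \<open>X\<close> becomes \<open>pairing X X > 0\<close>.\<close>
    define K where "K = 1 + (\<Sum>Y\<in>C \<union> \<Delta>. \<bar>pairing X Y\<bar>)"
    have K: "\<bar>pairing X Y\<bar> < K" if "Y \<in> C \<union> \<Delta>" for Y
    proof -
      have "\<bar>pairing X Y\<bar> \<le> (\<Sum>Y\<in>C \<union> \<Delta>. \<bar>pairing X Y\<bar>)"
        by (rule member_le_sum) (use that assms(1) insert.hyps in auto)
      then show ?thesis
        by (simp add: K_def)
    qed
    define v' where "v' = (\<chi> i j. K * v $ i $ j + X $ i $ j)"
    have v': "pairing v' Y = K * pairing v Y + pairing X Y" for Y
      unfolding v'_def by (rule pairing_scale_add)
    have "0 < pairing v' Y" if "Y \<in> C" for Y
    proof -
      have "1 \<le> pairing v Y" "\<bar>pairing X Y\<bar> < K"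
        using v(1) K that by fastforce+
      then have "K * 1 \<le> K * pairing v Y"
        by (intro mult_left_mono) auto
      then show ?thesis
        using \<open>\<bar>pairing X Y\<bar> < K\<close> by (simp add: v')
    qed
    moreover have "pairing v' Y \<noteq> 0" if "Y \<in> \<Delta>" for Y
    proof
      assume "pairing v' Y = 0"
      then have "\<bar>K * pairing v Y\<bar> = \<bar>pairing X Y\<bar>"
        by (simp add: v')
      moreover have "1 \<le> \<bar>pairing v Y\<bar>" "\<bar>pairing X Y\<bar> < K"
        using v(2) K that by auto
      moreover have "K * 1 \<le> K * \<bar>pairing v Y\<bar>"
        using calculation by (intro mult_left_mono) auto
      ultimately show False
        by (simp add: abs_mult)
    qed
    moreover have "pairing v' X \<noteq> 0"
      using pairing_self_pos[of X] insert.prems True by (auto simp: v')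
    ultimately show ?thesis
      by blast
  qed
qed

section \<open>Evaluation along one-parameter curves in the torus\<close>

definition torus_curve :: "int ^ 'n::finite ^ 'm::finite \<Rightarrow> real \<Rightarrow> complex ^ 'n ^ 'm" where
  "torus_curve v t = (\<chi> i j. of_real t powi (v $ i $ j))"

lemma torus_curve_nonzero: "0 < t \<Longrightarrow> torus_curve v t $ i $ j \<noteq> 0"
  by (simp add: torus_curve_def)

lemma power_int_sum: "x \<noteq> 0 \<Longrightarrow> x powi (\<Sum>i\<in>A. f i) = (\<Prod>i\<in>A. x powi f i)"
  for x :: "'a::field"
  by (induction A rule: infinite_finite_induct) (auto simp: power_int_add)

lemma monom_eval_torus_curve:
  assumes "0 < t"
  shows "monom_eval X (torus_curve v t) = of_real t powi pairing v X"
  using assms by (simp add: monom_eval_def torus_curve_def pairing_def power_int_sum power_int_mult)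

text \<open>Distinct exponents of \<open>t\<close> leave a single term of lowest order, which
  dominates near 0.\<close>

lemma laurent_eval_torus_curve_nonzero:
  fixes h :: "('m::finite, 'n::finite) laurent"
  assumes "h \<noteq> 0" and inj: "inj_on (\<lambda>X. pairing v (matrix_of X)) (Poly_Mapping.keys h)"
  shows "\<forall>\<^sub>F t in at_right 0. laurent_eval h (torus_curve v t) \<noteq> 0"
proof -
  define f where "f X = pairing v (matrix_of X)" for X :: "'m \<Rightarrow>\<^sub>0 'n \<Rightarrow>\<^sub>0 int"
  define E where "E = Poly_Mapping.keys h"
  have E: "finite E" "E \<noteq> {}"
    using assms(1) by (auto simp: E_def)
  obtain X0 where X0: "X0 \<in> E" "\<And>X. X \<in> E \<Longrightarrow> f X0 \<le> f X"
    using ex_is_arg_min_if_finite[OF E, of f] by (auto simp: is_arg_min_linorder)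
  have lt: "f X0 < f X" if "X \<in> E" "X \<noteq> X0" for X
    using X0 that inj unfolding inj_on_def f_def E_def by force
  \<comment> \<open>What remains of \<open>h\<close> on the curve after division by the lowest power
    of \<open>t\<close>; its value at 0 is the coefficient of \<open>X0\<close>.\<close>
  define g where "g t = (\<Sum>X\<in>E. Poly_Mapping.lookup h X * complex_of_real t ^ nat (f X - f X0))"
    for t
  have "isCont g 0"
    unfolding g_def by (intro continuous_intros)
  then have "(g \<longlongrightarrow> g 0) (at_right 0)"
    using isCont_def tendsto_within_subset by blast
  moreover have "g 0 = (\<Sum>X\<in>E. if X = X0 then Poly_Mapping.lookup h X else 0)"
    unfolding g_def by (rule sum.cong) (use lt in \<open>force simp: power_0_left\<close>)+
  then have "g 0 = Poly_Mapping.lookup h X0"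
    using E X0 by simp
  then have "g 0 \<noteq> 0"
    using X0 by (simp add: E_def in_keys_iff)
  ultimately have "\<forall>\<^sub>F t in at_right 0. g t \<noteq> 0"
    by (rule tendsto_imp_eventually_ne)
  moreover have "\<forall>\<^sub>F t in at_right (0::real). 0 < t"
    by (simp add: eventually_at_right_less)
  ultimately show ?thesis
  proof eventually_elim
    case (elim t)
    have "laurent_eval h (torus_curve v t) =
        (\<Sum>X\<in>E. Poly_Mapping.lookup h X * complex_of_real t powi f X)"
      using elim by (simp add: laurent_eval_altdef monom_eval_torus_curve E_def f_def)
    also have "\<dots> = (\<Sum>X\<in>E. complex_of_real t powi f X0 *
        (Poly_Mapping.lookup h X * complex_of_real t ^ nat (f X - f X0)))"
    proof (rule sum.cong)
      fix X assume "X \<in> E"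
      then have "complex_of_real t ^ nat (f X - f X0) = complex_of_real t powi (f X - f X0)"
        using X0(2) by (simp add: power_int_def)
      then show "Poly_Mapping.lookup h X * complex_of_real t powi f X = complex_of_real t powi f X0 *
          (Poly_Mapping.lookup h X * complex_of_real t ^ nat (f X - f X0))"
        using elim by (simp add: power_int_diff)
    qed simp
    also have "\<dots> = complex_of_real t powi f X0 * g t"
      by (simp add: g_def sum_distrib_left)
    finally show ?case
      using elim by simp
  qed
qed

text \<open>On pointed polyhedra \<open>is_gen_fun\<close> gives explicit values only at points of
  convergence where the denominator does not vanish. The weights positive on \<open>C\<close> supply
  enough of them: if the two fractions differed, their cross-multiplied difference would be nonzero
  at such a point.\<close>

lemma gen_fun_unique:
  fixes Q :: "(real ^ 'n::{finite,linorder} ^ 'm::{finite,linorder}) set"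
  assumes F: "is_gen_fun F" and Q: "rational_polyhedron Q" "\<not> contains_line Q"
    and f: "has_fract (lattice_series (lattice_part Q)) f"
    and C: "finite C" "\<forall>Y\<in>C. 0 < pairing v0 Y"
    and conv: "\<And>v t. \<forall>Y\<in>C. 0 < pairing v Y \<Longrightarrow> 0 < (t::real) \<Longrightarrow> t < 1 \<Longrightarrow>
      (\<lambda>\<alpha>. t powi pairing v \<alpha>) summable_on lattice_part Q"
  shows "F Q = f"
proof -
  obtain N D where ND: "D \<noteq> 0" "act D (lattice_series (lattice_part Q)) = Poly_Mapping.lookup N"
    "f = Fract N D"
    using f unfolding has_fract_def by blast
  obtain p q where pq: "F Q = Fract p q" "q \<noteq> 0"
    by (cases "F Q") auto
  \<comment> \<open>The factor \<open>q\<close> ensures that \<open>q\<close> does not vanish at a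
    point where \<open>h\<close> does not.\<close>
  define h where "h = q * (p * D - N * q)"
  have "h = 0"
  proof (rule ccontr)
    assume "h \<noteq> 0"
    \<comment> \<open>A weight that vanishes on none of these differences is injective on the
      exponents of \<open>h\<close>.\<close>
    define \<Delta> where "\<Delta> = (\<lambda>(X, Y). matrix_of X - matrix_of Y) `
        {(X, Y). X \<in> Poly_Mapping.keys h \<and> Y \<in> Poly_Mapping.keys h \<and> X \<noteq> Y}"
    have "{(X, Y). X \<in> Poly_Mapping.keys h \<and> Y \<in> Poly_Mapping.keys h \<and> X \<noteq> Y} \<subseteq>
        Poly_Mapping.keys h \<times> Poly_Mapping.keys h"
      by auto
    then have fin: "finite \<Delta>"
      unfolding \<Delta>_def by (meson finite_SigmaI finite_imageI finite_keys finite_subset)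
    have "0 \<notin> \<Delta>"
      by (auto simp: \<Delta>_def) (metis exponent_matrix_of)
    then obtain v where v: "\<forall>Y\<in>C. 0 < pairing v Y" "\<forall>X\<in>\<Delta>. pairing v X \<noteq> 0"
      using generic_weight[OF C(1) fin _ C(2)] by blast
    have "inj_on (\<lambda>X. pairing v (matrix_of X)) (Poly_Mapping.keys h)"
    proof (rule inj_onI, rule ccontr)
      fix X Y
      assume XY: "X \<in> Poly_Mapping.keys h" "Y \<in> Poly_Mapping.keys h" "X \<noteq> Y"
        "pairing v (matrix_of X) = pairing v (matrix_of Y)"
      then have "matrix_of X - matrix_of Y \<in> \<Delta>"
        by (auto simp: \<Delta>_def)
      with v(2) XY(4) show False
        by (auto simp: pairing_diff)
    qed
    then have "\<forall>\<^sub>F t in at_right 0. laurent_eval h (torus_curve v t) \<noteq> 0"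
      by (rule laurent_eval_torus_curve_nonzero[OF \<open>h \<noteq> 0\<close>])
    moreover have "\<forall>\<^sub>F t in at_right (0::real). t \<in> {0<..<1}"
      by (rule eventually_at_right_real) simp
    ultimately have ev: "\<forall>\<^sub>F t in at_right (0::real). laurent_eval h (torus_curve v t) \<noteq> 0 \<and> t \<in> {0<..<1}"
      by (rule eventually_conj)
    then obtain t where t: "laurent_eval h (torus_curve v t) \<noteq> 0" "0 < t" "t < 1"
      using eventually_happens[OF ev] trivial_limit_at_right_real by force
    define z where "z = torus_curve v t"
    have z: "\<forall>i j. z $ i $ j \<noteq> 0"
      using t by (simp add: z_def torus_curve_nonzero)
    have "(\<lambda>\<alpha>. norm (monom_eval \<alpha> z)) summable_on lattice_part Q"
      using conv[OF v(1) t(2,3)] t(2) by (simp add: z_def monom_eval_torus_curve norm_power_int)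
    note conv' = this
    have h_eval: "laurent_eval q z \<noteq> 0" "laurent_eval p z * laurent_eval D z \<noteq> laurent_eval N z * laurent_eval q z"
      using t(1) by (auto simp: z_def[symmetric] h_def laurent_eval_mult[OF z] laurent_eval_diff)
    have "laurent_eval p z / laurent_eval q z = infsum (\<lambda>\<alpha>. monom_eval \<alpha> z) (lattice_part Q)"
      using F Q z conv' pq(1) h_eval(1) unfolding is_gen_fun_def by blast
    moreover have "laurent_eval N z = laurent_eval D z * infsum (\<lambda>\<alpha>. monom_eval \<alpha> z) (lattice_part Q)"
      by (rule laurent_eval_act[OF z conv' ND(2)])
    ultimately show False
      using h_eval by (simp add: field_simps)
  qed
  then show ?thesis
    using pq ND(1,3) by (simp add: h_def eq_fract)
qed

section \<open>Flows on bipartite forests and trees\<close>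

definition acyclic_edges :: "('m \<times> 'n) set \<Rightarrow> bool" where
  "acyclic_edges E \<longleftrightarrow> (\<nexists>is js. bip_cycle E is js)"

lemma bip_cycle_mono:
  assumes "bip_cycle E is js" "E \<subseteq> E'"
  shows "bip_cycle E' is js"
  using assms unfolding bip_cycle_def by blast

lemma acyclic_edges_subset: "acyclic_edges E' \<Longrightarrow> E \<subseteq> E' \<Longrightarrow> acyclic_edges E"
  unfolding acyclic_edges_def using bip_cycle_mono by blast

lemma bip_cycle_intro:
  assumes "p + 2 \<le> q" "inj_on f {p..<q}" "inj_on g {p..<q}"
    and "\<And>t. p \<le> t \<Longrightarrow> t < q \<Longrightarrow> (f t, g t) \<in> E"
    and "\<And>t. p \<le> t \<Longrightarrow> Suc t < q \<Longrightarrow> (f (Suc t), g t) \<in> E"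
    and "(f p, g (q - 1)) \<in> E"
  shows "bip_cycle E (map f [p..<q]) (map g [p..<q])"
proof -
  have "(f (p + Suc t mod (q - p)), g (p + t)) \<in> E" if "t < q - p" for t
  proof (cases "Suc t = q - p")
    case True
    then have "p + t = q - 1" by simp
    with True assms(6) show ?thesis by simp
  next
    case False
    then have "Suc t mod (q - p) = Suc t"
      using that by simp
    then show ?thesis
      using assms(5)[of "p + t"] that False by simp
  qed
  moreover have "p + Suc t mod (q - p) < q" for t
    using assms(1) mod_less_divisor[of "q - p" "Suc t"] by linarith
  moreover have "2 \<le> q - p"
    using assms(1) by simp
  ultimately show ?thesis
    using assms by (simp add: bip_cycle_def distinct_map)
qed

text \<open>A walk that never turns back must revisit a vertex, and the first revisit closes a
  cycle.\<close>

lemma min_degree_two_cycle: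
  fixes E :: "('m::finite \<times> 'n::finite) set"
  assumes "E \<noteq> {}"
    and L: "\<And>i j. (i, j) \<in> E \<Longrightarrow> \<exists>i'. i' \<noteq> i \<and> (i', j) \<in> E"
    and R: "\<And>i j. (i, j) \<in> E \<Longrightarrow> \<exists>j'. j' \<noteq> j \<and> (i, j') \<in> E"
  shows "\<not> acyclic_edges E"
proof -
  from L obtain l where l: "\<And>i j. (i, j) \<in> E \<Longrightarrow> l i j \<noteq> i \<and> (l i j, j) \<in> E" by metis
  from R obtain r where r: "\<And>i j. (i, j) \<in> E \<Longrightarrow> r i j \<noteq> j \<and> (i, r i j) \<in> E" by metis
  obtain e0 where e0: "e0 \<in> E" using assms(1) by blast
  \<comment> \<open>\<open>w t\<close> is the edge \<open>(f t, g t)\<close> of the walk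
    \<open>f 0, g 0, f 1, g 1, ...\<close>.\<close>
  define w where "w = rec_nat e0 (\<lambda>_ e. (l (fst e) (snd e), r (l (fst e) (snd e)) (snd e)))"
  define f where "f t = fst (w t)" for t
  define g where "g t = snd (w t)" for t
  have w_Suc: "f (Suc t) = l (f t) (g t)" "g (Suc t) = r (f (Suc t)) (g t)" for t
    by (simp_all add: f_def g_def w_def)
  have edge: "(f t, g t) \<in> E" for t
  proof (induction t)
    case 0
    then show ?case using e0 by (simp add: f_def g_def w_def)
  next
    case (Suc t)
    then show ?case using l r w_Suc by metis
  qed
  then have edge': "(f (Suc t), g t) \<in> E" "f (Suc t) \<noteq> f t" "g (Suc t) \<noteq> g t" for t
    using l r w_Suc by metis+
  define P where "P q \<longleftrightarrow> (\<exists>p<q. f p = f q \<or> g p = g q)" for q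
  have "\<not> inj f"
    using finite_imageD[of f UNIV] by (metis finite infinite_UNIV_nat)
  then obtain p q where "f p = f q" "p \<noteq> q" by (auto simp: inj_def)
  then have "P p \<or> P q" unfolding P_def by (metis linorder_neqE_nat)
  then have "\<exists>q. P q" by blast
  define q where "q = (LEAST q. P q)"
  have "P q" using \<open>\<exists>q. P q\<close> unfolding q_def by (rule LeastI_ex)
  have least: "\<not> P t" if "t < q" for t using that unfolding q_def by (rule not_less_Least)
  have inj: "inj_on f {..<q}" "inj_on g {..<q}"
    using least unfolding P_def inj_on_def by (metis lessThan_iff linorder_neqE_nat)+
  show ?thesis
  proof (cases "\<exists>p<q. f p = f q")
    case True
    then obtain p where p: "p < q" "f p = f q" by blast
    have "q \<noteq> Suc p" using p(2) edge'(2)[of p] by auto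
    have "bip_cycle E (map f [p..<q]) (map g [p..<q])"
    proof (rule bip_cycle_intro)
      show "p + 2 \<le> q" using p \<open>q \<noteq> Suc p\<close> by simp
      show "inj_on f {p..<q}" "inj_on g {p..<q}" using inj by (auto simp: inj_on_def)
      show "(f p, g (q - 1)) \<in> E" using edge'(1)[of "q - 1"] p by simp
    qed (use edge edge' in auto)
    then show ?thesis unfolding acyclic_edges_def by blast
  next
    case False
    with \<open>P q\<close> obtain p where p: "p < q" "g p = g q" unfolding P_def by blast
    have "q \<noteq> Suc p" using p(2) edge'(3)[of p] by auto
    have injf: "inj_on f {..q}"
      using inj(1) False unfolding inj_on_def by (metis atMost_iff lessThan_iff order_le_less)
    \<comment> \<open>Here a right vertex is repeated: \<open>g q\<close> takes the place of
      \<open>g p\<close>, so the index range moves up by one and the closing edge is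
      \<open>(f (Suc p), g p)\<close>.\<close>
    have "bip_cycle E (map f [Suc p..<Suc q]) (map g [Suc p..<Suc q])"
    proof (rule bip_cycle_intro)
      show "Suc p + 2 \<le> Suc q" using p \<open>q \<noteq> Suc p\<close> by simp
      show "inj_on f {Suc p..<Suc q}" using injf by (auto simp: inj_on_def)
      show "inj_on g {Suc p..<Suc q}"
      proof (rule inj_onI)
        fix s t assume st: "s \<in> {Suc p..<Suc q}" "t \<in> {Suc p..<Suc q}" "g s = g t"
        have "s = t" if "s < q" "t < q" using inj(2) st(3) that by (auto simp: inj_on_def)
        moreover have "g u \<noteq> g q" if "Suc p \<le> u" "u < q" for u
        proof
          assume "g u = g q"
          then have "u = p" using inj(2) p that by (auto simp: inj_on_def)
          then show False using that by simp
        qed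
        ultimately show "s = t" using st by (metis atLeastLessThan_iff less_Suc_eq)
      qed
      show "(f (Suc p), g (Suc q - 1)) \<in> E" using edge'(1)[of p] p by simp
    qed (use edge edge' in auto)
    then show ?thesis unfolding acyclic_edges_def by blast
  qed
qed

lemma acyclic_edges_leaf:
  fixes E :: "('m::finite \<times> 'n::finite) set"
  assumes "acyclic_edges E" "E \<noteq> {}"
  shows "\<exists>i j. (i, j) \<in> E \<and>
    ((\<forall>j'. (i, j') \<in> E \<longrightarrow> j' = j) \<or> (\<forall>i'. (i', j) \<in> E \<longrightarrow> i' = i))"
  using min_degree_two_cycle[OF assms(2)] assms(1) by metis

text \<open>At a leaf a single edge carries the whole margin, so it carries 0 and can be deleted.
  The uniqueness arguments for flows on trees below rest on this.\<close>

lemma acyclic_flow_zero: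
  fixes E :: "('m::finite \<times> 'n::finite) set" and X :: "'m \<Rightarrow> 'n \<Rightarrow> 'a::comm_monoid_add"
  assumes "acyclic_edges E" "\<And>i j. (i, j) \<notin> E \<Longrightarrow> X i j = 0"
    and "\<And>i. (\<Sum>j\<in>UNIV. X i j) = 0" "\<And>j. (\<Sum>i\<in>UNIV. X i j) = 0"
  shows "X i j = 0"
  using finite[of E] assms(1,2)
proof (induction E rule: finite_psubset_induct)
  case (psubset E)
  show ?case
  proof (cases "E = {}")
    case True
    then show ?thesis using psubset.prems by blast
  next
    case False
    then obtain i' j' where e: "(i', j') \<in> E"
      "(\<forall>j. (i', j) \<in> E \<longrightarrow> j = j') \<or> (\<forall>i. (i, j') \<in> E \<longrightarrow> i = i')"
      using acyclic_edges_leaf[OF psubset.prems(1)] by blast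
    from e(2) have "X i' j' = 0"
    proof
      assume "\<forall>j. (i', j) \<in> E \<longrightarrow> j = j'"
      then have "(\<Sum>j\<in>UNIV. X i' j) = (\<Sum>j\<in>UNIV. if j = j' then X i' j' else 0)"
        by (intro sum.cong) (use psubset.prems(2) in auto)
      then have "(\<Sum>j\<in>UNIV. X i' j) = X i' j'"
        by simp
      then show ?thesis using assms(3) by metis
    next
      assume "\<forall>i. (i, j') \<in> E \<longrightarrow> i = i'"
      then have "(\<Sum>i\<in>UNIV. X i j') = (\<Sum>i\<in>UNIV. if i = i' then X i' j' else 0)"
        by (intro sum.cong) (use psubset.prems(2) in auto)
      then have "(\<Sum>i\<in>UNIV. X i j') = X i' j'"
        by simp
      then show ?thesis using assms(4) by metis
    qed
    moreover have "E - {(i', j')} \<subset> E" using e by blast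
    moreover have "acyclic_edges (E - {(i', j')})"
      using psubset.prems(1) by (rule acyclic_edges_subset) blast
    ultimately show ?thesis
      using psubset.IH[of "E - {(i', j')}"] psubset.prems(2) by blast
  qed
qed

text \<open>Deleting a leaf removes one edge and one vertex. The block \<open>L \<times> R\<close>
  is kept general because the degree count applies the bound to the edges at a subset of the right
  vertices.\<close>

lemma acyclic_edges_card:
  fixes E :: "('m::finite \<times> 'n::finite) set"
  assumes "acyclic_edges E" "E \<subseteq> L \<times> R" "L \<noteq> {} \<or> R \<noteq> {}"
  shows "card E + 1 \<le> card L + card R"
  using finite[of E] assms
proof (induction E arbitrary: L R rule: finite_psubset_induct)
  case (psubset E)
  show ?case
  proof (cases "E = {}")
    case True
    then show ?thesis
      using psubset.prems(3) by (auto simp: Suc_le_eq card_gt_0_iff)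
  next
    case False
    then obtain i j where e: "(i, j) \<in> E"
      "(\<forall>j'. (i, j') \<in> E \<longrightarrow> j' = j) \<or> (\<forall>i'. (i', j) \<in> E \<longrightarrow> i' = i)"
      using acyclic_edges_leaf[OF psubset.prems(1)] by blast
    have sub: "E - {(i, j)} \<subset> E" using e by blast
    have ac: "acyclic_edges (E - {(i, j)})"
      using psubset.prems(1) by (rule acyclic_edges_subset) blast
    have ij: "i \<in> L" "j \<in> R" using e psubset.prems(2) by auto
    have card: "card E = card (E - {(i, j)}) + 1"
      using e by (metis Suc_eq_plus1 card.remove finite)
    from e(2) show ?thesis
    proof
      assume "\<forall>j'. (i, j') \<in> E \<longrightarrow> j' = j"
      then have "E - {(i, j)} \<subseteq> (L - {i}) \<times> R" using psubset.prems(2) by auto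
      then have "card (E - {(i, j)}) + 1 \<le> card (L - {i}) + card R"
        using psubset.IH[OF sub ac] ij by blast
      moreover have "card L = card (L - {i}) + 1"
        using ij by (metis Suc_eq_plus1 card.remove finite)
      ultimately show ?thesis using card by simp
    next
      assume "\<forall>i'. (i', j) \<in> E \<longrightarrow> i' = i"
      then have "E - {(i, j)} \<subseteq> L \<times> (R - {j})" using psubset.prems(2) by auto
      then have "card (E - {(i, j)}) + 1 \<le> card L + card (R - {j})"
        using psubset.IH[OF sub ac] ij by blast
      moreover have "card R = card (R - {j}) + 1"
        using ij by (metis Suc_eq_plus1 card.remove finite)
      ultimately show ?thesis using card by simp
    qed
  qed
qed

lemma spanning_tree_altdef: "spanning_tree T \<longleftrightarrow> bip_connected T \<and> acyclic_edges T"
  by (simp add: spanning_tree_def acyclic_edges_def)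

text \<open>The sign makes each edge contribute with opposite signs at its two ends, so that a path
  carries a unit flow.\<close>

definition excess :: "('m::finite \<Rightarrow> 'n::finite \<Rightarrow> int) \<Rightarrow> 'm + 'n \<Rightarrow> int" where
  "excess X v = (case v of Inl i \<Rightarrow> \<Sum>j\<in>UNIV. X i j | Inr j \<Rightarrow> - (\<Sum>i\<in>UNIV. X i j))"

lemma excess_edge:
  "excess (\<lambda>i j. if i = i' \<and> j = j' then c else 0) v =
    (of_bool (v = Inl i') - of_bool (v = Inr j')) * c"
proof -
  have "(\<Sum>j\<in>UNIV. if i = i' \<and> j = j' then c else 0) = of_bool (i = i') * c" for i
    by (cases "i = i'") simp_all
  moreover have "(\<Sum>i\<in>UNIV. if i = i' \<and> j = j' then c else 0) = of_bool (j = j') * c" for j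
    by (cases "j = j'") simp_all
  ultimately show ?thesis
    by (cases v) (simp_all add: excess_def)
qed

lemma excess_add: "excess (\<lambda>i j. X i j + Y i j) v = excess X v + excess Y v"
  by (cases v) (simp_all add: excess_def sum.distrib)

lemma excess_scale: "excess (\<lambda>i j. c * X i j) v = c * excess X v"
  by (cases v) (simp_all add: excess_def sum_distrib_left)

lemma excess_sum: "excess (\<lambda>i j. \<Sum>a\<in>A. X a i j) v = (\<Sum>a\<in>A. excess (X a) v)"
  by (induction A rule: infinite_finite_induct) (auto simp: excess_add, auto simp: excess_def split: sum.splits)

lemma path_flow:
  fixes E :: "('m::finite \<times> 'n::finite) set"
  assumes "(x, y) \<in> (bip_adj E)\<^sup>*"
  shows "\<exists>X. (\<forall>i j. (i, j) \<notin> E \<longrightarrow> X i j = 0) \<and>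
    (\<forall>v. excess X v = of_bool (v = x) - of_bool (v = y))"
  using assms
proof (induction rule: rtrancl_induct)
  case base
  show ?case
    by (rule exI[of _ "\<lambda>_ _. 0"]) (simp add: excess_def split: sum.splits)
next
  case (step y y')
  then obtain X where X: "\<forall>i j. (i, j) \<notin> E \<longrightarrow> X i j = 0"
    "\<forall>v. excess X v = of_bool (v = x) - of_bool (v = y)" by blast
  from step(2) obtain i' j' c where c: "(i', j') \<in> E"
    "\<And>v. (of_bool (v = Inl i') - of_bool (v = Inr j')) * (c :: int) = of_bool (v = y) - of_bool (v = y')"
    unfolding bip_adj_def
  proof (elim UnE CollectE exE conjE)
    fix i j
    assume "(y, y') = (Inl i, Inr j)" "(i, j) \<in> E"
    then show thesis by (intro that[of i j 1]) auto
  next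
    fix i j
    assume "(y, y') = (Inr j, Inl i)" "(i, j) \<in> E"
    then show thesis by (intro that[of i j "- 1"]) auto
  qed
  have "excess (\<lambda>i j. X i j + (if i = i' \<and> j = j' then c else 0)) v =
      of_bool (v = x) - of_bool (v = y')" for v
    using X(2) c(2)[of v] by (simp add: excess_add excess_edge)
  then show ?case
    using X(1) c(1) by (intro exI[of _ "\<lambda>i j. X i j + (if i = i' \<and> j = j' then c else 0)"]) auto
qed

text \<open>Superposition: from each vertex \<open>x\<close> its demand \<open>d x\<close> is sent
  along a path to a fixed root. The signed demands add up to 0, so nothing is left over at the
  root.\<close>

lemma connected_flow:
  fixes E :: "('m::finite \<times> 'n::finite) set"
  assumes "bip_connected E" "(\<Sum>i\<in>UNIV. \<rho> i) = (\<Sum>j\<in>UNIV. \<gamma> j)"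
  shows "\<exists>X :: 'm \<Rightarrow> 'n \<Rightarrow> int. (\<forall>i j. (i, j) \<notin> E \<longrightarrow> X i j = 0) \<and>
    (\<forall>i. (\<Sum>j\<in>UNIV. X i j) = \<rho> i) \<and> (\<forall>j. (\<Sum>i\<in>UNIV. X i j) = \<gamma> j)"
proof -
  fix i0 :: 'm
  define d where "d v = (case v of Inl i \<Rightarrow> \<rho> i | Inr j \<Rightarrow> - \<gamma> j)" for v
  have "(\<Sum>v\<in>UNIV. d v) = (\<Sum>i\<in>UNIV. d (Inl i)) + (\<Sum>j\<in>UNIV. d (Inr j))"
    unfolding UNIV_Plus_UNIV[symmetric] by (simp add: sum.Plus del: UNIV_Plus_UNIV)
  then have d_sum: "(\<Sum>v\<in>UNIV. d v) = 0"
    using assms(2) by (simp add: d_def sum_negf)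
  have "\<forall>x. \<exists>X. (\<forall>i j. (i, j) \<notin> E \<longrightarrow> X i j = 0) \<and>
    (\<forall>v. excess X v = of_bool (v = x) - of_bool (v = Inl i0))"
    using assms(1) path_flow unfolding bip_connected_def by blast
  then obtain P where P: "\<And>x i j. (i, j) \<notin> E \<Longrightarrow> P x i j = 0"
    "\<And>x v. excess (P x) v = of_bool (v = x) - of_bool (v = Inl i0)" by metis
  define X where "X i j = (\<Sum>x\<in>UNIV. d x * P x i j)" for i j
  have "excess X v = d v" for v
  proof -
    have "excess X v = (\<Sum>x\<in>UNIV. d x * (of_bool (v = x) - of_bool (v = Inl i0)))"
      unfolding X_def[abs_def] by (simp add: excess_sum excess_scale P)
    also have "\<dots> = (\<Sum>x\<in>UNIV. if x = v then d x else 0) - of_bool (v = Inl i0) * (\<Sum>x\<in>UNIV. d x)"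
      unfolding sum_distrib_left sum_subtractf[symmetric] by (rule sum.cong) auto
    also have "\<dots> = d v" by (simp add: d_sum)
    finally show ?thesis .
  qed
  from this[of "Inl _"] this[of "Inr _"] show ?thesis
    by (intro exI[of _ X]) (simp add: X_def[of _ _] P excess_def d_def)
qed

text \<open>The block \<open>L \<times> R\<close> occurs in both margin sums and cancels. The
  margins thus determine the net flow across a cut.\<close>

lemma cut_formula:
  fixes X :: "'m::finite \<Rightarrow> 'n::finite \<Rightarrow> 'a::ab_group_add"
  shows "(\<Sum>i\<in>L. \<Sum>j\<in>- R. X i j) - (\<Sum>i\<in>- L. \<Sum>j\<in>R. X i j) =
    (\<Sum>i\<in>L. \<Sum>j\<in>UNIV. X i j) - (\<Sum>j\<in>R. \<Sum>i\<in>UNIV. X i j)"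
proof -
  have "(\<Sum>j\<in>UNIV. X i j) = (\<Sum>j\<in>- R. X i j) + (\<Sum>j\<in>R. X i j)" for i
    by (subst sum.union_disjoint[symmetric]) (auto simp: Compl_partition2 Un_commute intro: sum.cong)
  moreover have "(\<Sum>i\<in>UNIV. X i j) = (\<Sum>i\<in>L. X i j) + (\<Sum>i\<in>- L. X i j)" for j
    by (subst sum.union_disjoint[symmetric]) (auto simp: Compl_partition)
  ultimately show ?thesis
    by (simp add: sum.distrib sum.swap[of _ R])
qed

text \<open>After deletion of the edge its ends are not joined by a path: the flow along such a path
  minus the edge would be a nonzero circulation on the tree. The cut is the component of
  \<open>i0\<close>.\<close>

lemma spanning_tree_cut:
  fixes T :: "('m::finite \<times> 'n::finite) set"
  assumes T: "spanning_tree T" and e: "(i0, j0) \<in> T"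
  obtains L R where "i0 \<in> L" "j0 \<notin> R"
    "\<And>i j. (i, j) \<in> T \<Longrightarrow> (i, j) \<noteq> (i0, j0) \<Longrightarrow> i \<in> L \<longleftrightarrow> j \<in> R"
proof -
  define T' where "T' = T - {(i0, j0)}"
  define A where "A = {v. (Inl i0, v) \<in> (bip_adj T')\<^sup>*}"
  have "Inr j0 \<notin> A"
  proof
    assume "Inr j0 \<in> A"
    then obtain X where X: "\<forall>i j. (i, j) \<notin> T' \<longrightarrow> X i j = 0"
      "\<forall>v. excess X v = of_bool (v = Inl i0) - of_bool (v = Inr j0)"
      using path_flow unfolding A_def by blast
    define Y where "Y i j = X i j + (if i = i0 \<and> j = j0 then - 1 else 0)" for i j
    have Y: "excess Y v = 0" for v
      unfolding Y_def[abs_def] by (simp add: excess_add excess_edge X(2) del: of_bool_eq)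
    have "Y i0 j0 = 0"
    proof (rule acyclic_flow_zero)
      show "acyclic_edges T" using T by (simp add: spanning_tree_altdef)
      show "Y i j = 0" if "(i, j) \<notin> T" for i j
        using that e X(1) by (auto simp: Y_def T'_def)
      show "(\<Sum>j\<in>UNIV. Y i j) = 0" for i using Y[of "Inl i"] by (simp add: excess_def)
      show "(\<Sum>i\<in>UNIV. Y i j) = 0" for j using Y[of "Inr j"] by (simp add: excess_def)
    qed
    then show False using X(1) by (simp add: Y_def T'_def)
  qed
  moreover have "Inl i \<in> A \<longleftrightarrow> Inr j \<in> A" if "(i, j) \<in> T" "(i, j) \<noteq> (i0, j0)" for i j
  proof -
    have "(Inl i, Inr j) \<in> bip_adj T'" "(Inr j, Inl i) \<in> bip_adj T'"
      using that by (auto simp: bip_adj_def T'_def)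
    then show ?thesis unfolding A_def by (meson mem_Collect_eq rtrancl.rtrancl_into_rtrancl)
  qed
  moreover have "Inl i0 \<in> A" by (simp add: A_def)
  ultimately show thesis
    by (intro that[of "{i. Inl i \<in> A}" "{j. Inr j \<in> A}"]) auto
qed

lemma disconnected_cut:
  fixes E :: "('m \<times> 'n) set"
  assumes "\<not> bip_connected E"
  obtains L R where "\<And>i j. (i, j) \<in> E \<Longrightarrow> i \<in> L \<longleftrightarrow> j \<in> R"
    "L \<noteq> {} \<or> R \<noteq> {}" "L \<noteq> UNIV \<or> R \<noteq> UNIV"
proof -
  obtain x y where xy: "(x, y) \<notin> (bip_adj E)\<^sup>*"
    using assms by (auto simp: bip_connected_def)
  define A where "A = {v. (x, v) \<in> (bip_adj E)\<^sup>*}"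
  have xA: "x \<in> A" "y \<notin> A" using xy by (auto simp: A_def)
  have "Inl i \<in> A \<longleftrightarrow> Inr j \<in> A" if "(i, j) \<in> E" for i j
  proof -
    have "(Inl i, Inr j) \<in> bip_adj E" "(Inr j, Inl i) \<in> bip_adj E"
      using that by (auto simp: bip_adj_def)
    then show ?thesis unfolding A_def by (meson mem_Collect_eq rtrancl.rtrancl_into_rtrancl)
  qed
  moreover have "{i. Inl i \<in> A} \<noteq> {} \<or> {j. Inr j \<in> A} \<noteq> {}" using xA(1) by (cases x) auto
  moreover have "{i. Inl i \<in> A} \<noteq> UNIV \<or> {j. Inr j \<in> A} \<noteq> UNIV" using xA(2) by (cases y) auto
  ultimately show thesis
    by (intro that[of "{i. Inl i \<in> A}" "{j. Inr j \<in> A}"]) auto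
qed

subsection \<open>Fundamental cycles\<close>

text \<open>A cycle of length \<open>2 * s\<close>, extended periodically to the integers: rotating and reversing it
  become translation and reflection of the index.\<close>

definition periodic_cycle ::
    "('m \<times> 'n) set \<Rightarrow> nat \<Rightarrow> (int \<Rightarrow> 'm) \<Rightarrow> (int \<Rightarrow> 'n) \<Rightarrow> bool" where
  "periodic_cycle E s f g \<longleftrightarrow> 2 \<le> s \<and>
     (\<forall>x y. f x = f y \<longleftrightarrow> x mod int s = y mod int s) \<and>
     (\<forall>x y. g x = g y \<longleftrightarrow> x mod int s = y mod int s) \<and>
     (\<forall>x. (f x, g x) \<in> E \<and> (f (x + 1), g x) \<in> E)"

lemma bip_cycle_imp_periodic:
  assumes "bip_cycle E is js"
  shows "periodic_cycle E (length is) (\<lambda>x. is ! nat (x mod int (length is)))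
    (\<lambda>x. js ! nat (x mod int (length is)))"
proof -
  define s where "s = length is"
  have c: "length js = s" "2 \<le> s" "distinct is" "distinct js"
    "\<And>t. t < s \<Longrightarrow> (is ! t, js ! t) \<in> E \<and> (is ! (Suc t mod s), js ! t) \<in> E"
    using assms by (auto simp: bip_cycle_def s_def)
  have lt: "nat (x mod int s) < s" for x
    using c(2) by (simp add: nat_less_iff)
  have nat_eq: "nat (x mod int s) = nat (y mod int s) \<longleftrightarrow> x mod int s = y mod int s" for x y
    using c(2) by (simp add: nat_eq_iff)
  have Suc: "nat ((x + 1) mod int s) = Suc (nat (x mod int s)) mod s" for x
  proof -
    have "int (Suc (nat (x mod int s)) mod s) = (x mod int s + 1) mod int s"
      using c(2) by (simp add: zmod_int add.commute)
    also have "\<dots> = (x + 1) mod int s"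
      by (simp add: mod_add_left_eq)
    finally show ?thesis
      by (metis nat_int)
  qed
  have len: "length is = s" by (simp add: s_def)
  show ?thesis
    unfolding periodic_cycle_def len Suc
    using c lt len by (simp add: nth_eq_iff_index_eq nat_eq)
qed

lemma periodic_imp_bip_cycle:
  assumes "periodic_cycle E s f g"
  shows "bip_cycle E (map (\<lambda>t. f (int t)) [0..<s]) (map (\<lambda>t. g (int t)) [0..<s])"
proof -
  have s: "2 \<le> s" using assms by (simp add: periodic_cycle_def)
  have f: "f x = f y \<longleftrightarrow> x mod int s = y mod int s" and g: "g x = g y \<longleftrightarrow> x mod int s = y mod int s"
    and e: "(f x, g x) \<in> E" "(f (x + 1), g x) \<in> E" for x y
    using assms by (auto simp: periodic_cycle_def)
  have "f (int (Suc t mod s)) = f (int t + 1)" for t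
    by (simp add: f zmod_int add.commute)
  then have "(f (int (Suc t mod s)), g (int t)) \<in> E" for t
    using e(2)[of "int t"] by (simp only:)
  moreover have "Suc t mod s < s" for t using s by simp
  ultimately show ?thesis
    using s e(1) by (simp add: bip_cycle_def distinct_map inj_on_def f g)
qed

text \<open>An edge of the first kind comes to the front by rotation alone. One of the second kind
  also needs reversal, since a cycle leaves its first edge through the right endpoint.\<close>

lemma bip_cycle_start:
  assumes c: "bip_cycle E is js" and t: "t < length is"
    and e: "e = (is ! t, js ! t) \<or> e = (is ! (Suc t mod length is), js ! t)"
  shows "\<exists>is' js'. bip_cycle E is' js' \<and> (hd is', hd js') = e"
proof -
  define s where "s = length is"
  define f where "f x = is ! nat (x mod int s)" for x
  define g where "g x = js ! nat (x mod int s)" for x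
  have p: "periodic_cycle E s f g"
    unfolding s_def f_def g_def using bip_cycle_imp_periodic[OF c] by simp
  then have s: "2 \<le> s" by (simp add: periodic_cycle_def)
  have ft: "f (int t) = is ! t" "g (int t) = js ! t"
    using t by (simp_all add: f_def g_def s_def)
  have ft1: "f (int t + 1) = is ! (Suc t mod s)"
  proof -
    have "(int t + 1) mod int s = int (Suc t mod s)"
      by (simp add: zmod_int add.commute)
    then show ?thesis by (simp only: f_def nat_int)
  qed
  have "\<exists>f' g'. periodic_cycle E s f' g' \<and> (f' 0, g' 0) = e"
    using e
  proof
    assume "e = (is ! t, js ! t)"
    moreover have "periodic_cycle E s (\<lambda>x. f (int t + x)) (\<lambda>x. g (int t + x))"
    proof -
      have "(a + x) mod int s = (a + y) mod int s \<longleftrightarrow> x mod int s = y mod int s" for a x y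
        by (simp add: mod_eq_dvd_iff)
      moreover have "(f (int t + x), g (int t + x)) \<in> E" "(f (int t + (x + 1)), g (int t + x)) \<in> E" for x
        using p[unfolded periodic_cycle_def] by (simp_all flip: add.assoc)
      ultimately show ?thesis
        using p unfolding periodic_cycle_def by simp
    qed
    ultimately show ?thesis
      using ft by (intro exI[of _ "\<lambda>x. f (int t + x)"] exI[of _ "\<lambda>x. g (int t + x)"]) simp
  next
    assume "e = (is ! (Suc t mod length is), js ! t)"
    \<comment> \<open>Reflection exchanges the two kinds of edges, which is why the offsets of
      \<open>f\<close> and \<open>g\<close> differ by one.\<close>
    moreover have "periodic_cycle E s (\<lambda>x. f (int t + 1 - x)) (\<lambda>x. g (int t - x))"
    proof -
      have mod_iff: "(a - x) mod int s = (a - y) mod int s \<longleftrightarrow> x mod int s = y mod int s" for a x y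
        using dvd_diff_commute[of "int s" x y] by (simp add: mod_eq_dvd_iff)
      have "(f (int t + 1 - x), g (int t - x)) \<in> E" for x
        using p[unfolded periodic_cycle_def] by (metis add_diff_eq diff_add_eq)
      moreover have "(f (int t + 1 - (x + 1)), g (int t - x)) \<in> E" for x
        using p[unfolded periodic_cycle_def] by simp
      ultimately show ?thesis
        using p mod_iff unfolding periodic_cycle_def by blast
    qed
    ultimately show ?thesis
      using ft ft1 by (intro exI[of _ "\<lambda>x. f (int t + 1 - x)"] exI[of _ "\<lambda>x. g (int t - x)"])
        (simp add: s_def)
  qed
  then obtain f' g' where "periodic_cycle E s f' g'" "(f' 0, g' 0) = e" by blast
  then show ?thesis
    using periodic_imp_bip_cycle s
    by (intro exI[of _ "map (\<lambda>t. f' (int t)) [0..<s]"] exI[of _ "map (\<lambda>t. g' (int t)) [0..<s]"])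
      (simp add: hd_map)
qed

text \<open>The matrix part of \<open>cyc\<close>, separated from the choice of the cycle.\<close>

definition cycle_matrix :: "'m::finite list \<Rightarrow> 'n::finite list \<Rightarrow> int ^ 'n ^ 'm" where
  "cycle_matrix is js = (\<chi> i j. if \<exists>t < length is. i = is ! t \<and> j = js ! t then 1
               else if \<exists>t < length is. i = is ! (Suc t mod length is) \<and> j = js ! t then - 1
               else 0)"

text \<open>Equal columns force \<open>t = u\<close>, and consecutive rows differ because the length
  is at least 2.\<close>

lemma bip_cycle_disjoint:
  assumes c: "bip_cycle E is js" and "t < length is" "u < length is"
  shows "(is ! t, js ! t) \<noteq> (is ! (Suc u mod length is), js ! u)"
proof
  assume eq: "(is ! t, js ! t) = (is ! (Suc u mod length is), js ! u)"
  have c': "length is = length js" "2 \<le> length is" "distinct is" "distinct js"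
    using c by (auto simp: bip_cycle_def)
  have "t = u" using eq c' assms(2,3) by (simp add: nth_eq_iff_index_eq)
  moreover have "Suc u mod length is < length is" using c'(2) by (intro mod_less_divisor) linarith
  then have "t = Suc u mod length is" using eq c' assms(2) by (simp add: nth_eq_iff_index_eq)
  ultimately have "u = Suc u mod length is" by simp
  then show False
    using c'(2) assms(3) by (cases "Suc u = length is") auto
qed

text \<open>The positions of the two signs never coincide, so the nested conditional becomes a
  difference of sums, which can be interchanged with row and column sums.\<close>

lemma cycle_matrix_altdef:
  assumes c: "bip_cycle E is js"
  shows "cycle_matrix is js $ i $ j = (\<Sum>t<length is. of_bool (i = is ! t \<and> j = js ! t)) -
    (\<Sum>t<length is. of_bool (i = is ! (Suc t mod length is) \<and> j = js ! t))"
proof -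
  have c': "length is = length js" "distinct is" "distinct js"
    using c by (auto simp: bip_cycle_def)
  have unique: "(\<Sum>t<length is. of_bool (P t \<and> j = js ! t)) = (of_bool (\<exists>t<length is. P t \<and> j = js ! t) :: int)" for P
  proof (cases "\<exists>t<length is. P t \<and> j = js ! t")
    case True
    then obtain t where t: "t < length is" "P t" "j = js ! t" by blast
    have "(\<Sum>u<length is. of_bool (P u \<and> j = js ! u)) = (\<Sum>u<length is. if u = t then 1 else (0::int))"
      by (rule sum.cong) (use t c' in \<open>auto simp: nth_eq_iff_index_eq\<close>)
    then show ?thesis using t(1) True by simp
  qed auto
  define A where "A \<longleftrightarrow> (\<exists>t<length is. i = is ! t \<and> j = js ! t)"
  define B where "B \<longleftrightarrow> (\<exists>t<length is. i = is ! (Suc t mod length is) \<and> j = js ! t)"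
  have "\<not> (A \<and> B)"
    unfolding A_def B_def using bip_cycle_disjoint[OF c] by metis
  moreover have "cycle_matrix is js $ i $ j = (if A then 1 else if B then - 1 else 0)"
    unfolding cycle_matrix_def A_def B_def by (simp only: vec_lambda_beta)
  ultimately show ?thesis
    unfolding unique A_def[symmetric] B_def[symmetric] by auto
qed

text \<open>In a row sum the positive and negative parts agree after a cyclic shift of the index, in
  a column sum they agree term by term.\<close>

lemma sum_cycle_matrix:
  assumes c: "bip_cycle E is js"
  shows "(\<Sum>j\<in>UNIV. cycle_matrix is js $ i $ j) = 0" "(\<Sum>i\<in>UNIV. cycle_matrix is js $ i $ j) = 0"
proof -
  define s where "s = length is"
  have s: "0 < s" "2 \<le> s" using c by (auto simp: bip_cycle_def s_def)
  have inj: "inj_on (\<lambda>t. Suc t mod s) {..<s}"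
    unfolding inj_on_def using s by (auto simp: mod_Suc split: if_splits)
  moreover have "(\<lambda>t. Suc t mod s) ` {..<s} \<subseteq> {..<s}" using s by auto
  ultimately have bij: "bij_betw (\<lambda>t. Suc t mod s) {..<s} {..<s}"
    by (simp add: bij_betw_def endo_inj_surj)
  have *: "(\<Sum>j\<in>UNIV. of_bool (Q \<and> j = y)) = (of_bool Q :: int)" for Q and y :: "'b"
    by (cases Q) simp_all
  have **: "(\<Sum>j\<in>UNIV. of_bool (j = y \<and> Q)) = (of_bool Q :: int)" for Q and y :: "'a"
    by (cases Q) simp_all
  have "(\<Sum>j\<in>UNIV. cycle_matrix is js $ i $ j) =
      (\<Sum>t<s. of_bool (i = is ! t)) - (\<Sum>t<s. of_bool (i = is ! (Suc t mod s)))"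
    unfolding cycle_matrix_altdef[OF c] sum_subtractf s_def[symmetric]
    by (subst (1 2) sum.swap) (simp add: *)
  also have "(\<Sum>t<s. of_bool (i = is ! (Suc t mod s))) = (\<Sum>t<s. of_bool (i = is ! t) :: int)"
    by (rule sum.reindex_bij_betw[OF bij])
  finally show "(\<Sum>j\<in>UNIV. cycle_matrix is js $ i $ j) = 0" by simp
  show "(\<Sum>i\<in>UNIV. cycle_matrix is js $ i $ j) = 0"
    unfolding cycle_matrix_altdef[OF c] sum_subtractf s_def[symmetric]
    by (subst (1 2) sum.swap) (simp add: **)
qed

lemma cycle_matrix_outside:
  assumes "bip_cycle E is js" "(i, j) \<notin> E"
  shows "cycle_matrix is js $ i $ j = 0"
  using assms by (auto simp: bip_cycle_def cycle_matrix_def)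

lemma cycle_matrix_hd:
  assumes "bip_cycle E is js"
  shows "cycle_matrix is js $ hd is $ hd js = 1"
proof -
  have "0 < length is" "length is = length js" "is \<noteq> []" "js \<noteq> []"
    using assms by (auto simp: bip_cycle_def)
  then have "\<exists>t<length is. hd is = is ! t \<and> hd js = js ! t"
    by (intro exI[of _ 0]) (auto simp: hd_conv_nth)
  then show ?thesis by (simp add: cycle_matrix_def)
qed

text \<open>A cycle can be traced in its matrix from its first edge: the entry -1 in the current
  column gives the next row, and the entry 1 in that row gives the next column. This makes the
  definite description in \<open>cyc\<close> unique.\<close>

lemma cycle_matrix_inject:
  assumes c: "bip_cycle E is js" and c': "bip_cycle E' is' js'"
    and eq: "cycle_matrix is js = cycle_matrix is' js'" and hd: "hd is = hd is'" "hd js = hd js'"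
    and le: "length is \<le> length is'"
  shows "is = is' \<and> js = js'"
proof -
  define s where "s = length is"
  define s' where "s' = length is'"
  have len: "length js = s" "length js' = s'" "2 \<le> s" "s \<le> s'"
    and dist: "distinct is" "distinct js" "distinct is'" "distinct js'"
    using c c' le by (auto simp: bip_cycle_def s_def s'_def)
  have plus': "cycle_matrix is' js' $ (is' ! t) $ (js' ! t) = 1" if "t < s'" for t
    using that by (auto simp: cycle_matrix_def s'_def)
  have minus': "cycle_matrix is' js' $ (is' ! (Suc t mod s')) $ (js' ! t) = - 1" if "t < s'" for t
  proof -
    have "\<not> (\<exists>u<s'. is' ! (Suc t mod s') = is' ! u \<and> js' ! t = js' ! u)"
      using bip_cycle_disjoint[OF c'] that unfolding s'_def by metis
    then show ?thesis
      using that by (auto simp: cycle_matrix_def s'_def)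
  qed
  have plus: "\<exists>u<s. i = is ! u \<and> j = js ! u" if "cycle_matrix is js $ i $ j = 1" for i j
    using that by (auto simp: cycle_matrix_def s_def split: if_splits)
  have minus: "\<exists>u<s. i = is ! (Suc u mod s) \<and> j = js ! u" if "cycle_matrix is js $ i $ j = - 1" for i j
    using that by (auto simp: cycle_matrix_def s_def split: if_splits)
  have row: "is ! (Suc t mod s) = is' ! (Suc t mod s')" if t: "t < s" "js ! t = js' ! t" for t
  proof -
    obtain u where "u < s" "is' ! (Suc t mod s') = is ! (Suc u mod s)" "js' ! t = js ! u"
      using minus[of "is' ! (Suc t mod s')" "js' ! t"] minus'[of t] t len(4) eq by auto
    moreover from this have "u = t"
      using t dist(2) len(1) by (simp add: nth_eq_iff_index_eq)
    ultimately show ?thesis by simp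
  qed
  have nth: "is ! t = is' ! t \<and> js ! t = js' ! t" if "t < s" for t
    using that
  proof (induction t)
    case 0
    have "is \<noteq> []" "is' \<noteq> []" "js \<noteq> []" "js' \<noteq> []"
      using len s_def s'_def by auto
    then show ?case
      using hd by (simp add: hd_conv_nth)
  next
    case (Suc t)
    then have "is ! Suc t = is' ! Suc t"
      using row[of t] len(4) by simp
    moreover obtain u where "u < s" "is' ! Suc t = is ! u" "js' ! Suc t = js ! u"
      using plus[of "is' ! Suc t" "js' ! Suc t"] plus'[of "Suc t"] Suc.prems len(4) eq by auto
    moreover from calculation have "u = Suc t"
      using Suc.prems dist(1) by (metis nth_eq_iff_index_eq s_def)
    ultimately show ?case by simp
  qed
  have "s = s'"
  proof (rule ccontr)
    assume "s \<noteq> s'"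
    then have "s < s'" using len(4) by simp
    have "is ! (Suc (s - 1) mod s) = is' ! (Suc (s - 1) mod s')"
      using row[of "s - 1"] nth[of "s - 1"] len(3) by simp
    then have "is' ! 0 = is' ! s"
      using nth[of 0] len(3) \<open>s < s'\<close> by simp
    moreover have "0 < length is'" "s < length is'"
      using \<open>s < s'\<close> by (auto simp: s'_def)
    note nth_eq_iff_index_eq[OF dist(3) this]
    ultimately show False
      using len(3) by simp
  qed
  then show ?thesis
    using nth len by (auto simp: s_def s'_def intro: nth_equalityI)
qed

text \<open>A flow on \<open>T\<close> with margins -1 at \<open>i0\<close> and \<open>j0\<close>,
  completed by 1 on the new edge, is a nonzero circulation, so a cycle exists. It is unique because
  the difference of two such cycle matrices is a circulation on \<open>T\<close>.\<close>

lemma cyc_eq_cycle_matrix: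
  fixes T :: "('m::finite \<times> 'n::finite) set"
  assumes T: "spanning_tree T" and e: "(i0, j0) \<notin> T"
  obtains "is" js where "bip_cycle (insert (i0, j0) T) is js" "(hd is, hd js) = (i0, j0)"
    "cyc T (i0, j0) = cycle_matrix is js"
proof -
  have conn: "bip_connected T" and ac: "acyclic_edges T"
    using T by (auto simp: spanning_tree_altdef)
  have sums: "(\<Sum>i\<in>UNIV. - of_bool (i = i0) :: int) = (\<Sum>j\<in>UNIV. - of_bool (j = j0))"
    by (simp add: sum_negf)
  obtain X :: "'m \<Rightarrow> 'n \<Rightarrow> int" where X: "\<forall>i j. (i, j) \<notin> T \<longrightarrow> X i j = 0"
    "\<forall>i. (\<Sum>j\<in>UNIV. X i j) = - of_bool (i = i0)" "\<forall>j. (\<Sum>i\<in>UNIV. X i j) = - of_bool (j = j0)"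
    using connected_flow[OF conn sums] by blast
  have "\<not> acyclic_edges (insert (i0, j0) T)"
  proof
    assume ac': "acyclic_edges (insert (i0, j0) T)"
    have "X i0 j0 + of_bool (i0 = i0 \<and> j0 = j0) = 0"
    proof (rule acyclic_flow_zero[OF ac', where X = "\<lambda>i j. X i j + of_bool (i = i0 \<and> j = j0)"])
      show "X i j + of_bool (i = i0 \<and> j = j0) = 0" if "(i, j) \<notin> insert (i0, j0) T" for i j
        using that X(1) by auto
      show "(\<Sum>j\<in>UNIV. X i j + of_bool (i = i0 \<and> j = j0)) = 0" for i
        by (cases "i = i0") (simp_all add: sum.distrib X(2))
      show "(\<Sum>i\<in>UNIV. X i j + of_bool (i = i0 \<and> j = j0)) = 0" for j
        by (cases "j = j0") (simp_all add: sum.distrib X(3))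
    qed
    then show False using X(1) e by simp
  qed
  then obtain "is" js where c: "bip_cycle (insert (i0, j0) T) is js"
    by (auto simp: acyclic_edges_def)
  have "\<exists>t<length is. (i0, j0) = (is ! t, js ! t) \<or> (i0, j0) = (is ! (Suc t mod length is), js ! t)"
  proof (rule ccontr)
    assume "\<not> ?thesis"
    then have "bip_cycle T is js"
      using c unfolding bip_cycle_def by (metis insert_iff)
    then show False using ac by (auto simp: acyclic_edges_def)
  qed
  then obtain "is'" js' where c': "bip_cycle (insert (i0, j0) T) is' js'" "(hd is', hd js') = (i0, j0)"
    using bip_cycle_start[OF c] by metis
  have unique: "is1 = is' \<and> js1 = js'"
    if c1: "bip_cycle (insert (i0, j0) T) is1 js1" "(hd is1, hd js1) = (i0, j0)" for is1 js1
  proof -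
    have "cycle_matrix is1 js1 $ i $ j - cycle_matrix is' js' $ i $ j = 0" for i j
    proof (rule acyclic_flow_zero[OF ac,
          where X = "\<lambda>i j. cycle_matrix is1 js1 $ i $ j - cycle_matrix is' js' $ i $ j"])
      show "cycle_matrix is1 js1 $ i $ j - cycle_matrix is' js' $ i $ j = 0" if "(i, j) \<notin> T" for i j
        using that c1 c' cycle_matrix_hd[OF c1(1)] cycle_matrix_hd[OF c'(1)]
          cycle_matrix_outside[OF c1(1), of i j] cycle_matrix_outside[OF c'(1), of i j]
        by (cases "(i, j) = (i0, j0)") auto
    qed (simp_all add: sum_subtractf sum_cycle_matrix[OF c1(1)] sum_cycle_matrix[OF c'(1)])
    then have "cycle_matrix is1 js1 = cycle_matrix is' js'"
      by (simp add: vec_eq_iff)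
    then show ?thesis
      using cycle_matrix_inject[OF c1(1) c'(1)] cycle_matrix_inject[OF c'(1) c1(1)] c1(2) c'(2)
      by (metis Pair_inject nat_le_linear)
  qed
  have "(THE (is, js). bip_cycle (insert (i0, j0) T) is js \<and> (hd is, hd js) = (i0, j0)) = (is', js')"
  proof (rule the_equality)
    show "case (is', js') of (is, js) \<Rightarrow> bip_cycle (insert (i0, j0) T) is js \<and> (hd is, hd js) = (i0, j0)"
      using c' by (simp only: prod.case)
  next
    fix x
    assume "case x of (is, js) \<Rightarrow> bip_cycle (insert (i0, j0) T) is js \<and> (hd is, hd js) = (i0, j0)"
    then show "x = (is', js')"
      using unique[of "fst x" "snd x"] by (simp add: case_prod_beta prod_eq_iff)
  qed
  then have "cyc T (i0, j0) = cycle_matrix is' js'"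
    by (simp add: cyc_def cycle_matrix_def Let_def)
  with c' show thesis using that by blast
qed

text \<open>All that the cones use of \<open>cyc\<close>: it is a circulation whose off-tree part is
  the unit vector at the edge. The matrices \<open>cyc T e\<close> are thus dual to the off-tree
  coordinates.\<close>

lemma cyc_props:
  fixes T :: "('m::finite \<times> 'n::finite) set"
  assumes "spanning_tree T" "(i0, j0) \<notin> T"
  shows cyc_row_sum: "(\<Sum>j\<in>UNIV. cyc T (i0, j0) $ i $ j) = 0"
    and cyc_col_sum: "(\<Sum>i\<in>UNIV. cyc T (i0, j0) $ i $ j) = 0"
    and cyc_outside: "(i, j) \<notin> T \<Longrightarrow> cyc T (i0, j0) $ i $ j = of_bool ((i, j) = (i0, j0))"
proof -
  obtain "is" js where c: "bip_cycle (insert (i0, j0) T) is js" "(hd is, hd js) = (i0, j0)"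
    "cyc T (i0, j0) = cycle_matrix is js"
    using cyc_eq_cycle_matrix[OF assms] .
  show "(\<Sum>j\<in>UNIV. cyc T (i0, j0) $ i $ j) = 0" "(\<Sum>i\<in>UNIV. cyc T (i0, j0) $ i $ j) = 0"
    using sum_cycle_matrix[OF c(1)] by (simp_all add: c(3))
  show "cyc T (i0, j0) $ i $ j = of_bool ((i, j) = (i0, j0))" if "(i, j) \<notin> T"
    using cycle_matrix_hd[OF c(1)] cycle_matrix_outside[OF c(1), of i j] c(2,3) that
    by (cases "(i, j) = (i0, j0)") auto
qed

section \<open>Decomposition into unimodular cones\<close>

text \<open>The sets with and without \<open>a\<close> cancel in pairs.\<close>

lemma alternating_sum_toggle:
  fixes \<phi> :: "'a set \<Rightarrow> 'b::comm_ring_1"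
  assumes "finite A" "a \<in> A" "\<And>K. K \<subseteq> A - {a} \<Longrightarrow> \<phi> (insert a K) = \<phi> K"
  shows "(\<Sum>K\<in>Pow A. (- 1) ^ card K * \<phi> K) = 0"
proof -
  define B where "B = A - {a}"
  have A: "A = insert a B" "a \<notin> B" "finite B" using assms by (auto simp: B_def)
  have "(\<Sum>K\<in>Pow A. (- 1) ^ card K * \<phi> K) =
      (\<Sum>K\<in>Pow B. (- 1) ^ card K * \<phi> K) + (\<Sum>K\<in>insert a ` Pow B. (- 1) ^ card K * \<phi> K)"
    unfolding A(1) Pow_insert by (rule sum.union_disjoint) (use A in auto)
  also have "(\<Sum>K\<in>insert a ` Pow B. (- 1) ^ card K * \<phi> K) =
      (\<Sum>K\<in>Pow B. (- 1) ^ card (insert a K) * \<phi> (insert a K))"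
    by (rule sum.reindex_cong[where l = "insert a"]) (use A in \<open>auto simp: inj_on_def\<close>)
  also have "\<dots> = (\<Sum>K\<in>Pow B. - ((- 1) ^ card K * \<phi> K))"
  proof (rule sum.cong)
    fix K assume K: "K \<in> Pow B"
    then have "finite K" "a \<notin> K" using A finite_subset by auto
    then show "(- 1) ^ card (insert a K) * \<phi> (insert a K) = - ((- 1) ^ card K * \<phi> K)"
      using assms(3)[of K] K by (simp add: B_def)
  qed simp
  finally show ?thesis by (simp add: sum_negf)
qed

lemma has_fract_sign:
  assumes "has_fract s f"
  shows "has_fract (\<lambda>X. (- 1) ^ n * s X) ((- 1) ^ n * f)"
proof (cases "even n")
  case False
  have "act (- 1) s = (\<lambda>X. - s X)"
    by (simp add: fun_eq_iff act_uminus_left)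
  moreover have "Fract (- 1) 1 = (- 1 :: ('a \<Rightarrow>\<^sub>0 complex) fract)"
    by (simp flip: minus_fract One_fract_def)
  ultimately show ?thesis
    using has_fract_act[OF assms, of "- 1"] False by simp
qed (use assms in simp)

text \<open>Only the edges outside \<open>G\<close> keep their sign condition, so the set grows with
  \<open>G\<close>. For a tree it is the set of lattice points of a simplicial cone.\<close>

definition relaxed_points ::
    "nat \<Rightarrow> nat \<Rightarrow> ('m::finite \<times> 'n::finite) set \<Rightarrow> (int ^ 'n ^ 'm) set" where
  "relaxed_points k s G = {X. (\<forall>i. (\<Sum>j\<in>UNIV. X $ i $ j) = int s) \<and>
     (\<forall>j. (\<Sum>i\<in>UNIV. X $ i $ j) = int (k * s)) \<and> (\<forall>i j. (i, j) \<notin> G \<longrightarrow> 0 \<le> X $ i $ j)}"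

text \<open>The flow \<open>Y\<close> has row sums \<open>N = n + 1\<close> and column sums \<open>k * N + 1\<close>, except for \<open>k * N + 1 - n\<close>
  in the last column. Up to scaling these are small generic perturbations of the row sums \<open>1\<close> and the
  column sums \<open>k\<close>, so the trees with positive flow are the vertices of a simple polytope.\<close>

definition pert_row :: "'n::finite itself \<Rightarrow> int" where
  "pert_row _ = int CARD('n) + 1"

definition pert_col :: "nat \<Rightarrow> 'n::{finite,linorder} \<Rightarrow> int" where
  "pert_col k j = int k * pert_row TYPE('n) + 1 - (if j = Max UNIV then int CARD('n) else 0)"

definition is_pert_flow ::
    "nat \<Rightarrow> ('m::finite \<times> 'n::{finite,linorder}) set \<Rightarrow> ('m \<Rightarrow> 'n \<Rightarrow> int) \<Rightarrow> bool" where
  "is_pert_flow k T Y \<longleftrightarrow> (\<forall>i j. (i, j) \<notin> T \<longrightarrow> Y i j = 0) \<and>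
     (\<forall>i. (\<Sum>j\<in>UNIV. Y i j) = pert_row TYPE('n)) \<and> (\<forall>j. (\<Sum>i\<in>UNIV. Y i j) = pert_col k j)"

text \<open>The criterion for \<open>T\<close> to give a vertex of the perturbed polyhedron without
  the sign conditions on \<open>G\<close>: free edges belong to the tree, and only the other tree
  edges must carry positive flow. For a spanning tree with balanced margins the quantified
  \<open>Y\<close> exists and is unique.\<close>

definition feasible ::
    "nat \<Rightarrow> ('m::finite \<times> 'n::{finite,linorder}) set \<Rightarrow> ('m \<times> 'n) set \<Rightarrow> bool" where
  "feasible k T G \<longleftrightarrow> G \<subseteq> T \<and>
     (\<forall>Y. is_pert_flow k T Y \<longrightarrow> (\<forall>(i, j)\<in>T - G. 0 < Y i j))"

text \<open>Closed form of the net perturbed flow from \<open>L\<close> to \<open>- R\<close> minus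
  the flow from \<open>- L\<close> to \<open>R\<close>; see \<open>sum_pert_margins\<close> and
  \<open>cut_formula\<close>.\<close>

definition pert_excess ::
    "nat \<Rightarrow> 'm::finite set \<Rightarrow> 'n::{finite,linorder} set \<Rightarrow> int" where
  "pert_excess k L R = pert_row TYPE('n) * (int (card L) - int k * int (card R))
     - int (card R) + of_bool (Max UNIV \<in> R) * int CARD('n)"

lemma sum_pert_margins:
  fixes L :: "'m::finite set" and R :: "'n::{finite,linorder} set"
  shows "(\<Sum>i\<in>L. pert_row TYPE('n)) - (\<Sum>j\<in>R. pert_col k j) = pert_excess k L R"
proof -
  have "(\<Sum>j\<in>R. pert_col k j) = int (card R) * (int k * pert_row TYPE('n) + 1) -
      (\<Sum>j\<in>R. if j = Max UNIV then int CARD('n) else 0)"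
    by (simp add: pert_col_def sum_subtractf)
  also have "(\<Sum>j\<in>R. if j = Max UNIV then int CARD('n) else 0) = of_bool (Max UNIV \<in> R) * int CARD('n)"
    by simp
  finally show ?thesis
    by (simp add: pert_excess_def algebra_simps)
qed

text \<open>The total margins balance. This allows a cut to be oriented so that its excess is
  positive.\<close>

lemma pert_excess_Compl:
  fixes L :: "'m::finite set" and R :: "'n::{finite,linorder} set"
  assumes "CARD('m) = k * CARD('n)"
  shows "pert_excess k (- L) (- R) = - pert_excess k L R"
proof -
  have L: "int (card (- L)) = int k * int CARD('n) - int (card L)"
    using card_mono[of UNIV L] assms by (simp add: Compl_eq_Diff_UNIV card_Diff_subset of_nat_diff)
  have R: "int (card (- R)) = int CARD('n) - int (card R)"
    using card_mono[of UNIV R] by (simp add: Compl_eq_Diff_UNIV card_Diff_subset of_nat_diff)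
  show ?thesis
    unfolding pert_excess_def L R by (simp add: algebra_simps)
qed

text \<open>The corrections add at most n, too little to lift a negative multiple of n + 1 above
  0.\<close>

lemma pert_excess_pos:
  fixes L :: "'m::finite set" and R :: "'n::{finite,linorder} set"
  assumes "0 < pert_excess k L R"
  shows "k * card R \<le> card L"
proof (rule ccontr)
  define d where "d = int (card L) - int k * int (card R)"
  assume "\<not> ?thesis"
  then have "int (card L) < int (k * card R)"
    by (simp only: not_le of_nat_less_iff)
  then have "d \<le> - 1" by (simp add: d_def)
  then have "pert_row TYPE('n) * d \<le> pert_row TYPE('n) * - 1"
    by (intro mult_left_mono) (auto simp: pert_row_def)
  then have "pert_excess k L R \<le> - 1"
    unfolding pert_excess_def d_def[symmetric] by (auto simp: pert_row_def)
  with assms show False by simp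
qed

text \<open>Genericity of the perturbation. The corrections are smaller than n + 1 in absolute
  value, so a zero excess makes both the multiple and the corrections vanish, which leaves only the
  two trivial cuts.\<close>

lemma pert_excess_nonzero:
  fixes L :: "'m::finite set" and R :: "'n::{finite,linorder} set"
  assumes "CARD('m) = k * CARD('n)"
    and "L \<noteq> {} \<or> R \<noteq> {}" "L \<noteq> UNIV \<or> R \<noteq> UNIV"
  shows "pert_excess k L R \<noteq> 0"
proof
  assume zero: "pert_excess k L R = 0"
  define d where "d = int (card L) - int k * int (card R)"
  have eq: "pert_row TYPE('n) * d = int (card R) - of_bool (Max UNIV \<in> R) * int CARD('n)"
    using zero unfolding pert_excess_def d_def by simp
  have le: "card R \<le> CARD('n)" by (simp add: card_mono)
  have "\<bar>pert_row TYPE('n) * d\<bar> \<le> int CARD('n)"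
    unfolding eq using le by auto
  then have "\<bar>pert_row TYPE('n) * d\<bar> < pert_row TYPE('n) * 1"
    by (simp add: pert_row_def)
  then have "pert_row TYPE('n) * \<bar>d\<bar> < pert_row TYPE('n) * 1"
    by (simp add: abs_mult pert_row_def)
  then have "\<bar>d\<bar> < 1"
    by (rule mult_left_less_imp_less) (simp add: pert_row_def)
  then have d: "d = 0" by simp
  show False
  proof (cases "Max UNIV \<in> R")
    case True
    then have "card R = CARD('n)" using eq d by simp
    moreover have "int (card L) = int CARD('m)"
      using d \<open>card R = CARD('n)\<close> assms(1) by (simp add: d_def)
    ultimately have "R = UNIV" "L = UNIV"
      by (simp_all add: card_eq_UNIV_imp_eq_UNIV)
    then show False using assms(3) by simp
  next
    case False
    then have "card R = 0" using eq d by simp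
    moreover have "card L = 0" using d \<open>card R = 0\<close> by (simp add: d_def)
    ultimately show False using assms(2) by simp
  qed
qed

lemma pert_flow_ex:
  fixes T :: "('m::finite \<times> 'n::{finite,linorder}) set"
  assumes "bip_connected T" "CARD('m) = k * CARD('n)"
  shows "\<exists>Y. is_pert_flow k T Y"
proof -
  have "pert_excess k (UNIV :: 'm set) (UNIV :: 'n set) = 0"
    using assms(2) by (simp add: pert_excess_def)
  then have "(\<Sum>i\<in>(UNIV :: 'm set). pert_row TYPE('n)) = (\<Sum>j\<in>UNIV. pert_col k (j :: 'n))"
    using sum_pert_margins[where k = k and L = "UNIV :: 'm set" and R = "UNIV :: 'n set"] by simp
  from connected_flow[OF assms(1) this] show ?thesis
    by (auto simp: is_pert_flow_def)
qed

text \<open>The sum cancels at each lattice point separately. If some entry on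
  \<open>L \<times> - R\<close> is nonnegative, its sign condition makes no difference and that edge
  can be toggled. Otherwise the cut formula forces a negative entry on
  \<open>- L \<times> R\<close>, where no sign condition is ever dropped.\<close>

lemma relaxed_points_alternating:
  fixes L :: "'m::finite set" and R :: "'n::{finite,linorder} set"
  assumes k: "0 < k" and m: "CARD('m) = k * CARD('n)"
    and G: "\<And>i j. (i, j) \<in> G \<Longrightarrow> i \<in> L \<longleftrightarrow> j \<in> R" and pos: "0 < pert_excess k L R"
  shows "(\<Sum>K\<in>Pow (L \<times> - R). (- 1) ^ card K * lattice_series (relaxed_points k s (G \<union> K)) X) = 0"
proof -
  define x where "x = matrix_of X"
  have crossing: "(i, j) \<notin> G \<union> K" if "i \<notin> L" "j \<in> R" "K \<subseteq> L \<times> - R" for i j K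
    using G that by auto
  consider (no_margins) "\<not> ((\<forall>i. (\<Sum>j\<in>UNIV. x $ i $ j) = int s) \<and> (\<forall>j. (\<Sum>i\<in>UNIV. x $ i $ j) = int (k * s)))"
    | (toggle) i j where "i \<in> L" "j \<notin> R" "0 \<le> x $ i $ j"
    | (neg) i j where "i \<notin> L" "j \<in> R" "x $ i $ j < 0"
  proof (rule ccontr)
    assume *: "\<not> thesis"
    have margins: "\<And>i. (\<Sum>j\<in>UNIV. x $ i $ j) = int s" "\<And>j. (\<Sum>i\<in>UNIV. x $ i $ j) = int (k * s)"
      using * no_margins by blast+
    have entry_neg: "x $ i $ j \<le> - 1" if "i \<in> L" "j \<in> - R" for i j
      using * toggle[of i j] that by force
    have nonneg: "0 \<le> x $ i $ j" if "i \<in> - L" "j \<in> R" for i j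
      using * that neg[of i j] by force
    have le: "k * card R \<le> card L" by (rule pert_excess_pos[OF pos])
    \<comment> \<open>Trivial cuts have excess 0, so the block \<open>L \<times> - R\<close> is
      nonempty. Its entries are at most -1 by integrality, which contradicts the cut formula even if
      the unperturbed excess is 0.\<close>
    have "L \<noteq> {}"
    proof
      assume "L = {}"
      with le k have "R = {}" by simp
      with \<open>L = {}\<close> pos show False by (simp add: pert_excess_def)
    qed
    have "- R \<noteq> {}"
    proof
      assume "- R = {}"
      then have R: "R = UNIV" by auto
      then have "card L = CARD('m)"
        using le m card_mono[of UNIV L] by simp
      then have "pert_excess k L R = 0"
        using R m by (simp add: pert_excess_def)
      then show False using pos by simp
    qed
    have "(\<Sum>i\<in>L. \<Sum>j\<in>- R. x $ i $ j) \<le> (\<Sum>i\<in>L. \<Sum>j\<in>- R. - 1)"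
      by (intro sum_mono entry_neg)
    also have "\<dots> = - (int (card L) * int (card (- R)))" by simp
    also have "\<dots> < 0"
      using \<open>L \<noteq> {}\<close> \<open>- R \<noteq> {}\<close> by (simp add: card_gt_0_iff)
    finally have "(\<Sum>i\<in>L. \<Sum>j\<in>- R. x $ i $ j) < 0" .
    moreover have "0 \<le> (\<Sum>i\<in>- L. \<Sum>j\<in>R. x $ i $ j)"
      by (intro sum_nonneg nonneg)
    moreover have "(\<Sum>i\<in>L. \<Sum>j\<in>- R. x $ i $ j) - (\<Sum>i\<in>- L. \<Sum>j\<in>R. x $ i $ j) =
        int s * (int (card L) - int k * int (card R))"
      unfolding cut_formula margins by (simp add: algebra_simps)
    moreover have "int (k * card R) \<le> int (card L)" using le by (simp only: of_nat_le_iff)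
    ultimately show False
      by (smt (verit) mult_nonneg_nonneg of_nat_0_le_iff of_nat_mult)
  qed
  then show ?thesis
  proof cases
    case no_margins
    then have "lattice_series (relaxed_points k s (G \<union> K)) X = 0" for K
      by (auto simp: lattice_series_def relaxed_points_def x_def)
    then show ?thesis by simp
  next
    case (toggle i j)
    show ?thesis
    proof (rule alternating_sum_toggle[of _ "(i, j)"])
      show "lattice_series (relaxed_points k s (G \<union> insert (i, j) K)) X =
          lattice_series (relaxed_points k s (G \<union> K)) X" for K
        using toggle(3) by (auto simp: lattice_series_def relaxed_points_def x_def)
    qed (use toggle in auto)
  next
    case (neg i j)
    then have "lattice_series (relaxed_points k s (G \<union> K)) X = 0" if "K \<in> Pow (L \<times> - R)" for K
      using crossing[of i j K] that by (force simp: lattice_series_def relaxed_points_def x_def)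
    then show ?thesis by simp
  qed
qed

lemma pert_flow_unique:
  assumes "spanning_tree T" "is_pert_flow k T Y" "is_pert_flow k T Y'"
  shows "Y = Y'"
proof -
  have "Y i j - Y' i j = 0" for i j
    by (rule acyclic_flow_zero[where E = T and X = "\<lambda>i j. Y i j - Y' i j"])
      (use assms in \<open>auto simp: spanning_tree_altdef is_pert_flow_def sum_subtractf\<close>)
  then show ?thesis by (simp add: fun_eq_iff)
qed

lemma feasible_iff:
  assumes "spanning_tree T" "is_pert_flow k T Y"
  shows "feasible k T G \<longleftrightarrow> G \<subseteq> T \<and> (\<forall>(i, j)\<in>T - G. 0 < Y i j)"
  using assms pert_flow_unique unfolding feasible_def by metis

text \<open>The same alternative with the perturbed flow on \<open>T\<close> in place of a lattice
  point: positive net flow leaves an edge of positive flow to toggle, or a tree edge in the opposite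
  direction with nonpositive flow, which lies in no \<open>G \<union> K\<close>.\<close>

lemma feasible_alternating:
  fixes L :: "'m::finite set" and R :: "'n::{finite,linorder} set"
  assumes m: "CARD('m) = k * CARD('n)" and T: "spanning_tree T"
    and G: "\<And>i j. (i, j) \<in> G \<Longrightarrow> i \<in> L \<longleftrightarrow> j \<in> R" and pos: "0 < pert_excess k L R"
  shows "(\<Sum>K\<in>Pow (L \<times> - R). (- 1) ^ card K * (of_bool (feasible k T (G \<union> K)) :: 'a::comm_ring_1)) = 0"
proof -
  obtain Y where Y: "is_pert_flow k T Y"
    using pert_flow_ex[of T k] m T by (auto simp: spanning_tree_altdef)
  note feas = feasible_iff[OF T Y]
  consider (toggle) i j where "i \<in> L" "j \<notin> R" "(i, j) \<in> T" "0 < Y i j"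
    | (neg) i j where "i \<notin> L" "j \<in> R" "(i, j) \<in> T" "Y i j \<le> 0"
  proof (rule ccontr)
    assume *: "\<not> thesis"
    have supp: "Y i j = 0" if "(i, j) \<notin> T" for i j
      using Y that by (auto simp: is_pert_flow_def)
    have "Y i j \<le> 0" if "i \<in> L" "j \<in> - R" for i j
      using * toggle[of i j] supp[of i j] that by force
    then have "(\<Sum>i\<in>L. \<Sum>j\<in>- R. Y i j) \<le> 0"
      by (intro sum_nonpos)
    moreover have "0 \<le> Y i j" if "i \<in> - L" "j \<in> R" for i j
      using * neg[of i j] supp[of i j] that by force
    then have "0 \<le> (\<Sum>i\<in>- L. \<Sum>j\<in>R. Y i j)"
      by (intro sum_nonneg)
    moreover have "(\<Sum>i\<in>L. \<Sum>j\<in>- R. Y i j) - (\<Sum>i\<in>- L. \<Sum>j\<in>R. Y i j) = pert_excess k L R"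
      unfolding cut_formula using Y by (simp add: is_pert_flow_def flip: sum_pert_margins)
    ultimately show False using pos by simp
  qed
  then show ?thesis
  proof cases
    case (toggle i j)
    show ?thesis
    proof (rule alternating_sum_toggle[of _ "(i, j)"])
      show "(of_bool (feasible k T (G \<union> insert (i, j) K)) :: 'a) = of_bool (feasible k T (G \<union> K))" for K
        unfolding feas using toggle by auto
    qed (use toggle in auto)
  next
    case (neg i j)
    have "\<not> feasible k T (G \<union> K)" if "K \<in> Pow (L \<times> - R)" for K
      unfolding feas using neg that G[of i j] by force
    then show ?thesis by simp
  qed
qed

text \<open>An additional edge would make its \<open>cyc\<close> a nonzero circulation on
  \<open>T'\<close>.\<close>

lemma spanning_tree_subset_eq:
  fixes T :: "('m::finite \<times> 'n::finite) set"
  assumes T: "spanning_tree T" and T': "spanning_tree T'" and sub: "T \<subseteq> T'"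
  shows "T = T'"
proof (rule ccontr)
  assume "T \<noteq> T'"
  then obtain i0 j0 where e: "(i0, j0) \<in> T'" "(i0, j0) \<notin> T" using sub by auto
  note cyc = cyc_props[OF T e(2)]
  have "cyc T (i0, j0) $ i0 $ j0 = 0"
  proof (rule acyclic_flow_zero[where E = T' and X = "\<lambda>i j. cyc T (i0, j0) $ i $ j"])
    show "acyclic_edges T'" using T' by (simp add: spanning_tree_altdef)
    show "cyc T (i0, j0) $ i $ j = 0" if "(i, j) \<notin> T'" for i j
      using that e sub by (subst cyc(3)) auto
  qed (use cyc in auto)
  then show False using cyc(3)[OF e(2)] by simp
qed

text \<open>A circulation along a cycle in \<open>G\<close> meets no sign condition, so it is a
  period.\<close>

lemma has_fract_cyclic:
  fixes G :: "('m::{finite,linorder} \<times> 'n::{finite,linorder}) set"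
  assumes "\<not> acyclic_edges G"
  shows "has_fract (lattice_series (relaxed_points k s G)) 0"
proof -
  obtain "is" js where c: "bip_cycle G is js"
    using assms by (auto simp: acyclic_edges_def)
  define u where "u = cycle_matrix is js"
  have "u \<noteq> 0"
    using cycle_matrix_hd[OF c] by (auto simp: u_def)
  have "matrix_of X - u \<in> relaxed_points k s G \<longleftrightarrow> matrix_of X \<in> relaxed_points k s G" for X
    using cycle_matrix_outside[OF c] sum_cycle_matrix[OF c]
    by (simp add: relaxed_points_def u_def sum_subtractf)
  then have "act (1 - Poly_Mapping.single (exponent u) 1) (lattice_series (relaxed_points k s G)) = (\<lambda>X. 0)"
    by (simp add: fun_eq_iff act_one_minus_monom lattice_series_def)
  then have "has_fract (act (1 - Poly_Mapping.single (exponent u) 1) (lattice_series (relaxed_points k s G))) 0"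
    by simp
  from has_fract_divide[OF this one_minus_monom_nonzero[OF \<open>u \<noteq> 0\<close>]] show ?thesis
    by simp
qed

text \<open>This is Brion's theorem for the perturbed polyhedron. If \<open>G\<close> is disconnected, the edges across a
  cut give two alternating sums over the supersets of \<open>G\<close>, one of the lattice points and one of the
  feasible trees, which reduce the claim for \<open>G\<close> to the claim for larger sets.\<close>

theorem has_fract_relaxed_points:
  fixes G :: "('m::{finite,linorder} \<times> 'n::{finite,linorder}) set"
  assumes k: "0 < k" and m: "CARD('m) = k * CARD('n)"
    and \<phi>: "\<And>T :: ('m \<times> 'n) set. spanning_tree T \<Longrightarrow> has_fract (lattice_series (relaxed_points k s T)) (\<phi> T)"
  shows "has_fract (lattice_series (relaxed_points k s G))
    (\<Sum>T\<in>{T. spanning_tree T}. of_bool (feasible k T G) * \<phi> T)"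
proof (induction "card (- G)" arbitrary: G rule: less_induct)
  case less
  show ?case
  proof (cases "acyclic_edges G")
    case False
    have "\<not> feasible k T G" if "spanning_tree T" for T
      using False that acyclic_edges_subset by (auto simp: feasible_def spanning_tree_altdef)
    then have "(\<Sum>T\<in>{T. spanning_tree T}. of_bool (feasible k T G) * \<phi> T) = 0"
      by simp
    then show ?thesis
      using has_fract_cyclic[OF False] by simp
  next
    case ac: True
    show ?thesis
    proof (cases "bip_connected G")
      case True
      with ac have G: "spanning_tree G" by (simp add: spanning_tree_altdef)
      have "feasible k T G \<longleftrightarrow> T = G" if "spanning_tree T" for T
        using spanning_tree_subset_eq[OF G that] by (auto simp: feasible_def)
      then have "(\<Sum>T\<in>{T. spanning_tree T}. of_bool (feasible k T G) * \<phi> T) =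
          (\<Sum>T\<in>{T. spanning_tree T}. if T = G then \<phi> T else 0)"
        by (intro sum.cong) auto
      then show ?thesis
        using \<phi>[OF G] G by simp
    next
      case False
      have "\<exists>L R. (\<forall>i j. (i, j) \<in> G \<longrightarrow> (i \<in> L \<longleftrightarrow> j \<in> R)) \<and> 0 < pert_excess k L R"
      proof -
        obtain L R where LR: "\<And>i j. (i, j) \<in> G \<Longrightarrow> i \<in> L \<longleftrightarrow> j \<in> R"
          "L \<noteq> {} \<or> R \<noteq> {}" "L \<noteq> UNIV \<or> R \<noteq> UNIV"
          using disconnected_cut[OF False] by metis
        consider "0 < pert_excess k L R" | "0 < pert_excess k (- L) (- R)"
          using pert_excess_nonzero[OF m LR(2,3)] pert_excess_Compl[OF m, of L R] by linarith
        then show ?thesis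
        proof cases
          case 1
          then show ?thesis using LR(1) by blast
        next
          case 2
          then show ?thesis using LR(1) by (intro exI[of _ "- L"] exI[of _ "- R"]) auto
        qed
      qed
      then obtain L R where LR: "\<And>i j. (i, j) \<in> G \<Longrightarrow> i \<in> L \<longleftrightarrow> j \<in> R"
        and pos: "0 < pert_excess k L R" by blast
      \<comment> \<open>No edge of \<open>G\<close> crosses the cut, so every such \<open>K\<close>
        is disjoint from \<open>G\<close> and enlarges it strictly.\<close>
      define \<K> where "\<K> = Pow (L \<times> - R) - {{}}"
      define \<Sigma> where "\<Sigma> G = (\<Sum>T\<in>{T. spanning_tree T}. of_bool (feasible k T G) * \<phi> T)" for G
      have IH: "has_fract (lattice_series (relaxed_points k s (G \<union> K))) (\<Sigma> (G \<union> K))" if "K \<in> \<K>" for K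
      proof -
        have "K \<noteq> {}" "K \<inter> G = {}" using that LR by (auto simp: \<K>_def)
        then have "- (G \<union> K) \<subset> - G" by blast
        then have "card (- (G \<union> K)) < card (- G)" by (intro psubset_card_mono) auto
        then show ?thesis unfolding \<Sigma>_def by (rule less)
      qed
      have split: "(\<Sum>K\<in>Pow (L \<times> - R). (- 1) ^ card K * f (G \<union> K)) =
          f G + (\<Sum>K\<in>\<K>. (- 1) ^ card K * f (G \<union> K))" for f :: "('m \<times> 'n) set \<Rightarrow> 'c::comm_ring_1"
        unfolding \<K>_def by (subst sum.remove[of _ "{}"]) auto
      have "lattice_series (relaxed_points k s G) =
          (\<lambda>X. (- 1) ^ 1 * (\<Sum>K\<in>\<K>. (- 1) ^ card K * lattice_series (relaxed_points k s (G \<union> K)) X))"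
        (is "_ = ?rhs")
      proof
        fix X
        show "lattice_series (relaxed_points k s G) X = ?rhs X"
        using relaxed_points_alternating[OF k m LR pos, where s = s and X = X]
          split[of "\<lambda>G. lattice_series (relaxed_points k s G) X"]
        by (simp add: eq_neg_iff_add_eq_0)
      qed
      moreover have "\<Sigma> G = (- 1) ^ 1 * (\<Sum>K\<in>\<K>. (- 1) ^ card K * \<Sigma> (G \<union> K))"
      proof -
        have "(\<Sum>K\<in>Pow (L \<times> - R). (- 1) ^ card K * \<Sigma> (G \<union> K)) =
            (\<Sum>T\<in>{T. spanning_tree T}. (\<Sum>K\<in>Pow (L \<times> - R). (- 1) ^ card K * of_bool (feasible k T (G \<union> K))) * \<phi> T)"
          unfolding \<Sigma>_def sum_distrib_left sum_distrib_right
          by (subst sum.swap) (simp add: mult.assoc)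
        also have "\<dots> = 0"
          by (rule sum.neutral) (use feasible_alternating[OF m _ LR pos] in auto)
        finally show ?thesis
          using split[of \<Sigma>] by (simp add: eq_neg_iff_add_eq_0)
      qed
      moreover have "has_fract (\<lambda>X. (- 1) ^ 1 * (\<Sum>K\<in>\<K>. (- 1) ^ card K * lattice_series (relaxed_points k s (G \<union> K)) X))
          ((- 1) ^ 1 * (\<Sum>K\<in>\<K>. (- 1) ^ card K * \<Sigma> (G \<union> K)))"
        by (intro has_fract_sign has_fract_sum IH)
      ultimately have "has_fract (lattice_series (relaxed_points k s G)) (\<Sigma> G)"
        by (simp only:)
      then show ?thesis by (simp only: \<Sigma>_def)
    qed
  qed
qed

section \<open>The simplicial cones of spanning trees\<close>

lemma one_minus_zpow: "1 - zpow X = Fract (1 - Poly_Mapping.single (exponent X) 1) 1"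
  by (simp add: zpow_def One_fract_def)

text \<open>Telescoping over faces: \<open>cyc T e\<close> changes no off-tree entry except the one
  at \<open>e\<close>, so the factor \<open>1 - zpow (cyc T e)\<close> passes to the subface where
  that entry is 0. When all off-tree entries vanish, only the apex remains.\<close>

lemma has_fract_unimodular:
  fixes T :: "('m::{finite,linorder} \<times> 'n::{finite,linorder}) set"
  assumes T: "spanning_tree T"
  shows "has_fract (lattice_series (relaxed_points k 0 T)) (\<Prod>e\<in>- T. 1 / (1 - zpow (cyc T e)))"
proof -
  define W where "W S = {X \<in> relaxed_points k 0 T. \<forall>(i, j)\<in>S. X $ i $ j = 0}" for S
  have "has_fract (lattice_series (W (- T - A))) (\<Prod>e\<in>A. 1 / (1 - zpow (cyc T e)))"
    if "finite A" "A \<subseteq> - T" for A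
    using that
  proof (induction A rule: finite_induct)
    case empty
    have "W (- T) = {0}"
    proof (rule equalityI)
      show "W (- T) \<subseteq> {0}"
      proof
        fix X assume X: "X \<in> W (- T)"
        have "X $ i $ j = 0" for i j
          by (rule acyclic_flow_zero[where E = T and X = "\<lambda>i j. X $ i $ j"])
            (use X T in \<open>auto simp: W_def relaxed_points_def spanning_tree_altdef\<close>)
        then show "X \<in> {0}" by (simp add: vec_eq_iff)
      qed
    qed (auto simp: W_def relaxed_points_def)
    then have "lattice_series (W (- T)) = Poly_Mapping.lookup 1"
      using lattice_series_finite[of "{0}"] by (simp add: exponent_zero single_one)
    then show ?case
      using has_fract_lookup[of 1] by (simp add: One_fract_def)
  next
    case (insert e A)
    obtain i0 j0 where e: "e = (i0, j0)" "(i0, j0) \<notin> T"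
      using insert.prems by (cases e) auto
    note cyc = cyc_props[OF T e(2)]
    define u where "u = cyc T e"
    have u0: "u $ i0 $ j0 = 1" using cyc(3)[OF e(2)] by (simp add: u_def e)
    then have "u \<noteq> 0" by auto
    define V where "V = - T - insert e A"
    have "act (1 - Poly_Mapping.single (exponent u) 1) (lattice_series (W V)) =
        lattice_series (W (- T - A))"
    proof
      fix X :: "'m \<Rightarrow>\<^sub>0 'n \<Rightarrow>\<^sub>0 int"
      define x where "x = matrix_of X"
      \<comment> \<open>All conditions except the one on the entry at \<open>e\<close>. The three
        sets then differ only in requiring this entry to be \<open>\<ge> 0\<close>,
        \<open>\<ge> 1\<close> or \<open>= 0\<close>.\<close>
      define B where "B \<longleftrightarrow> (\<forall>i. (\<Sum>j\<in>UNIV. x $ i $ j) = 0) \<and> (\<forall>j. (\<Sum>i\<in>UNIV. x $ i $ j) = 0) \<and>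
          (\<forall>i j. (i, j) \<notin> T \<longrightarrow> (i, j) \<noteq> e \<longrightarrow> 0 \<le> x $ i $ j) \<and> (\<forall>(i, j)\<in>V. x $ i $ j = 0)"
      have eV: "e \<in> - T" "e \<notin> V" "V \<subseteq> - T" "- T - A = insert e V"
        using e insert.hyps by (auto simp: V_def)
      have "x \<in> W V \<longleftrightarrow> B \<and> 0 \<le> x $ i0 $ j0"
        using eV by (auto simp: W_def B_def relaxed_points_def e)
      moreover have "x - u \<in> W V \<longleftrightarrow> B \<and> 1 \<le> x $ i0 $ j0"
      proof -
        have u_off: "u $ i $ j = 0" if "(i, j) \<notin> T" "(i, j) \<noteq> e" for i j
          using cyc(3)[OF that(1)] that(2) by (simp add: u_def e)
        have "(\<forall>i j. (i, j) \<notin> T \<longrightarrow> 0 \<le> (x - u) $ i $ j) \<longleftrightarrow>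
            (\<forall>i j. (i, j) \<notin> T \<longrightarrow> (i, j) \<noteq> e \<longrightarrow> 0 \<le> x $ i $ j) \<and> 1 \<le> x $ i0 $ j0"
        proof safe
          fix i j assume *: "\<forall>i j. (i, j) \<notin> T \<longrightarrow> 0 \<le> (x - u) $ i $ j" "(i, j) \<notin> T" "(i, j) \<noteq> e"
          then show "0 \<le> x $ i $ j" using u_off[of i j] by fastforce
        next
          assume "\<forall>i j. (i, j) \<notin> T \<longrightarrow> 0 \<le> (x - u) $ i $ j"
          then show "1 \<le> x $ i0 $ j0" using e(2) u0 by fastforce
        next
          fix i j
          assume *: "\<forall>i j. (i, j) \<notin> T \<longrightarrow> (i, j) \<noteq> e \<longrightarrow> 0 \<le> x $ i $ j" "1 \<le> x $ i0 $ j0" "(i, j) \<notin> T"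
          show "0 \<le> (x - u) $ i $ j"
            using * u_off[of i j] u0 e(1) by (cases "(i, j) = e") auto
        qed
        moreover have "(x - u) $ i $ j = x $ i $ j" if "(i, j) \<in> V" for i j
          using u_off[of i j] that eV by auto
        ultimately show ?thesis
          by (auto simp: W_def B_def relaxed_points_def sum_subtractf u_def e(1) cyc(1,2))
      qed
      moreover have "x \<in> W (- T - A) \<longleftrightarrow> B \<and> x $ i0 $ j0 = 0"
      proof
        assume "B \<and> x $ i0 $ j0 = 0"
        moreover from this have "0 \<le> x $ i $ j" if "(i, j) \<notin> T" for i j
          using that by (cases "(i, j) = e") (auto simp: B_def e)
        ultimately show "x \<in> W (- T - A)"
          using eV by (auto simp: W_def B_def relaxed_points_def e)
      qed (use eV in \<open>auto simp: W_def B_def relaxed_points_def e\<close>)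
      ultimately show "act (1 - Poly_Mapping.single (exponent u) 1) (lattice_series (W V)) X =
          lattice_series (W (- T - A)) X"
        by (auto simp: act_one_minus_monom lattice_series_def x_def)
    qed
    then have "has_fract (act (1 - Poly_Mapping.single (exponent u) 1) (lattice_series (W V)))
        (\<Prod>e\<in>A. 1 / (1 - zpow (cyc T e)))"
      using insert by simp
    from has_fract_divide[OF this one_minus_monom_nonzero[OF \<open>u \<noteq> 0\<close>]] show ?case
      using insert.hyps by (simp add: V_def u_def flip: one_minus_zpow)
  qed
  from this[of "- T"] show ?thesis
    by (simp add: W_def)
qed

text \<open>\<open>Z\<close> is the apex of the cone for margin \<open>s\<close>, which is therefore
  a lattice translate of the cone for margin 0.\<close>

lemma has_fract_translate:
  assumes T: "has_fract (lattice_series (relaxed_points k 0 T)) f"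
    and Z: "\<And>i j. (i, j) \<notin> T \<Longrightarrow> Z $ i $ j = 0" "\<And>i. (\<Sum>j\<in>UNIV. Z $ i $ j) = int s"
      "\<And>j. (\<Sum>i\<in>UNIV. Z $ i $ j) = int (k * s)"
  shows "has_fract (lattice_series (relaxed_points k s T)) (zpow Z * f)"
proof -
  have "matrix_of X - Z \<in> relaxed_points k 0 T \<longleftrightarrow> matrix_of X \<in> relaxed_points k s T" for X
    using Z by (simp add: relaxed_points_def sum_subtractf)
  then have "act (Poly_Mapping.single (exponent Z) 1) (lattice_series (relaxed_points k 0 T)) =
      lattice_series (relaxed_points k s T)"
    by (simp add: fun_eq_iff act_single lattice_series_def)
  with has_fract_act[OF T, of "Poly_Mapping.single (exponent Z) 1"] show ?thesis
    by (simp add: zpow_def)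
qed

text \<open>Only one entry survives in the cut formula. On a tree this expresses the flow on an edge
  by the margins on one side of it.\<close>

lemma single_crossing_edge:
  fixes X :: "'m::finite \<Rightarrow> 'n::finite \<Rightarrow> 'a::ab_group_add"
  assumes "i0 \<in> L" "j0 \<notin> R"
    and "\<And>i j. (i, j) \<noteq> (i0, j0) \<Longrightarrow> X i j \<noteq> 0 \<Longrightarrow> i \<in> L \<longleftrightarrow> j \<in> R"
  shows "X i0 j0 = (\<Sum>i\<in>L. \<Sum>j\<in>UNIV. X i j) - (\<Sum>j\<in>R. \<Sum>i\<in>UNIV. X i j)"
proof -
  have "(\<Sum>i\<in>L. \<Sum>j\<in>- R. X i j) = (\<Sum>(i, j)\<in>L \<times> - R. X i j)"
    by (simp add: sum.cartesian_product)
  also have "\<dots> = (\<Sum>(i, j)\<in>{(i0, j0)}. X i j)"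
    by (rule sum.mono_neutral_right) (use assms in auto)
  finally have "(\<Sum>i\<in>L. \<Sum>j\<in>- R. X i j) = X i0 j0" by simp
  moreover have "X i j = 0" if "i \<in> - L" "j \<in> R" for i j
    using assms(3)[of i j] that assms(1) by auto
  then have "(\<Sum>i\<in>- L. \<Sum>j\<in>R. X i j) = 0"
    by (intro sum.neutral ballI) simp
  ultimately show ?thesis
    using cut_formula[of X R L] by simp
qed

lemma acyclic_edges_extend:
  fixes G :: "('m::finite \<times> 'n::finite) set"
  assumes "acyclic_edges G"
  obtains T where "spanning_tree T" "G \<subseteq> T"
proof -
  obtain T where T: "acyclic_edges T" "G \<subseteq> T"
    and max: "\<And>T'. acyclic_edges T' \<Longrightarrow> T \<subseteq> T' \<Longrightarrow> T = T'"
    using finite_has_maximal2[of "{T. acyclic_edges T}" G] assms by auto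
  have "bip_connected T"
  proof (rule ccontr)
    assume nc: "\<not> bip_connected T"
    obtain L R where LR: "\<And>i j. (i, j) \<in> T \<Longrightarrow> i \<in> L \<longleftrightarrow> j \<in> R"
      "L \<noteq> {} \<or> R \<noteq> {}" "L \<noteq> UNIV \<or> R \<noteq> UNIV"
      using disconnected_cut[OF nc] by metis
    have "\<exists>L R i0 j0. (\<forall>i j. (i, j) \<in> T \<longrightarrow> (i \<in> L \<longleftrightarrow> j \<in> R)) \<and> i0 \<in> L \<and> j0 \<notin> R"
    proof (cases "L \<noteq> {} \<and> R \<noteq> UNIV")
      case True
      then obtain i0 j0 where "i0 \<in> L" "j0 \<notin> R" by auto
      then show ?thesis using LR(1) by blast
    next
      case False
      then have "- L \<noteq> {}" "- R \<noteq> UNIV" using LR(2,3) by auto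
      then obtain i0 j0 where "i0 \<in> - L" "j0 \<notin> - R" by blast
      then show ?thesis using LR(1) by (intro exI[of _ "- L"] exI[of _ "- R"] exI[of _ i0] exI[of _ j0]) auto
    qed
    then obtain L R i0 j0 where cut: "\<And>i j. (i, j) \<in> T \<Longrightarrow> i \<in> L \<longleftrightarrow> j \<in> R"
      and e: "i0 \<in> L" "j0 \<notin> R" by blast
    have "(i0, j0) \<notin> T" using cut e by blast
    then have "\<not> acyclic_edges (insert (i0, j0) T)"
      using max[of "insert (i0, j0) T"] by blast
    then obtain "is" js where c: "bip_cycle (insert (i0, j0) T) is js"
      by (auto simp: acyclic_edges_def)
    \<comment> \<open>Every circulation on the enlarged set vanishes on its only edge across the
      cut, so the cycle avoids this edge and already lies in \<open>T\<close>.\<close>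
    have zero: "cycle_matrix is js $ i0 $ j0 = 0"
    proof -
      have "cycle_matrix is js $ i0 $ j0 = (\<Sum>i\<in>L. \<Sum>j\<in>UNIV. cycle_matrix is js $ i $ j) -
          (\<Sum>j\<in>R. \<Sum>i\<in>UNIV. cycle_matrix is js $ i $ j)"
        by (rule single_crossing_edge[OF e, where X = "\<lambda>i j. cycle_matrix is js $ i $ j"])
          (use cycle_matrix_outside[OF c] cut in blast)
      then show ?thesis by (simp add: sum_cycle_matrix[OF c])
    qed
    have "(is ! t, js ! t) \<noteq> (i0, j0) \<and> (is ! (Suc t mod length is), js ! t) \<noteq> (i0, j0)"
      if "t < length is" for t
    proof -
      have "cycle_matrix is js $ (is ! t) $ (js ! t) \<noteq> 0"
        "cycle_matrix is js $ (is ! (Suc t mod length is)) $ (js ! t) \<noteq> 0"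
        using that by (auto simp: cycle_matrix_def)
      then show ?thesis using zero by auto
    qed
    then have "bip_cycle T is js"
      using c unfolding bip_cycle_def by (metis insert_iff)
    then show False using T(1) by (auto simp: acyclic_edges_def)
  qed
  then show thesis using that T by (simp add: spanning_tree_altdef)
qed

subsection \<open>Feasible trees and degree sequences\<close>

text \<open>The unperturbed margins for \<open>s = 1\<close>. The apex of the cone of a tree is
  \<open>s\<close> times its unit flow, which makes it integral.\<close>

definition is_unit_flow ::
    "nat \<Rightarrow> ('m::finite \<times> 'n::finite) set \<Rightarrow> int ^ 'n ^ 'm \<Rightarrow> bool" where
  "is_unit_flow k T Z \<longleftrightarrow> (\<forall>i j. (i, j) \<notin> T \<longrightarrow> Z $ i $ j = 0) \<and>
     (\<forall>i. (\<Sum>j\<in>UNIV. Z $ i $ j) = 1) \<and> (\<forall>j. (\<Sum>i\<in>UNIV. Z $ i $ j) = int k)"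

lemma unit_flow_ex:
  fixes T :: "('m::finite \<times> 'n::finite) set"
  assumes "bip_connected T" "CARD('m) = k * CARD('n)"
  shows "\<exists>Z. is_unit_flow k T Z"
proof -
  have "(\<Sum>i\<in>(UNIV :: 'm set). 1) = (\<Sum>j\<in>(UNIV :: 'n set). int k)"
    using assms(2) by simp
  from connected_flow[OF assms(1) this] obtain X :: "'m \<Rightarrow> 'n \<Rightarrow> int" where X:
    "\<forall>i j. (i, j) \<notin> T \<longrightarrow> X i j = 0" "\<forall>i. (\<Sum>j\<in>UNIV. X i j) = 1" "\<forall>j. (\<Sum>i\<in>UNIV. X i j) = int k"
    by blast
  then show ?thesis
    by (intro exI[of _ "\<chi> i j. X i j"]) (simp add: is_unit_flow_def)
qed

text \<open>One cut evaluates both flows, so that their signs can be compared.\<close>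

lemma tree_edge_flow:
  fixes T :: "('m::finite \<times> 'n::{finite,linorder}) set"
  assumes T: "spanning_tree T" and e: "(i0, j0) \<in> T"
    and Z: "is_unit_flow k T Z" and Y: "is_pert_flow k T Y"
  shows "\<exists>L R. i0 \<in> L \<and> j0 \<notin> R \<and>
    (\<forall>i j. (i, j) \<in> T \<longrightarrow> (i, j) \<noteq> (i0, j0) \<longrightarrow> (i \<in> L \<longleftrightarrow> j \<in> R)) \<and>
    Z $ i0 $ j0 = int (card L) - int k * int (card R) \<and> Y i0 j0 = pert_excess k L R"
proof -
  obtain L R where LR: "i0 \<in> L" "j0 \<notin> R"
    "\<And>i j. (i, j) \<in> T \<Longrightarrow> (i, j) \<noteq> (i0, j0) \<Longrightarrow> i \<in> L \<longleftrightarrow> j \<in> R"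
    using spanning_tree_cut[OF T e] by metis
  have "Z $ i0 $ j0 = (\<Sum>i\<in>L. \<Sum>j\<in>UNIV. Z $ i $ j) - (\<Sum>j\<in>R. \<Sum>i\<in>UNIV. Z $ i $ j)"
    by (rule single_crossing_edge[OF LR(1,2), where X = "\<lambda>i j. Z $ i $ j"])
      (use LR(3) Z in \<open>auto simp: is_unit_flow_def\<close>)
  then have "Z $ i0 $ j0 = int (card L) - int k * int (card R)"
    using Z by (simp add: is_unit_flow_def)
  moreover have "Y i0 j0 = (\<Sum>i\<in>L. \<Sum>j\<in>UNIV. Y i j) - (\<Sum>j\<in>R. \<Sum>i\<in>UNIV. Y i j)"
    by (rule single_crossing_edge[OF LR(1,2)]) (use LR(3) Y in \<open>auto simp: is_pert_flow_def\<close>)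
  then have "Y i0 j0 = pert_excess k L R"
    using Y by (simp add: is_pert_flow_def flip: sum_pert_margins)
  ultimately show ?thesis using LR by blast
qed

text \<open>\<open>R\<close> omits \<open>j0\<close>, so \<open>card R < n\<close>. If the last
  vertex lies in \<open>R\<close>, its bonus n outweighs \<open>card R\<close>; otherwise one full n
  + 1 does.\<close>

lemma pert_excess_pos_intro:
  fixes L :: "'m::finite set" and R :: "'n::{finite,linorder} set"
  assumes "j0 \<notin> R" and "1 - of_bool (Max UNIV \<in> R) \<le> int (card L) - int k * int (card R)"
  shows "0 < pert_excess k L R"
proof -
  define d where "d = int (card L) - int k * int (card R)"
  have "card R < CARD('n)"
    using assms(1) by (intro psubset_card_mono) auto
  moreover define P where "P = pert_row TYPE('n) * d"
  moreover have "pert_row TYPE('n) * (1 - of_bool (Max UNIV \<in> R)) \<le> P"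
    using assms(2) unfolding P_def d_def by (intro mult_left_mono) (auto simp: pert_row_def)
  ultimately show ?thesis
    unfolding pert_excess_def d_def[symmetric] P_def[symmetric]
    by (cases "Max UNIV \<in> R") (simp_all add: pert_row_def)
qed

text \<open>The perturbation is too small to overturn a nonzero unit flow; it breaks the ties at
  edges with value 0.\<close>

lemma pert_flow_pos_unit_flow:
  fixes T :: "('m::finite \<times> 'n::{finite,linorder}) set"
  assumes "spanning_tree T" "(i, j) \<in> T" "is_unit_flow k T Z" "is_pert_flow k T Y"
  shows "0 < Y i j \<Longrightarrow> 0 \<le> Z $ i $ j" "0 < Z $ i $ j \<Longrightarrow> 0 < Y i j"
proof -
  obtain L :: "'m set" and R where LR: "j \<notin> R"
    "Z $ i $ j = int (card L) - int k * int (card R)" "Y i j = pert_excess k L R"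
    using tree_edge_flow[OF assms] by blast
  show "0 \<le> Z $ i $ j" if "0 < Y i j"
  proof -
    have "k * card R \<le> card L" using pert_excess_pos that LR(3) by simp
    then have "int (k * card R) \<le> int (card L)" by (simp only: of_nat_le_iff)
    then show ?thesis using LR(2) by simp
  qed
  show "0 < Y i j" if "0 < Z $ i $ j"
    unfolding LR(3) by (rule pert_excess_pos_intro[OF LR(1)]) (use that LR(2) in auto)
qed

text \<open>For the cut of a tree edge, the tree edges at \<open>R\<close> form a forest inside
  \<open>L \<times> R\<close>, hence number at most \<open>card L + card R - 1\<close>. Comparison
  with the prescribed degrees gives exactly the bound in
  \<open>pert_excess_pos_intro\<close>.\<close>

lemma ST_imp_feasible:
  fixes T :: "('m::finite \<times> 'n::{finite,linorder}) set"
  assumes T: "T \<in> ST k" and m: "CARD('m) = k * CARD('n)"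
  shows "feasible k T {}"
proof -
  have tree: "spanning_tree T" and deg: "\<And>j. right_degree T j = (if j = Max UNIV then k else k + 1)"
    using T by (auto simp: ST_def)
  obtain Y Z where Y: "is_pert_flow k T Y" and Z: "is_unit_flow k T Z"
    using pert_flow_ex[of T k] unit_flow_ex[of T k] m tree by (auto simp: spanning_tree_altdef)
  have "0 < Y i0 j0" if e: "(i0, j0) \<in> T" for i0 j0
  proof -
    obtain L R where LR: "i0 \<in> L" "j0 \<notin> R"
      "\<And>i j. (i, j) \<in> T \<Longrightarrow> (i, j) \<noteq> (i0, j0) \<Longrightarrow> i \<in> L \<longleftrightarrow> j \<in> R"
      "Y i0 j0 = pert_excess k L R"
      using tree_edge_flow[OF tree e Z Y] by blast
    define E where "E = {e \<in> T. snd e \<in> R}"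
    have "E \<subseteq> L \<times> R"
    proof
      fix e assume "e \<in> E"
      then obtain i j where ij: "e = (i, j)" "(i, j) \<in> T" "j \<in> R"
        by (cases e) (auto simp: E_def)
      then show "e \<in> L \<times> R" using LR(3)[of i j] LR(2) by auto
    qed
    moreover have "acyclic_edges E"
      using tree by (auto simp: spanning_tree_altdef E_def intro: acyclic_edges_subset)
    ultimately have "card E + 1 \<le> card L + card R"
      using acyclic_edges_card LR(1) by blast
    moreover have "card E = (\<Sum>j\<in>R. right_degree T j)"
    proof -
      have "E = (\<Union>j\<in>R. {e \<in> T. snd e = j})" by (auto simp: E_def)
      then show ?thesis
        unfolding right_degree_def by (simp add: card_UN_disjoint disjoint_iff)
    qed
    moreover have "int (\<Sum>j\<in>R. right_degree T j) =
        (\<Sum>j\<in>R. (int k + 1) - (if j = Max UNIV then 1 else 0))"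
      unfolding deg of_nat_sum by (rule sum.cong) auto
    then have "int (\<Sum>j\<in>R. right_degree T j) = int (card R) * (int k + 1) - of_bool (Max UNIV \<in> R)"
      by (simp add: sum_subtractf)
    ultimately have "int (card R) * (int k + 1) - of_bool (Max UNIV \<in> R) + 1 \<le> int (card L) + int (card R)"
      by linarith
    then show ?thesis
      unfolding LR(4) by (intro pert_excess_pos_intro[OF LR(2)]) (simp add: algebra_simps)
  qed
  then show ?thesis
    unfolding feasible_iff[OF tree Y] by auto
qed

text \<open>Row sums bound the unit flow by 1 and the perturbed flow by \<open>pert_row\<close>. A
  column therefore has at least k edges, and at least k + 1 unless it is the last one. These bounds
  add up to m + n - 1, the most that a forest allows, so all of them are equalities.\<close>

lemma feasible_imp_ST:
  fixes T :: "('m::finite \<times> 'n::{finite,linorder}) set"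
  assumes tree: "spanning_tree T" and feas: "feasible k T {}" and m: "CARD('m) = k * CARD('n)"
  shows "T \<in> ST k"
proof -
  obtain Y Z where Y: "is_pert_flow k T Y" and Z: "is_unit_flow k T Z"
    using pert_flow_ex[of T k] unit_flow_ex[of T k] m tree by (auto simp: spanning_tree_altdef)
  have Y_supp: "Y i j = 0" and Z_supp: "Z $ i $ j = 0" if "(i, j) \<notin> T" for i j
    using that Y Z by (auto simp: is_pert_flow_def is_unit_flow_def)
  have Y_pos: "0 < Y i j" if "(i, j) \<in> T" for i j
    using feas that unfolding feasible_iff[OF tree Y] by auto
  have Y_nonneg: "0 \<le> Y i j" for i j
    using Y_pos[of i j] Y_supp[of i j] by (cases "(i, j) \<in> T") auto
  have Z_nonneg: "0 \<le> Z $ i $ j" for i j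
    using pert_flow_pos_unit_flow(1)[OF tree _ Z Y, of i j] Y_pos[of i j] Z_supp[of i j]
    by (cases "(i, j) \<in> T") auto
  have Z_le: "Z $ i $ j \<le> 1" and Y_le: "Y i j \<le> pert_row TYPE('n)" for i j
  proof -
    have "Z $ i $ j \<le> (\<Sum>j\<in>UNIV. Z $ i $ j)" "Y i j \<le> (\<Sum>j\<in>UNIV. Y i j)"
      using Z_nonneg Y_nonneg by (auto intro: member_le_sum)
    then show "Z $ i $ j \<le> 1" "Y i j \<le> pert_row TYPE('n)"
      using Y Z by (simp_all add: is_pert_flow_def is_unit_flow_def)
  qed
  define A where "A j = {i. (i, j) \<in> T}" for j
  have deg: "right_degree T j = card (A j)" for j
  proof -
    have "{e \<in> T. snd e = j} = (\<lambda>i. (i, j)) ` A j" by (auto simp: A_def)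
    then show ?thesis
      unfolding right_degree_def by (simp add: card_image inj_on_def)
  qed
  have ge: "int k \<le> int (card (A j))" for j
  proof -
    have "int k = (\<Sum>i\<in>UNIV. Z $ i $ j)"
      using Z by (simp add: is_unit_flow_def)
    also have "\<dots> = (\<Sum>i\<in>A j. Z $ i $ j)"
      by (rule sum.mono_neutral_right) (use Z_supp in \<open>auto simp: A_def\<close>)
    also have "\<dots> \<le> (\<Sum>i\<in>A j. 1)" by (intro sum_mono Z_le)
    finally show ?thesis by simp
  qed
  have ge': "int k + 1 \<le> int (card (A j))" if "j \<noteq> Max UNIV" for j
  proof (rule ccontr)
    assume "\<not> ?thesis"
    then have card: "int (card (A j)) = int k" using ge[of j] by simp
    have "pert_col k j = (\<Sum>i\<in>UNIV. Y i j)"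
      using Y by (simp add: is_pert_flow_def)
    also have "\<dots> = (\<Sum>i\<in>A j. Y i j)"
      by (rule sum.mono_neutral_right) (use Y_supp in \<open>auto simp: A_def\<close>)
    also have "\<dots> \<le> (\<Sum>i\<in>A j. pert_row TYPE('n))" by (intro sum_mono Y_le)
    also have "\<dots> = int k * pert_row TYPE('n)" using card by simp
    finally show False using that by (simp add: pert_col_def)
  qed
  define low where "low j = (if j = Max UNIV then k else k + 1)" for j :: 'n
  have low: "low j \<le> card (A j)" for j
    using ge[of j] ge'[of j] by (auto simp: low_def)
  have "card T + 1 \<le> CARD('m) + CARD('n)"
    by (rule acyclic_edges_card) (use tree in \<open>auto simp: spanning_tree_altdef\<close>)
  moreover have "card T = (\<Sum>j\<in>UNIV. card (A j))"
  proof -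
    have "T = (\<Union>j\<in>UNIV. {e \<in> T. snd e = j})" by auto
    then have "card T = (\<Sum>j\<in>UNIV. right_degree T j)"
      unfolding right_degree_def by (subst card_UN_disjoint[symmetric]) auto
    then show ?thesis by (simp add: deg)
  qed
  moreover have "(\<Sum>j\<in>UNIV. low j) + 1 = CARD('m) + CARD('n)"
  proof -
    have "int (\<Sum>j\<in>UNIV. low j) = (\<Sum>j\<in>(UNIV :: 'n set). (int k + 1) - (if j = Max UNIV then 1 else 0))"
      unfolding low_def of_nat_sum by (rule sum.cong) auto
    also have "\<dots> = int CARD('n) * (int k + 1) - 1" by (simp add: sum_subtractf)
    finally have "int (\<Sum>j\<in>UNIV. low j) + 1 = int CARD('m) + int CARD('n)"
      using m by (simp add: algebra_simps)
    then show ?thesis by linarith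
  qed
  ultimately have sum_le: "(\<Sum>j\<in>UNIV. card (A j)) \<le> (\<Sum>j\<in>UNIV. low j)" by simp
  have "card (A j) = low j" for j
  proof (rule ccontr)
    assume "card (A j) \<noteq> low j"
    then have "low j < card (A j)" using low[of j] by simp
    then have "(\<Sum>j\<in>UNIV. low j) < (\<Sum>j\<in>UNIV. card (A j))"
      using low by (intro sum_strict_mono_ex1) auto
    then show False using sum_le by simp
  qed
  then show ?thesis
    using tree by (simp add: ST_def deg low_def)
qed

subsection \<open>Convergence on tree cones\<close>

text \<open>The off-tree entries are natural-number coordinates on the cone, with
  \<open>cyc T e\<close> as basis. In them the series is dominated by a product of geometric
  series.\<close>

lemma summable_tree_cone:
  fixes T :: "('m::finite \<times> 'n::finite) set"
  assumes T: "spanning_tree T" and v: "\<And>e. e \<notin> T \<Longrightarrow> 0 < pairing v (cyc T e)"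
    and t: "0 < t" "t < (1 :: real)"
  shows "(\<lambda>\<alpha>. t powi pairing v \<alpha>) summable_on relaxed_points k 0 T"
proof -
  define h where "h \<alpha> = (\<lambda>e\<in>- T. nat (\<alpha> $ fst e $ snd e))" for \<alpha> :: "int ^ 'n ^ 'm"
  have expand: "\<alpha> $ i $ j = (\<Sum>e\<in>- T. \<alpha> $ fst e $ snd e * cyc T e $ i $ j)"
    if \<alpha>: "\<alpha> \<in> relaxed_points k 0 T" for \<alpha> i j
  proof -
    define D where "D i j = \<alpha> $ i $ j - (\<Sum>e\<in>- T. \<alpha> $ fst e $ snd e * cyc T e $ i $ j)" for i j
    have "D i j = 0"
    proof (rule acyclic_flow_zero[where E = T and X = D])
      show "acyclic_edges T" using T by (simp add: spanning_tree_altdef)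
      show "D i j = 0" if "(i, j) \<notin> T" for i j
      proof -
        have "(\<Sum>e\<in>- T. \<alpha> $ fst e $ snd e * cyc T e $ i $ j) =
            (\<Sum>e\<in>- T. if e = (i, j) then \<alpha> $ i $ j else 0)"
          by (rule sum.cong) (use cyc_outside[OF T _ that] in auto)
        then show ?thesis using that by (simp add: D_def)
      qed
      have row: "(\<Sum>j\<in>UNIV. cyc T e $ i $ j) = 0" if "e \<in> - T" for e i
        using cyc_row_sum[OF T, of "fst e" "snd e" i] that by simp
      have col: "(\<Sum>i\<in>UNIV. cyc T e $ i $ j) = 0" if "e \<in> - T" for e j
        using cyc_col_sum[OF T, of "fst e" "snd e" j] that by simp
      show "(\<Sum>j\<in>UNIV. D i j) = 0" for i
        unfolding D_def sum_subtractf
        by (subst sum.swap) (use \<alpha> row in \<open>simp add: relaxed_points_def flip: sum_distrib_left\<close>)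
      show "(\<Sum>i\<in>UNIV. D i j) = 0" for j
        unfolding D_def sum_subtractf
        by (subst sum.swap) (use \<alpha> col in \<open>simp add: relaxed_points_def flip: sum_distrib_left\<close>)
    qed
    then show ?thesis by (simp add: D_def)
  qed
  have inj: "inj_on h (relaxed_points k 0 T)"
  proof (rule inj_onI)
    fix \<alpha> \<beta>
    assume *: "\<alpha> \<in> relaxed_points k 0 T" "\<beta> \<in> relaxed_points k 0 T" "h \<alpha> = h \<beta>"
    have eq: "\<alpha> $ fst e $ snd e = \<beta> $ fst e $ snd e" if "e \<in> - T" for e
    proof -
      have "nat (\<alpha> $ fst e $ snd e) = nat (\<beta> $ fst e $ snd e)"
        using fun_cong[OF *(3), of e] that by (simp add: h_def)
      moreover have "0 \<le> \<alpha> $ fst e $ snd e" "0 \<le> \<beta> $ fst e $ snd e"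
        using *(1,2) that by (auto simp: relaxed_points_def)
      ultimately show ?thesis by (simp add: nat_eq_iff)
    qed
    have "\<alpha> $ i $ j = \<beta> $ i $ j" for i j
    proof -
      have "\<alpha> $ i $ j = (\<Sum>e\<in>- T. \<alpha> $ fst e $ snd e * cyc T e $ i $ j)"
        by (rule expand[OF *(1)])
      also have "\<dots> = (\<Sum>e\<in>- T. \<beta> $ fst e $ snd e * cyc T e $ i $ j)"
        by (rule sum.cong) (simp_all only: eq)
      also have "\<dots> = \<beta> $ i $ j"
        by (rule expand[OF *(2), symmetric])
      finally show ?thesis .
    qed
    then show "\<alpha> = \<beta>" by (simp add: vec_eq_iff)
  qed
  define g where "g p = (\<Prod>e\<in>- T. t ^ p e)" for p :: "'m \<times> 'n \<Rightarrow> nat"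
  have sums: "((\<lambda>n. t ^ n) has_sum (1 / (1 - t))) (UNIV :: nat set)"
    using geometric_sums[of t] t by (intro norm_summable_imp_has_sum) (auto simp: norm_power)
  have "infsum g (PiE (- T) (\<lambda>_. UNIV)) = (\<Prod>e\<in>- T. infsum (\<lambda>n. t ^ n) UNIV)"
    unfolding g_def
  proof (rule infsum_prod_PiE_abs)
    show "(\<lambda>n::nat. norm (t ^ n)) summable_on UNIV"
      using sums t by (simp add: norm_power has_sum_imp_summable)
  qed simp
  \<comment> \<open>\<open>infsum\<close> is 0 for a family that is not summable, so a nonzero value
    proves summability.\<close>
  also have "\<dots> \<noteq> 0"
    using infsumI[OF sums] t by simp
  finally have "g summable_on PiE (- T) (\<lambda>_. UNIV)"
    using infsum_not_exists by blast
  then have "g summable_on h ` relaxed_points k 0 T"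
    by (rule summable_on_subset_banach) (auto simp: h_def)
  then have "(g \<circ> h) summable_on relaxed_points k 0 T"
    using summable_on_reindex[OF inj] by blast
  then show ?thesis
  proof (rule summable_on_comparison_test)
    fix \<alpha> assume \<alpha>: "\<alpha> \<in> relaxed_points k 0 T"
    have nonneg: "0 \<le> \<alpha> $ fst e $ snd e" if "e \<in> - T" for e
      using \<alpha> that by (auto simp: relaxed_points_def)
    have "v $ i $ j * \<alpha> $ i $ j = (\<Sum>e\<in>- T. \<alpha> $ fst e $ snd e * (v $ i $ j * cyc T e $ i $ j))" for i j
      by (subst expand[OF \<alpha>, of i j]) (simp add: sum_distrib_left mult.left_commute)
    then have "pairing v \<alpha> = (\<Sum>i\<in>UNIV. \<Sum>j\<in>UNIV. \<Sum>e\<in>- T. \<alpha> $ fst e $ snd e * (v $ i $ j * cyc T e $ i $ j))"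
      by (simp only: pairing_def)
    also have "\<dots> = (\<Sum>e\<in>- T. \<Sum>i\<in>UNIV. \<Sum>j\<in>UNIV. \<alpha> $ fst e $ snd e * (v $ i $ j * cyc T e $ i $ j))"
      by (simp add: sum.swap[of _ "- T"])
    also have "\<dots> = (\<Sum>e\<in>- T. \<alpha> $ fst e $ snd e * pairing v (cyc T e))"
      by (simp add: pairing_def sum_distrib_left)
    finally have pairing_eq: "pairing v \<alpha> = (\<Sum>e\<in>- T. \<alpha> $ fst e $ snd e * pairing v (cyc T e))" .
    \<comment> \<open>Each generator has a positive integral pairing, hence at least 1, so the
      exponent is at least the sum of the coordinates.\<close>
    have "(\<Sum>e\<in>- T. \<alpha> $ fst e $ snd e * 1) \<le> pairing v \<alpha>"
      unfolding pairing_eq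
    proof (intro sum_mono mult_left_mono nonneg)
      show "1 \<le> pairing v (cyc T e)" if "e \<in> - T" for e
        using v[of e] that by simp
    qed
    moreover have "(\<Sum>e\<in>- T. \<alpha> $ fst e $ snd e) = int (\<Sum>e\<in>- T. h \<alpha> e)"
      using nonneg by (simp add: h_def)
    ultimately have "int (\<Sum>e\<in>- T. h \<alpha> e) \<le> pairing v \<alpha>" by simp
    then have "t powi pairing v \<alpha> \<le> t powi int (\<Sum>e\<in>- T. h \<alpha> e)"
      using t by (intro power_int_decreasing) auto
    then show "t powi pairing v \<alpha> \<le> (g \<circ> h) \<alpha>"
      by (simp only: g_def o_apply power_int_of_nat power_sum)
    show "0 \<le> t powi pairing v \<alpha>" using t by simp
  qed
qed

section \<open>Transportation polytopes\<close>

definition flow_polyhedron ::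
    "nat \<Rightarrow> nat \<Rightarrow> ('m::finite \<times> 'n::finite) set \<Rightarrow> (real ^ 'n ^ 'm) set" where
  "flow_polyhedron k s G = {X. (\<forall>i. (\<Sum>j\<in>UNIV. X $ i $ j) = real s) \<and>
     (\<forall>j. (\<Sum>i\<in>UNIV. X $ i $ j) = real (k * s)) \<and> (\<forall>i j. (i, j) \<notin> G \<longrightarrow> 0 \<le> X $ i $ j)}"

lemma lattice_part_flow_polyhedron: "lattice_part (flow_polyhedron k s G) = relaxed_points k s G"
proof -
  have "real_of_int x = real n \<longleftrightarrow> x = int n" for x n
    by (metis of_int_eq_iff of_int_of_nat_eq)
  then show ?thesis
    by (simp add: flow_polyhedron_def relaxed_points_def flip: of_int_sum del: of_nat_mult)
qed

lemma rational_flow_polyhedron: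
  fixes G :: "('m::finite \<times> 'n::finite) set"
  shows "rational_polyhedron (flow_polyhedron k s G)"
proof -
  define row :: "'m \<Rightarrow> real ^ 'n ^ 'm" where "row i = (\<chi> i' j. of_bool (i' = i))" for i
  define col :: "'n \<Rightarrow> real ^ 'n ^ 'm" where "col j = (\<chi> i j'. of_bool (j' = j))" for j
  define unit :: "'m \<times> 'n \<Rightarrow> real ^ 'n ^ 'm" where "unit e = (\<chi> i j. of_bool ((i, j) = e))" for e
  have row: "row i \<bullet> X = (\<Sum>j\<in>UNIV. X $ i $ j)" for i X
  proof -
    have "row i \<bullet> X = (\<Sum>i'\<in>UNIV. if i' = i then \<Sum>j\<in>UNIV. X $ i $ j else 0)"
      unfolding inner_vec_def by (rule sum.cong) (auto simp: row_def)
    then show ?thesis by simp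
  qed
  have col: "col j \<bullet> X = (\<Sum>i\<in>UNIV. X $ i $ j)" for j X
  proof -
    have "col j \<bullet> X = (\<Sum>i\<in>UNIV. \<Sum>j'\<in>UNIV. if j' = j then X $ i $ j else 0)"
      unfolding inner_vec_def by (intro sum.cong) (auto simp: col_def)
    then show ?thesis by simp
  qed
  have unit: "unit (i, j) \<bullet> X = X $ i $ j" for i j X
  proof -
    have "unit (i, j) \<bullet> X = (\<Sum>i'\<in>UNIV. \<Sum>j'\<in>UNIV. if j' = j then of_bool (i' = i) * X $ i $ j else 0)"
      unfolding inner_vec_def by (intro sum.cong) (auto simp: unit_def)
    also have "\<dots> = (\<Sum>i'\<in>UNIV. if i' = i then X $ i $ j else 0)"
      by (rule sum.cong) auto
    finally show ?thesis by simp
  qed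
  define hs where "hs = (\<lambda>(a :: real ^ 'n ^ 'm, b :: real). {x. a \<bullet> x \<le> b})"
  define D where "D = range (\<lambda>i. (row i, real s)) \<union> range (\<lambda>i. (- row i, - real s)) \<union>
    range (\<lambda>j. (col j, real (k * s))) \<union> range (\<lambda>j. (- col j, - real (k * s))) \<union> (\<lambda>e. (- unit e, 0)) ` (- G)"
  have nz: "row i \<noteq> 0" "col j \<noteq> 0" "unit e \<noteq> 0" for i j e
    by (cases e; auto simp: row_def col_def unit_def vec_eq_iff)+
  have rat: "row i $ i' $ j' \<in> \<rat>" "col j $ i' $ j' \<in> \<rat>" "unit e $ i' $ j' \<in> \<rat>" for i j e i' j'
    by (auto simp: row_def col_def unit_def)
  have poly: "flow_polyhedron k s G = \<Inter> (hs ` D)"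
  proof (rule set_eqI)
    fix X :: "real ^ 'n ^ 'm"
    have "X \<in> \<Inter> (hs ` D) \<longleftrightarrow> (\<forall>(a, b)\<in>D. a \<bullet> X \<le> b)"
      by (auto simp: hs_def)
    also have "\<dots> \<longleftrightarrow> (\<forall>i. row i \<bullet> X \<le> real s) \<and> (\<forall>i. (- row i) \<bullet> X \<le> - real s) \<and>
        (\<forall>j. col j \<bullet> X \<le> real (k * s)) \<and> (\<forall>j. (- col j) \<bullet> X \<le> - real (k * s)) \<and>
        (\<forall>e\<in>- G. (- unit e) \<bullet> X \<le> 0)"
      unfolding D_def ball_Un by (simp only: ball_simps split conj_assoc UNIV_I simp_thms)
    also have "(\<forall>e\<in>- G. (- unit e) \<bullet> X \<le> 0) \<longleftrightarrow> (\<forall>i j. (i, j) \<notin> G \<longrightarrow> 0 \<le> X $ i $ j)"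
      by (simp add: Ball_def split_paired_All unit)
    finally have "X \<in> \<Inter> (hs ` D) \<longleftrightarrow> X \<in> flow_polyhedron k s G"
      by (auto simp: flow_polyhedron_def row col order_antisym_conv simp del: of_nat_mult)
    then show "X \<in> flow_polyhedron k s G \<longleftrightarrow> X \<in> \<Inter> (hs ` D)" by simp
  qed
  have fin: "finite (hs ` D)" by (simp add: D_def)
  have halfspace: "\<exists>a b. a \<noteq> 0 \<and> (\<forall>i j. a $ i $ j \<in> \<rat>) \<and> b \<in> \<rat> \<and> h = {x. a \<bullet> x \<le> b}" if "h \<in> hs ` D" for h
  proof -
    obtain a b where ab: "(a, b) \<in> D" "h = {x. a \<bullet> x \<le> b}"
      using \<open>h \<in> hs ` D\<close> by (auto simp: hs_def)
    moreover have "a \<noteq> 0" "\<forall>i j. a $ i $ j \<in> \<rat>" "b \<in> \<rat>"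
      using ab(1) nz rat by (auto simp: D_def simp del: of_nat_mult)
    ultimately show ?thesis by blast
  qed
  show ?thesis
    unfolding rational_polyhedron_def
    by (intro exI[of _ "hs ` D"] conjI ballI poly fin halfspace)
qed

lemma no_line_flow_polyhedron:
  fixes G :: "('m::finite \<times> 'n::finite) set"
  assumes "acyclic_edges G"
  shows "\<not> contains_line (flow_polyhedron k s G)"
proof
  assume "contains_line (flow_polyhedron k s G)"
  then obtain x v where v: "v \<noteq> 0" "\<And>t. x + t *\<^sub>R v \<in> flow_polyhedron k s G"
    unfolding contains_line_def by blast
  have x: "x \<in> flow_polyhedron k s G" using v(2)[of 0] by simp
  have "v $ i $ j = 0" for i j
  proof (rule acyclic_flow_zero[OF assms, where X = "\<lambda>i j. v $ i $ j"])
    show "v $ i $ j = 0" if "(i, j) \<notin> G" for i j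
    proof (rule ccontr)
      assume nz: "v $ i $ j \<noteq> 0"
      have "0 \<le> x $ i $ j + t * v $ i $ j" for t
        using v(2)[of t] that by (simp add: flow_polyhedron_def)
      from this[of "- (x $ i $ j + 1) / v $ i $ j"] show False
        using nz by simp
    qed
    show "(\<Sum>j\<in>UNIV. v $ i $ j) = 0" for i
      using v(2)[of 1] x by (simp add: flow_polyhedron_def sum.distrib)
    show "(\<Sum>i\<in>UNIV. v $ i $ j) = 0" for j
      using v(2)[of 1] x by (simp add: flow_polyhedron_def sum.distrib)
  qed
  with v(1) show False by (simp add: vec_eq_iff)
qed

text \<open>Positive entries stay positive for small steps, so only the sign conditions off
  \<open>aux M\<close> survive, and the margins become 0.\<close>

lemma fcone_flow_polyhedron:
  fixes M :: "real ^ 'n::finite ^ 'm::finite"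
  assumes M: "M \<in> flow_polyhedron k s {}"
  shows "fcone (flow_polyhedron k s {}) M = flow_polyhedron k 0 (aux M)"
proof (rule set_eqI)
  fix u
  have rows: "(\<Sum>j\<in>UNIV. M $ i $ j) = real s" and cols: "(\<Sum>i\<in>UNIV. M $ i $ j) = real (k * s)"
    and nonneg: "0 \<le> M $ i $ j" for i j
    using M by (auto simp: flow_polyhedron_def)
  have M0: "M $ i $ j = 0" if "(i, j) \<notin> aux M" for i j
    using nonneg[of i j] that by (auto simp: aux_def)
  show "u \<in> fcone (flow_polyhedron k s {}) M \<longleftrightarrow> u \<in> flow_polyhedron k 0 (aux M)"
  proof
    assume "u \<in> fcone (flow_polyhedron k s {}) M"
    then have "\<forall>\<^sub>F \<delta> in at_right (0::real). M + \<delta> *\<^sub>R u \<in> flow_polyhedron k s {}"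
      by (simp add: fcone_def)
    moreover have "\<forall>\<^sub>F \<delta> in at_right (0::real). 0 < \<delta>"
      by (simp add: eventually_at_right_less)
    ultimately have ev: "\<forall>\<^sub>F \<delta> in at_right (0::real). M + \<delta> *\<^sub>R u \<in> flow_polyhedron k s {} \<and> 0 < \<delta>"
      by (rule eventually_conj)
    obtain \<delta> where \<delta>: "M + \<delta> *\<^sub>R u \<in> flow_polyhedron k s {}" "(0::real) < \<delta>"
      using eventually_happens[OF ev] trivial_limit_at_right_real by blast
    have "\<delta> * (\<Sum>j\<in>UNIV. u $ i $ j) = 0" for i
      using \<delta>(1) rows by (simp add: flow_polyhedron_def sum.distrib sum_distrib_left)
    moreover have "\<delta> * (\<Sum>i\<in>UNIV. u $ i $ j) = 0" for j
      using \<delta>(1) cols by (simp add: flow_polyhedron_def sum.distrib sum_distrib_left)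
    moreover have "0 \<le> u $ i $ j" if "(i, j) \<notin> aux M" for i j
    proof -
      have "0 \<le> M $ i $ j + \<delta> * u $ i $ j"
        using \<delta>(1) by (simp add: flow_polyhedron_def)
      then show ?thesis using M0[OF that] \<delta>(2) by (simp add: zero_le_mult_iff)
    qed
    ultimately show "u \<in> flow_polyhedron k 0 (aux M)"
      using \<delta>(2) by (simp add: flow_polyhedron_def)
  next
    assume u: "u \<in> flow_polyhedron k 0 (aux M)"
    have "\<forall>\<^sub>F \<delta> in at_right (0::real). 0 \<le> M $ i $ j + \<delta> * u $ i $ j" for i j
    proof (cases "(i, j) \<in> aux M")
      case True
      have "((\<lambda>\<delta>. M $ i $ j + \<delta> * u $ i $ j) \<longlongrightarrow> M $ i $ j + 0 * u $ i $ j) (at_right 0)"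
        by (intro tendsto_intros)
      moreover have "0 < M $ i $ j + 0 * u $ i $ j" using True by (simp add: aux_def)
      ultimately have "\<forall>\<^sub>F \<delta> in at_right (0::real). 0 < M $ i $ j + \<delta> * u $ i $ j"
        by (rule order_tendstoD(1))
      then show ?thesis by (rule eventually_mono) simp
    next
      case False
      have "\<forall>\<^sub>F \<delta> in at_right (0::real). 0 < \<delta>"
        by (simp add: eventually_at_right_less)
      then show ?thesis
        by (rule eventually_mono) (use u False M0[OF False] in \<open>simp add: flow_polyhedron_def\<close>)
    qed
    then have "\<forall>\<^sub>F \<delta> in at_right (0::real). \<forall>i j. 0 \<le> M $ i $ j + \<delta> * u $ i $ j"
      by (intro eventually_all_finite)
    then have "\<forall>\<^sub>F \<delta> in at_right (0::real). M + \<delta> *\<^sub>R u \<in> flow_polyhedron k s {}"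
      by (rule eventually_mono)
        (use u rows cols in \<open>simp add: flow_polyhedron_def sum.distrib flip: sum_distrib_left\<close>)
    then show "u \<in> fcone (flow_polyhedron k s {}) M" by (simp add: fcone_def)
  qed
qed

lemma finite_relaxed_points_empty:
  "finite (relaxed_points k s ({} :: ('m::finite \<times> 'n::finite) set))"
proof -
  define h where "h X = (\<lambda>(i, j)\<in>UNIV. X $ i $ j)" for X :: "int ^ 'n::finite ^ 'm::finite"
  have "h ` relaxed_points k s {} \<subseteq> PiE UNIV (\<lambda>_. {0..int s})"
  proof
    fix y assume "y \<in> h ` relaxed_points k s {}"
    then obtain X where X: "X \<in> relaxed_points k s {}" "y = h X" by blast
    have "X $ i $ j \<le> int s" for i j
    proof -
      have "X $ i $ j \<le> (\<Sum>j\<in>UNIV. X $ i $ j)"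
        by (rule member_le_sum) (use X(1) in \<open>auto simp: relaxed_points_def\<close>)
      then show ?thesis using X(1) by (simp add: relaxed_points_def)
    qed
    then show "y \<in> PiE UNIV (\<lambda>_. {0..int s})"
      using X by (auto simp: h_def relaxed_points_def)
  qed
  then have "finite (h ` relaxed_points k s {})"
    by (rule finite_subset) (simp add: finite_PiE)
  moreover have "inj_on h (relaxed_points k s {})"
  proof (rule inj_onI)
    fix X Y assume "h X = h Y"
    then have "h X (i, j) = h Y (i, j)" for i j by simp
    then show "X = Y" by (simp add: h_def vec_eq_iff)
  qed
  ultimately show ?thesis by (rule finite_imageD)
qed

text \<open>Along a cycle in its support \<open>M\<close> could be moved in both directions, which
  makes it a midpoint.\<close>

lemma extreme_point_acyclic:
  fixes M :: "real ^ 'n::finite ^ 'm::finite"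
  assumes M: "M extreme_point_of flow_polyhedron k s {}"
  shows "acyclic_edges (aux M)"
proof (rule ccontr)
  assume "\<not> acyclic_edges (aux M)"
  then obtain "is" js where c: "bip_cycle (aux M) is js"
    by (auto simp: acyclic_edges_def)
  define C where "C = real_mat (cycle_matrix is js)"
  have C_sums: "(\<Sum>j\<in>UNIV. C $ i $ j) = 0" "(\<Sum>i\<in>UNIV. C $ i $ j) = 0" for i j
    using sum_cycle_matrix[OF c] by (simp_all add: C_def flip: of_int_sum)
  have C_le: "\<bar>C $ i $ j\<bar> \<le> 1" for i j
    by (simp add: C_def cycle_matrix_def)
  have C_out: "C $ i $ j = 0" if "(i, j) \<notin> aux M" for i j
    using cycle_matrix_outside[OF c that] by (simp add: C_def)
  have C_hd: "C $ hd is $ hd js = 1"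
    using cycle_matrix_hd[OF c] by (simp add: C_def)
  have MP: "M \<in> flow_polyhedron k s {}"
    using M by (simp add: extreme_point_of_def)
  have "(hd is, hd js) \<in> aux M"
    using C_out[of "hd is" "hd js"] C_hd by fastforce
  then have ne: "aux M \<noteq> {}" by blast
  \<comment> \<open>The entries of \<open>C\<close> are at most 1 in absolute value, so a step by
    the smallest positive entry of \<open>M\<close> creates no negative entry.\<close>
  define \<epsilon> where "\<epsilon> = Min ((\<lambda>(i, j). M $ i $ j) ` aux M)"
  have "\<epsilon> \<in> (\<lambda>(i, j). M $ i $ j) ` aux M"
    unfolding \<epsilon>_def by (rule Min_in) (use ne in auto)
  then have \<epsilon>_pos: "0 < \<epsilon>" by (auto simp: aux_def)
  have \<epsilon>_le: "\<epsilon> \<le> M $ i $ j" if "(i, j) \<in> aux M" for i j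
    unfolding \<epsilon>_def by (rule Min_le) (use that in force)+
  have mem: "M + t *\<^sub>R C \<in> flow_polyhedron k s {}" if t: "\<bar>t\<bar> = \<epsilon>" for t
  proof -
    have "0 \<le> M $ i $ j + t * C $ i $ j" for i j
    proof (cases "(i, j) \<in> aux M")
      case True
      have "\<bar>t * C $ i $ j\<bar> \<le> \<epsilon> * 1"
        unfolding abs_mult t using C_le \<epsilon>_pos by (intro mult_left_mono) auto
      then show ?thesis using \<epsilon>_le[OF True] by linarith
    next
      case False
      then show ?thesis using MP C_out[OF False] by (simp add: flow_polyhedron_def)
    qed
    then show ?thesis
      using MP C_sums by (simp add: flow_polyhedron_def sum.distrib flip: sum_distrib_left)
  qed
  have "M \<in> open_segment (M + (- \<epsilon>) *\<^sub>R C) (M + \<epsilon> *\<^sub>R C)"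
  proof -
    have "M = (1 - 1 / 2) *\<^sub>R (M + (- \<epsilon>) *\<^sub>R C) + (1 / 2) *\<^sub>R (M + \<epsilon> *\<^sub>R C)"
      by (simp add: algebra_simps flip: scaleR_add_left)
    moreover have "M + (- \<epsilon>) *\<^sub>R C \<noteq> M + \<epsilon> *\<^sub>R C"
    proof
      assume "M + (- \<epsilon>) *\<^sub>R C = M + \<epsilon> *\<^sub>R C"
      from arg_cong[OF this, of "\<lambda>X. X $ hd is $ hd js"] show False
        using \<epsilon>_pos C_hd by simp
    qed
    ultimately show ?thesis
      unfolding in_segment by (intro conjI exI[of _ "1 / 2"]) auto
  qed
  then show False
    using M mem[of "- \<epsilon>"] mem[of \<epsilon>] \<epsilon>_pos unfolding extreme_point_of_def by auto
qed

lemma flow_unique: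
  fixes M M' :: "real ^ 'n::finite ^ 'm::finite"
  assumes T: "acyclic_edges T" and M: "M \<in> flow_polyhedron k s G" and M': "M' \<in> flow_polyhedron k s G'"
    and supp: "\<And>i j. (i, j) \<notin> T \<Longrightarrow> M $ i $ j = 0" "\<And>i j. (i, j) \<notin> T \<Longrightarrow> M' $ i $ j = 0"
  shows "M = M'"
proof -
  have "M $ i $ j - M' $ i $ j = 0" for i j
    by (rule acyclic_flow_zero[OF T, where X = "\<lambda>i j. M $ i $ j - M' $ i $ j"])
      (use M M' supp in \<open>auto simp: flow_polyhedron_def sum_subtractf\<close>)
  then show ?thesis by (simp add: vec_eq_iff)
qed

lemma flow_polyhedron_aux_outside:
  assumes "M \<in> flow_polyhedron k s {}" "aux M \<subseteq> T" "(i, j) \<notin> T"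
  shows "M $ i $ j = 0"
proof -
  have "0 \<le> M $ i $ j" using assms(1) by (simp add: flow_polyhedron_def)
  moreover have "\<not> 0 < M $ i $ j" using assms(2,3) by (auto simp: aux_def)
  ultimately show ?thesis by simp
qed

text \<open>The ends of a segment through \<open>M\<close> vanish wherever \<open>M\<close> does, so
  they are flows on \<open>T\<close> with equal margins and coincide.\<close>

lemma acyclic_extreme_point:
  fixes M :: "real ^ 'n::finite ^ 'm::finite"
  assumes T: "acyclic_edges T" and M: "M \<in> flow_polyhedron k s {}" "aux M \<subseteq> T"
  shows "M extreme_point_of flow_polyhedron k s {}"
  unfolding extreme_point_of_def
proof (intro conjI ballI notI M(1))
  fix A B assume AB: "A \<in> flow_polyhedron k s {}" "B \<in> flow_polyhedron k s {}"
    and "M \<in> open_segment A B"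
  then obtain u where u: "A \<noteq> B" "0 < u" "u < 1" "M = (1 - u) *\<^sub>R A + u *\<^sub>R B"
    by (auto simp: in_segment)
  have zero: "A $ i $ j = 0 \<and> B $ i $ j = 0" if "(i, j) \<notin> T" for i j
  proof -
    have "0 \<le> A $ i $ j" "0 \<le> B $ i $ j"
      using AB by (auto simp: flow_polyhedron_def)
    moreover have "(1 - u) * A $ i $ j + u * B $ i $ j = 0"
      using flow_polyhedron_aux_outside[OF M that] u(4) by simp
    ultimately show ?thesis
      using u(2,3) by (simp add: add_nonneg_eq_0_iff)
  qed
  have "A = B"
    by (rule flow_unique[OF T AB]) (use zero in auto)
  with u(1) show False by simp
qed

section \<open>Vertices as multiples of unit flows\<close>

definition scaled_flow :: "nat \<Rightarrow> int ^ 'n ^ 'm \<Rightarrow> int ^ 'n ^ 'm" where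
  "scaled_flow s Z = (\<chi> i j. int s * Z $ i $ j)"

lemma scaled_flow_margins:
  assumes "is_unit_flow k T Z"
  shows "(i, j) \<notin> T \<Longrightarrow> scaled_flow s Z $ i $ j = 0"
    and "(\<Sum>j\<in>UNIV. scaled_flow s Z $ i $ j) = int s"
    and "(\<Sum>i\<in>UNIV. scaled_flow s Z $ i $ j) = int (k * s)"
  using assms by (simp_all add: is_unit_flow_def scaled_flow_def mult.commute flip: sum_distrib_left)

lemma scaled_flow_in_flow_polyhedron:
  assumes Z: "is_unit_flow k T Z"
  shows "real_mat (scaled_flow s Z) \<in> flow_polyhedron k s T"
  using scaled_flow_margins[OF Z, where s = s]
  by (simp add: flow_polyhedron_def flip: of_int_sum)

lemma unit_flow_nonneg:
  fixes T :: "('m::finite \<times> 'n::{finite,linorder}) set"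
  assumes "T \<in> ST k" "CARD('m) = k * CARD('n)" "is_unit_flow k T Z"
  shows "0 \<le> Z $ i $ j"
proof (cases "(i, j) \<in> T")
  case True
  have tree: "spanning_tree T" using assms(1) by (simp add: ST_def)
  obtain Y where Y: "is_pert_flow k T Y"
    using pert_flow_ex[of T k] assms(2) tree by (auto simp: spanning_tree_altdef)
  then have "0 < Y i j"
    using ST_imp_feasible[OF assms(1,2)] True unfolding feasible_iff[OF tree Y] by auto
  then show ?thesis
    using pert_flow_pos_unit_flow(1)[OF tree True assms(3) Y] by simp
qed (use assms(3) in \<open>simp add: is_unit_flow_def\<close>)

text \<open>The edges of \<open>aux M\<close> carry a positive unperturbed flow, so they impose no condition on the
  perturbed flow.\<close>

lemma feasible_aux_iff:
  fixes M :: "real ^ 'n::{finite,linorder} ^ 'm::{finite,linorder}"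
  assumes m: "CARD('m) = k * CARD('n)" and M: "M \<in> flow_polyhedron k s {}"
  shows "spanning_tree T \<and> feasible k T (aux M) \<longleftrightarrow> T \<in> PertAux k M"
proof
  assume "T \<in> PertAux k M"
  then have T: "T \<in> ST k" "aux M \<subseteq> T" by (auto simp: PertAux_def)
  then have "feasible k T {}" by (intro ST_imp_feasible m)
  then show "spanning_tree T \<and> feasible k T (aux M)"
    using T by (auto simp: feasible_def ST_def)
next
  assume T: "spanning_tree T \<and> feasible k T (aux M)"
  then have sub: "aux M \<subseteq> T" by (simp add: feasible_def)
  obtain Y Z where Y: "is_pert_flow k T Y" and Z: "is_unit_flow k T Z"
    using pert_flow_ex[of T k] unit_flow_ex[of T k] m T by (auto simp: spanning_tree_altdef)
  have MZ: "M = real_mat (scaled_flow s Z)"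
  proof (rule flow_unique[OF _ M scaled_flow_in_flow_polyhedron[OF Z]])
    show "acyclic_edges T" using T by (simp add: spanning_tree_altdef)
    show "M $ i $ j = 0" if "(i, j) \<notin> T" for i j
      by (rule flow_polyhedron_aux_outside[OF M sub that])
    show "real_mat (scaled_flow s Z) $ i $ j = 0" if "(i, j) \<notin> T" for i j
      using scaled_flow_margins(1)[OF Z that] by simp
  qed
  have "0 < Y i j" if "(i, j) \<in> T" for i j
  proof (cases "(i, j) \<in> aux M")
    case True
    then have "0 < Z $ i $ j"
      by (auto simp: aux_def MZ scaled_flow_def zero_less_mult_iff)
    then show ?thesis
      using pert_flow_pos_unit_flow(2) T that Z Y by blast
  next
    case False
    then show ?thesis
      using T that unfolding feasible_iff[OF conjunct1[OF T] Y] by auto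
  qed
  then have "feasible k T {}"
    unfolding feasible_iff[OF conjunct1[OF T] Y] by auto
  then show "T \<in> PertAux k M"
    using feasible_imp_ST m T sub by (auto simp: PertAux_def)
qed

text \<open>Convergence is inherited from the larger cone of some spanning tree that contains
  \<open>aux M\<close>.\<close>

lemma gen_fun_fcone:
  fixes M :: "real ^ 'n::{finite,linorder} ^ 'm::{finite,linorder}"
  assumes k: "0 < k" and m: "CARD('m) = k * CARD('n)" and M: "M extreme_point_of flow_polyhedron k s {}"
  shows "gen_fun (fcone (flow_polyhedron k s {}) M) =
    (\<Sum>T\<in>PertAux k M. \<Prod>e\<in>- T. 1 / (1 - zpow (cyc T e)))"
proof -
  have MP: "M \<in> flow_polyhedron k s {}" using M by (simp add: extreme_point_of_def)
  note ac = extreme_point_acyclic[OF M]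
  obtain T where T: "spanning_tree T" "aux M \<subseteq> T"
    using acyclic_edges_extend[OF ac] by blast
  \<comment> \<open>\<open>v0\<close> sums the off-tree entries, so it pairs to 1 with every
    generator \<open>cyc T e\<close>. This shows that positive weights exist.\<close>
  define v0 :: "int ^ 'n::{finite,linorder} ^ 'm::{finite,linorder}" where "v0 = (\<chi> i j. of_bool ((i, j) \<notin> T))"
  have v0: "pairing v0 (cyc T e) = 1" if e: "e \<notin> T" for e
  proof -
    obtain i0 j0 where ij: "e = (i0, j0)" by fastforce
    have "v0 $ i $ j * cyc T e $ i $ j = (if j = j0 then of_bool (i = i0) else 0)" for i j
      using cyc_outside[of T i0 j0 i j] T e by (cases "(i, j) \<in> T") (auto simp: v0_def ij)
    then have "pairing v0 (cyc T e) = (\<Sum>i\<in>UNIV. of_bool (i = i0))"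
      by (simp add: pairing_def)
    then show ?thesis by simp
  qed
  have "has_fract (lattice_series (relaxed_points k 0 (aux M)))
      (\<Sum>T\<in>{T. spanning_tree T}. of_bool (feasible k T (aux M)) * (\<Prod>e\<in>- T. 1 / (1 - zpow (cyc T e))))"
    by (rule has_fract_relaxed_points[OF k m has_fract_unimodular])
  also have "(\<Sum>T\<in>{T. spanning_tree T}. of_bool (feasible k T (aux M)) * (\<Prod>e\<in>- T. 1 / (1 - zpow (cyc T e)))) =
      (\<Sum>T\<in>PertAux k M. \<Prod>e\<in>- T. 1 / (1 - zpow (cyc T e)))"
    by (rule sum.mono_neutral_cong_right) (use feasible_aux_iff[OF m MP] in auto)
  finally have hf: "has_fract (lattice_series (lattice_part (flow_polyhedron k 0 (aux M))))
      (\<Sum>T\<in>PertAux k M. \<Prod>e\<in>- T. 1 / (1 - zpow (cyc T e)))"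
    unfolding lattice_part_flow_polyhedron .
  show ?thesis
    unfolding fcone_flow_polyhedron[OF MP]
  proof (rule gen_fun_unique[OF is_gen_fun_gen_fun rational_flow_polyhedron no_line_flow_polyhedron[OF ac] hf])
    show "finite (cyc T ` (- T))" by simp
    show "\<forall>Y\<in>cyc T ` (- T). 0 < pairing v0 Y" using v0 by auto
    fix v :: "int ^ 'n::{finite,linorder} ^ 'm::{finite,linorder}" and t :: real
    assume v: "\<forall>Y\<in>cyc T ` (- T). 0 < pairing v Y" and t: "0 < t" "t < 1"
    have "(\<lambda>\<alpha>. t powi pairing v \<alpha>) summable_on relaxed_points k 0 T"
      using summable_tree_cone[OF T(1) _ t] v by auto
    then show "(\<lambda>\<alpha>. t powi pairing v \<alpha>) summable_on lattice_part (flow_polyhedron k 0 (aux M))"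
      unfolding lattice_part_flow_polyhedron
      by (rule summable_on_subset_banach) (use T(2) in \<open>force simp: relaxed_points_def\<close>)
  qed
qed

lemma gen_fun_flow_polyhedron:
  fixes Z :: "('m \<times> 'n) set \<Rightarrow> int ^ 'n::{finite,linorder} ^ 'm::{finite,linorder}"
  assumes k: "0 < k" and m: "CARD('m) = k * CARD('n)"
    and Z: "\<And>T. spanning_tree T \<Longrightarrow> is_unit_flow k T (Z T)"
  shows "gen_fun (flow_polyhedron k s ({} :: ('m \<times> 'n) set)) =
    (\<Sum>T\<in>ST k. zpow (scaled_flow s (Z T)) * (\<Prod>e\<in>- T. 1 / (1 - zpow (cyc T e))))"
proof -
  define \<phi> where "\<phi> T = zpow (scaled_flow s (Z T)) * (\<Prod>e\<in>- T. 1 / (1 - zpow (cyc T e)))" for T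
  have "has_fract (lattice_series (relaxed_points k s T)) (\<phi> T)" if T: "spanning_tree T" for T
    unfolding \<phi>_def
    by (rule has_fract_translate[OF has_fract_unimodular[OF T]]) (use scaled_flow_margins[OF Z[OF T]] in auto)
  then have "has_fract (lattice_series (relaxed_points k s {}))
      (\<Sum>T\<in>{T. spanning_tree T}. of_bool (feasible k T {}) * \<phi> T)"
    by (rule has_fract_relaxed_points[OF k m])
  also have "(\<Sum>T\<in>{T. spanning_tree T}. of_bool (feasible k T {}) * \<phi> T) = (\<Sum>T\<in>ST k. \<phi> T)"
  proof (rule sum.mono_neutral_cong_right)
    show "ST k \<subseteq> {T. spanning_tree T}" by (auto simp: ST_def)
  qed (use ST_imp_feasible[OF _ m] feasible_imp_ST[OF _ _ m] in auto)
  finally have hf: "has_fract (lattice_series (lattice_part (flow_polyhedron k s {}))) (\<Sum>T\<in>ST k. \<phi> T)"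
    unfolding lattice_part_flow_polyhedron .
  have ac: "acyclic_edges ({} :: ('m \<times> 'n) set)"
    by (force simp: acyclic_edges_def bip_cycle_def)
  have "gen_fun (flow_polyhedron k s ({} :: ('m \<times> 'n) set)) = (\<Sum>T\<in>ST k. \<phi> T)"
  proof (rule gen_fun_unique[OF is_gen_fun_gen_fun rational_flow_polyhedron no_line_flow_polyhedron[OF ac] hf])
    \<comment> \<open>The polytope has finitely many lattice points, so the series converges for
      every weight and \<open>C\<close> is taken empty.\<close>
    show "finite ({} :: (int ^ 'n::{finite,linorder} ^ 'm::{finite,linorder}) set)" by simp
    show "\<forall>Y\<in>{}. 0 < pairing 0 Y" by simp
    show "(\<lambda>\<alpha>. t powi pairing v \<alpha>) summable_on lattice_part (flow_polyhedron k s {})" for v and t :: real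
      unfolding lattice_part_flow_polyhedron
      by (rule summable_on_finite) (rule finite_relaxed_points_empty)
  qed
  then show ?thesis by (simp add: \<phi>_def)
qed

theorem theorem1p2:
  fixes k a b :: nat
    and r :: "real ^ 'm::{finite, linorder}"
    and c :: "real ^ 'n::{finite, linorder}"
    and P :: "(real ^ 'n::{finite, linorder} ^ 'm::{finite, linorder}) set"
  assumes "0 < k" and "0 < a" and "0 < b"
    and "CARD('m) = k * CARD('n)"
    and "CARD('m) * a = CARD('n) * b"
    and "r = (\<chi> i. real a)"
    and "c = (\<chi> j. real b)"
    and "P = transportation_polytope r c"
  shows "(\<forall>M. M extreme_point_of P \<longrightarrow>
            gen_fun (fcone P M) = (\<Sum>T\<in>PertAux k M. \<Prod>e\<in>- T. 1 / (1 - zpow (cyc T e)))) \<and>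
         (\<forall>T\<in>ST k. \<exists>!M. M extreme_point_of P \<and> aux M \<subseteq> T) \<and>
         gen_fun P =
           (\<Sum>T\<in>ST k. zpow (the_inv real_mat (tree_vertex P T)) *
              (\<Prod>e\<in>- T. 1 / (1 - zpow (cyc T e))))"
proof (intro conjI allI impI ballI)
  note k = assms(1) and m = assms(4)
  have "CARD('n) * b = CARD('n) * (k * a)"
    using assms(4,5) by (simp add: mult_ac)
  then have b: "b = k * a" by simp
  have P: "P = flow_polyhedron k a {}"
    unfolding assms(6-8) b transportation_polytope_def flow_polyhedron_def by auto
  show "gen_fun (fcone P M) = (\<Sum>T\<in>PertAux k M. \<Prod>e\<in>- T. 1 / (1 - zpow (cyc T e)))"
    if "M extreme_point_of P" for M
    unfolding P by (rule gen_fun_fcone[OF k m that[unfolded P]])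
  have "\<forall>T :: ('m \<times> 'n) set. spanning_tree T \<longrightarrow> (\<exists>Z. is_unit_flow k T Z)"
    using unit_flow_ex m by (auto simp: spanning_tree_altdef)
  then obtain Z :: "('m \<times> 'n) set \<Rightarrow> int ^ 'n::{finite,linorder} ^ 'm::{finite,linorder}"
    where Z: "\<And>T. spanning_tree T \<Longrightarrow> is_unit_flow k T (Z T)" by metis
  \<comment> \<open>Identifying the vertex as an explicit integral matrix gives existence and
    uniqueness together, and makes \<open>the_inv real_mat\<close> meaningful on it.\<close>
  have vertex: "M extreme_point_of P \<and> aux M \<subseteq> T \<longleftrightarrow> M = real_mat (scaled_flow a (Z T))"
    if T: "T \<in> ST k" for T M
  proof -
    have tree: "spanning_tree T" using T by (simp add: ST_def)
    then have ac: "acyclic_edges T" by (simp add: spanning_tree_altdef)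
    define M' where "M' = real_mat (scaled_flow a (Z T))"
    have M'_T: "M' \<in> flow_polyhedron k a T"
      unfolding M'_def by (rule scaled_flow_in_flow_polyhedron[OF Z[OF tree]])
    have M'_out: "M' $ i $ j = 0" if "(i, j) \<notin> T" for i j
      using scaled_flow_margins(1)[OF Z[OF tree] that] by (simp add: M'_def)
    have "0 \<le> M' $ i $ j" for i j
      using unit_flow_nonneg[OF T m Z[OF tree]] by (simp add: M'_def scaled_flow_def)
    then have M'_P: "M' \<in> flow_polyhedron k a {}"
      using M'_T by (simp add: flow_polyhedron_def)
    have "aux M' \<subseteq> T" using M'_out by (force simp: aux_def)
    then have "M' extreme_point_of P \<and> aux M' \<subseteq> T"
      unfolding P using acyclic_extreme_point[OF ac M'_P] by simp
    moreover have "M = M'" if "M extreme_point_of P" "aux M \<subseteq> T"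
    proof (rule flow_unique[OF ac _ M'_P])
      show M: "M \<in> flow_polyhedron k a {}"
        using that(1) by (simp add: P extreme_point_of_def)
      show "M $ i $ j = 0" if "(i, j) \<notin> T" for i j
        by (rule flow_polyhedron_aux_outside[OF M \<open>aux M \<subseteq> T\<close> that])
    qed (rule M'_out)
    ultimately show ?thesis unfolding M'_def by blast
  qed
  then show "\<exists>!M. M extreme_point_of P \<and> aux M \<subseteq> T" if "T \<in> ST k" for T
    using that by simp
  have "the_inv real_mat (tree_vertex P T) = scaled_flow a (Z T)" if "T \<in> ST k" for T
    using vertex[OF that] by (simp add: tree_vertex_def the_inv_f_f[OF inj_real_mat])
  then show "gen_fun P = (\<Sum>T\<in>ST k. zpow (the_inv real_mat (tree_vertex P T)) *
      (\<Prod>e\<in>- T. 1 / (1 - zpow (cyc T e))))"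
    using gen_fun_flow_polyhedron[OF k m Z] by (simp add: P)
qed

end
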